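(* Let $f\in L_2(\Omega)$, let $(\boldsymbol\sigma,w)\in\Sigma\times W$ be the unique solution of $$a^{\mathrm{dual}}(\boldsymbol\sigma,\boldsymbol\tau)+b^{\mathrm{dual}}(w,\boldsymbol\tau)=(f,-\varepsilon\,\mathrm{div}_{\mathcal T}\boldsymbol\tau)_\Omega,\qquad b^{\mathrm{dual}}(v,\boldsymbol\sigma)=0\qquad\text{for all }(\boldsymbol\tau,v)\in\Sigma\times W,$$ and let $(\boldsymbol\sigma_h,w_h)\in\Sigma_h\times W_h$ be the unique solution of $$a^{\mathrm{dual}}(\boldsymbol\sigma_h,\boldsymbol\tau_h)+b^{\mathrm{dual}}(w_h,\boldsymbol\tau_h)=(f,-\varepsilon\,\mathrm{div}_{\mathcal T}\boldsymbol\tau_h)_\Omega,\qquad b^{\mathrm{dual}}(v_h,\boldsymbol\sigma_h)=0\qquad\text{for all }(\boldsymbol\tau_h,v_h)\in\Sigma_h\times W_h.$$ For $T\in\mathcal T$ set $$\xi(T)^2=\|(1-\Pi_T^0)(\varepsilon\,\mathrm{div}\,\boldsymbol\sigma_h+f)\|_T^2+\|(1-\Pi_T^0)\boldsymbol\sigma_h\|_T^2+\min\{\varepsilon,h_T\}\,\|[\boldsymbol\sigma_h\cdot\boldsymbol n]\|_{\partial T\setminus\partial\Omega}^2.$$ Then there is a constant $C>0$, independent of $\varepsilon$ and of the mesh except for its shape-regularity, such that for any $T\in\mathcal T$ $$\xi(T)^2\le C\Big(\|\boldsymbol\sigma-\boldsymbol\sigma_h\|_{\Omega_T}^2+\varepsilon^2\|\mathrm{div}_{\mathcal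 T}(\boldsymbol\sigma-\boldsymbol\sigma_h)\|_{\Omega_T}^2+\min_{\boldsymbol\tau_h\in P^0(T)^d}\|\boldsymbol\sigma-\boldsymbol\tau_h\|_T^2+\min_{v_h\in P^0(T)}\varepsilon^2\|\mathrm{div}_{\mathcal T}\boldsymbol\sigma-v_h\|_T^2+\|(1-\Pi_T^0)f\|_T^2\Big).$$
   Context: $\Omega\subseteq\mathbb R^d$ ($d=2,3$) is a bounded open Lipschitz domain with polygonal/polyhedral boundary, $0<\varepsilon\le 1$; $(\cdot,\cdot)_T$ and $\|\cdot\|_T$ are the $L_2(T)$ inner product and norm. $\mathcal T$ is a conforming mesh of $\Omega$ into shape-regular simplices ($\max_{T\in\mathcal T}h_T^d/|T|\le\kappa$), $h_T=\mathrm{diam}(T)$. $\Omega_T=\mathrm{int}\big(\bigcup\{\overline{T'}:T'\in\mathcal T,\ \overline T\cap\overline{T'}\ne\emptyset\}\big)$. Continuous spaces: $\boldsymbol H(\mathrm{div};T)=\{\boldsymbol\tau\in L_2(T)^d: \mathrm{div}\,\boldsymbol\tau\in L_2(T)\}$. $\Sigma:=\boldsymbol H(\mathrm{div};\mathcal T)=\{\boldsymbol\tau\in L_2(\Omega)^d:\boldsymbol\tau|_T\in\boldsymbol H(\mathrm{div};T)\ \forall T\in\mathcal T\}$ with piecewise divergence $\mathrm{div}_{\mathcal T}$. $\mathrm{tr}^{\nabla}_{\mathcal T}:H^1(\Omega)\to\Sigma'$, $\langle\mathrm{tr}^{\nabla}_{\mathcal T}v,\boldsymbol\tau\rangle_{\partial\mathcal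 T}=\sum_{T}[(\mathrm{div}\,\boldsymbol\tau,v)_T+(\boldsymbol\tau,\nabla v)_T]$; $W:=\mathrm{tr}^{\nabla}_{\mathcal T}(H_0^1(\Omega))$. The duality $\langle w,\boldsymbol\tau\rangle_{\partial\mathcal T}$ is also written $\langle\boldsymbol\tau\cdot\boldsymbol n,w\rangle_{\partial\mathcal T}$. Bilinear forms: $a^{\mathrm{dual}}(\boldsymbol\sigma,\boldsymbol\tau)=\varepsilon^2(\mathrm{div}_{\mathcal T}\boldsymbol\sigma,\mathrm{div}_{\mathcal T}\boldsymbol\tau)_\Omega+(\boldsymbol\sigma,\boldsymbol\tau)_\Omega$, $b^{\mathrm{dual}}(w,\boldsymbol\tau)=-\varepsilon\langle\boldsymbol\tau\cdot\boldsymbol n,w\rangle_{\partial\mathcal T}$. Discrete spaces: $P^p(T)$ (resp. $P^p(\mathcal T)$) denotes polynomials on $T$ (resp. $\mathcal T$-piecewise polynomials) of degree $\le p$. $W_h=\mathrm{tr}^{\nabla}_{\mathcal T}(P^1(\mathcal T)\cap H_0^1(\Omega))$. For $T\in\mathcal T$ let $\mathcal V_T$ be its vertices, $\mathcal F_T$ its facets, $\boldsymbol n_T$ the exterior unit normal on $\partial T$, $\eta_z^T$ the barycentric coordinate of $z\in\mathcal V_T$; for $F\in\mathcal F_T$ let $z_F^T$ be the vertex opposite $F$, and set $\eta_F^T=\prod_{z\in\mathcal V_T\setminus\{z_F^T\}}\eta_z^T$, $d_F^T=\eta^T_{z_F^T}$, $\eta_{F,\varepsilon}^T=\exp(-(h_T/\varepsilon)d_F^T)\,\eta_F^T$,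 $\boldsymbol\eta_F^T=\eta_F^T\boldsymbol n_T|_F$, $\boldsymbol\eta_{F,\varepsilon}^T=\eta_{F,\varepsilon}^T\boldsymbol n_T|_F$. Fix for each $T$ a vertex $z_T\in\mathcal V_T$; $\mathcal E_{T,z_T}$ is the set of the $d$ edges of $T$ sharing $z_T$; for $E\in\mathcal E_{T,z_T}$ let $\boldsymbol t_E^T$ be a unit tangent vector and $\eta_E^T$ the product of the barycentric coordinates of the two endpoints of $E$. With $\boldsymbol{RT}^0(T)=P^0(T)^d+\boldsymbol xP^0(T)$, set $\Sigma_h=\prod_{T\in\mathcal T}\Sigma_{h,\varepsilon}(T)$, where $\Sigma_{h,\varepsilon}(T)=\boldsymbol{RT}^0(T)+\mathrm{span}\{\boldsymbol\eta_{F,\varepsilon}^T:F\in\mathcal F_T\}+\mathrm{span}\{\eta_E^T\boldsymbol t_E^T:E\in\mathcal E_{T,z_T}\}$ if $\varepsilon<h_T$, and the same with $\boldsymbol\eta_{F,\varepsilon}^T$ replaced by $\boldsymbol\eta_F^T$ if $\varepsilon\ge h_T$. $\Pi_T^0$ is the $L_2(T)$-orthogonal projection onto constants (componentwise for vectors). $[\boldsymbol\tau\cdot\boldsymbol n]$ is the jump of the normal component across a facet, taken facet by facet. *)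

theory Defs
  imports "HOL-Analysis.Analysis"
begin

text \<open>Functions are total on \<open>real ^ 'n\<close>; only their values almost everywhere on the set in
  question matter.\<close>

definition L2 :: "(real ^ 'n) set \<Rightarrow> (real ^ 'n \<Rightarrow> 'b::euclidean_space) set" where
  "L2 S = {f. f \<in> borel_measurable (lebesgue_on S) \<and>
              integrable (lebesgue_on S) (\<lambda>x. (norm (f x))\<^sup>2)}"

definition l2_inner ::
  "(real ^ 'n) set \<Rightarrow> (real ^ 'n \<Rightarrow> 'b::euclidean_space) \<Rightarrow> (real ^ 'n \<Rightarrow> 'b) \<Rightarrow> real" where
  "l2_inner S f g = (LINT x|lebesgue_on S. f x \<bullet> g x)"

definition l2_norm :: "(real ^ 'n) set \<Rightarrow> (real ^ 'n \<Rightarrow> 'b::euclidean_space) \<Rightarrow> real" where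
  "l2_norm S f = sqrt (l2_inner S f f)"

definition proj0 :: "(real ^ 'n) set \<Rightarrow> (real ^ 'n \<Rightarrow> 'b::euclidean_space) \<Rightarrow> 'b" where
  "proj0 T f = (THE c. \<forall>q. l2_inner T (\<lambda>x. f x - c) (\<lambda>_. q) = 0)"

definition grad :: "(real ^ 'n \<Rightarrow> real) \<Rightarrow> real ^ 'n \<Rightarrow> real ^ 'n" where
  "grad \<phi> x = (\<chi> i. frechet_derivative \<phi> (at x) (axis i 1))"

primrec Ck :: "nat \<Rightarrow> (real ^ 'n \<Rightarrow> real) \<Rightarrow> bool" where
  "Ck 0 \<phi> \<longleftrightarrow> continuous_on UNIV \<phi>"
| "Ck (Suc k) \<phi> \<longleftrightarrow> \<phi> differentiable_on UNIV \<and> (\<forall>i. Ck k (\<lambda>x. grad \<phi> x $ i))"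

definition test_functions :: "(real ^ 'n) set \<Rightarrow> (real ^ 'n \<Rightarrow> real) set" where
  "test_functions U = {\<phi>. (\<forall>k. Ck k \<phi>) \<and>
     compact (closure {x. \<phi> x \<noteq> 0}) \<and> closure {x. \<phi> x \<noteq> 0} \<subseteq> U}"

text \<open>Mesh elements are closed simplices, so test functions live on the interior. The operators
  \<open>weak_grad\<close> and \<open>weak_div\<close> choose one representative of the almost-everywhere class.\<close>

definition is_weak_grad ::
  "(real ^ 'n) set \<Rightarrow> (real ^ 'n \<Rightarrow> real) \<Rightarrow> (real ^ 'n \<Rightarrow> real ^ 'n) \<Rightarrow> bool" where
  "is_weak_grad S v g \<longleftrightarrow> (\<forall>\<phi>\<in>test_functions (interior S). \<forall>i.
     l2_inner S v (\<lambda>x. grad \<phi> x $ i) = - l2_inner S (\<lambda>x. g x $ i) \<phi>)"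

definition is_weak_div ::
  "(real ^ 'n) set \<Rightarrow> (real ^ 'n \<Rightarrow> real ^ 'n) \<Rightarrow> (real ^ 'n \<Rightarrow> real) \<Rightarrow> bool" where
  "is_weak_div S \<tau> g \<longleftrightarrow> (\<forall>\<phi>\<in>test_functions (interior S).
     l2_inner S \<tau> (grad \<phi>) = - l2_inner S g \<phi>)"

definition weak_grad :: "(real ^ 'n) set \<Rightarrow> (real ^ 'n \<Rightarrow> real) \<Rightarrow> real ^ 'n \<Rightarrow> real ^ 'n" where
  "weak_grad S v = (SOME g. g \<in> L2 S \<and> is_weak_grad S v g)"

definition weak_div :: "(real ^ 'n) set \<Rightarrow> (real ^ 'n \<Rightarrow> real ^ 'n) \<Rightarrow> real ^ 'n \<Rightarrow> real" where
  "weak_div S \<tau> = (SOME g. g \<in> L2 S \<and> is_weak_div S \<tau> g)"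

definition H1 :: "(real ^ 'n) set \<Rightarrow> (real ^ 'n \<Rightarrow> real) set" where
  "H1 S = {v \<in> L2 S. \<exists>g\<in>L2 S. is_weak_grad S v g}"

definition H10 :: "(real ^ 'n) set \<Rightarrow> (real ^ 'n \<Rightarrow> real) set" where
  "H10 S = {v \<in> H1 S. \<forall>e>0. \<exists>\<phi>\<in>test_functions (interior S).
     (l2_norm S (\<lambda>x. v x - \<phi> x))\<^sup>2 + (l2_norm S (\<lambda>x. weak_grad S v x - grad \<phi> x))\<^sup>2 < e}"

definition Hdiv :: "(real ^ 'n) set \<Rightarrow> (real ^ 'n \<Rightarrow> real ^ 'n) set" where
  "Hdiv S = {\<tau> \<in> L2 S. \<exists>g\<in>L2 S. is_weak_div S \<tau> g}"

text \<open>Locally \<open>\<Omega>\<close> is the epigraph of a Lipschitz function over the hyperplane orthogonal to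
  some unit vector \<open>e\<close>.\<close>

definition lipschitz_domain :: "(real ^ 'n) set \<Rightarrow> bool" where
  "lipschitz_domain \<Omega> \<longleftrightarrow> open \<Omega> \<and> connected \<Omega> \<and> \<Omega> \<noteq> {} \<and>
     (\<forall>x\<in>frontier \<Omega>. \<exists>r>0. \<exists>e L g. norm e = 1 \<and> L-lipschitz_on {y. y \<bullet> e = 0} g \<and>
        \<Omega> \<inter> ball x r = {y \<in> ball x r. g (y - (y \<bullet> e) *\<^sub>R e) < y \<bullet> e})"

definition polyhedral_boundary :: "(real ^ 'n) set \<Rightarrow> bool" where
  "polyhedral_boundary \<Omega> \<longleftrightarrow> (\<exists>P. finite P \<and>
     (\<forall>F\<in>P. polytope F \<and> aff_dim F = int CARD('n) - 1) \<and> frontier \<Omega> = \<Union>P)"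

definition conforming_mesh :: "(real ^ 'n) set \<Rightarrow> (real ^ 'n) set set \<Rightarrow> bool" where
  "conforming_mesh \<Omega> \<T> \<longleftrightarrow> triangulation \<T> \<and> (\<forall>T\<in>\<T>. int CARD('n) simplex T) \<and>
     \<Union>\<T> = closure \<Omega>"

definition shape_regular :: "real \<Rightarrow> (real ^ 'n) set set \<Rightarrow> bool" where
  "shape_regular \<kappa> \<T> \<longleftrightarrow> (\<forall>T\<in>\<T>. diameter T ^ CARD('n) / measure lebesgue T \<le> \<kappa>)"

definition patch :: "(real ^ 'n) set set \<Rightarrow> (real ^ 'n) set \<Rightarrow> (real ^ 'n) set" where
  "patch \<T> T = interior (\<Union>{T' \<in> \<T>. T \<inter> T' \<noteq> {}})"

definition Hdiv_mesh ::
  "(real ^ 'n) set \<Rightarrow> (real ^ 'n) set set \<Rightarrow> (real ^ 'n \<Rightarrow> real ^ 'n) set" where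
  "Hdiv_mesh \<Omega> \<T> = {\<tau> \<in> L2 \<Omega>. \<forall>T\<in>\<T>. \<tau> \<in> Hdiv T}"

definition pw_div ::
  "(real ^ 'n) set set \<Rightarrow> (real ^ 'n \<Rightarrow> real ^ 'n) \<Rightarrow> real ^ 'n \<Rightarrow> real" where
  "pw_div \<T> \<tau> x = (\<Sum>T | T \<in> \<T> \<and> x \<in> interior T. weak_div T \<tau> x)"

definition tr_grad ::
  "(real ^ 'n) set \<Rightarrow> (real ^ 'n) set set \<Rightarrow> (real ^ 'n \<Rightarrow> real) \<Rightarrow> (real ^ 'n \<Rightarrow> real ^ 'n) \<Rightarrow> real"
  where
  "tr_grad \<Omega> \<T> v = (\<lambda>\<tau>\<in>Hdiv_mesh \<Omega> \<T>.
     \<Sum>T\<in>\<T>. l2_inner T (weak_div T \<tau>) v + l2_inner T \<tau> (weak_grad \<Omega> v))"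

definition W_space ::
  "(real ^ 'n) set \<Rightarrow> (real ^ 'n) set set \<Rightarrow> ((real ^ 'n \<Rightarrow> real ^ 'n) \<Rightarrow> real) set" where
  "W_space \<Omega> \<T> = tr_grad \<Omega> \<T> ` H10 \<Omega>"

definition a_dual ::
  "real \<Rightarrow> (real ^ 'n) set \<Rightarrow> (real ^ 'n) set set \<Rightarrow>
     (real ^ 'n \<Rightarrow> real ^ 'n) \<Rightarrow> (real ^ 'n \<Rightarrow> real ^ 'n) \<Rightarrow> real" where
  "a_dual \<epsilon> \<Omega> \<T> \<sigma> \<tau> = \<epsilon>\<^sup>2 * l2_inner \<Omega> (pw_div \<T> \<sigma>) (pw_div \<T> \<tau>) + l2_inner \<Omega> \<sigma> \<tau>"

definition b_dual ::
  "real \<Rightarrow> ((real ^ 'n \<Rightarrow> real ^ 'n) \<Rightarrow> real) \<Rightarrow> (real ^ 'n \<Rightarrow> real ^ 'n) \<Rightarrow> real" where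
  "b_dual \<epsilon> w \<tau> = - \<epsilon> * w \<tau>"

definition solves_dual ::
  "real \<Rightarrow> (real ^ 'n) set \<Rightarrow> (real ^ 'n) set set \<Rightarrow> (real ^ 'n \<Rightarrow> real) \<Rightarrow>
     (real ^ 'n \<Rightarrow> real ^ 'n) set \<Rightarrow> ((real ^ 'n \<Rightarrow> real ^ 'n) \<Rightarrow> real) set \<Rightarrow>
     (real ^ 'n \<Rightarrow> real ^ 'n) \<Rightarrow> ((real ^ 'n \<Rightarrow> real ^ 'n) \<Rightarrow> real) \<Rightarrow> bool" where
  "solves_dual \<epsilon> \<Omega> \<T> f S V \<sigma> w \<longleftrightarrow> \<sigma> \<in> S \<and> w \<in> V \<and>
     (\<forall>\<tau>\<in>S. a_dual \<epsilon> \<Omega> \<T> \<sigma> \<tau> + b_dual \<epsilon> w \<tau> = l2_inner \<Omega> f (\<lambda>x. - \<epsilon> * pw_div \<T> \<tau> x)) \<and>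
     (\<forall>v\<in>V. b_dual \<epsilon> v \<sigma> = 0)"

definition poly_space :: "nat \<Rightarrow> (real ^ 'n \<Rightarrow> real) set" where
  "poly_space p = {q. \<exists>c :: ('n \<Rightarrow> nat) \<Rightarrow> real.
     q = (\<lambda>x. \<Sum>\<alpha> | sum \<alpha> UNIV \<le> p. c \<alpha> * (\<Prod>i\<in>UNIV. x $ i ^ \<alpha> i))}"

definition pw_poly :: "nat \<Rightarrow> (real ^ 'n) set set \<Rightarrow> (real ^ 'n \<Rightarrow> real) set" where
  "pw_poly p \<T> = {v. \<forall>T\<in>\<T>. \<exists>q\<in>poly_space p. \<forall>x\<in>interior T. v x = q x}"

definition Wh_space ::
  "(real ^ 'n) set \<Rightarrow> (real ^ 'n) set set \<Rightarrow> ((real ^ 'n \<Rightarrow> real ^ 'n) \<Rightarrow> real) set" where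
  "Wh_space \<Omega> \<T> = tr_grad \<Omega> \<T> ` (pw_poly 1 \<T> \<inter> H10 \<Omega>)"

definition vertices :: "(real ^ 'n) set \<Rightarrow> (real ^ 'n) set" where
  "vertices T = {z. z extreme_point_of T}"

definition bary :: "(real ^ 'n) set \<Rightarrow> real ^ 'n \<Rightarrow> real ^ 'n \<Rightarrow> real" where
  "bary T z x = (THE u. (\<forall>y. y \<notin> vertices T \<longrightarrow> u y = 0) \<and> sum u (vertices T) = 1 \<and>
     (\<Sum>y\<in>vertices T. u y *\<^sub>R y) = x) z"

definition outer_normal :: "(real ^ 'n) set \<Rightarrow> (real ^ 'n) set \<Rightarrow> real ^ 'n" where
  "outer_normal T F = (THE n. norm n = 1 \<and> (\<forall>x\<in>F. \<forall>y\<in>T. n \<bullet> (y - x) \<le> 0))"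

definition opposite_vertex :: "(real ^ 'n) set \<Rightarrow> (real ^ 'n) set \<Rightarrow> real ^ 'n" where
  "opposite_vertex T F = (THE z. z \<in> vertices T \<and> z \<notin> F)"

definition facet_bubble :: "(real ^ 'n) set \<Rightarrow> (real ^ 'n) set \<Rightarrow> real ^ 'n \<Rightarrow> real" where
  "facet_bubble T F x = (\<Prod>z\<in>vertices T - {opposite_vertex T F}. bary T z x)"

definition facet_bubble_eps ::
  "real \<Rightarrow> (real ^ 'n) set \<Rightarrow> (real ^ 'n) set \<Rightarrow> real ^ 'n \<Rightarrow> real" where
  "facet_bubble_eps \<epsilon> T F x =
     exp (- (diameter T / \<epsilon>) * bary T (opposite_vertex T F) x) * facet_bubble T F x"

definition edge_bubble :: "(real ^ 'n) set \<Rightarrow> (real ^ 'n) set \<Rightarrow> real ^ 'n \<Rightarrow> real" where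
  "edge_bubble T E x = (\<Prod>z\<in>vertices E. bary T z x)"

definition edge_tangent :: "(real ^ 'n) set \<Rightarrow> real ^ 'n" where
  "edge_tangent E = (SOME t. norm t = 1 \<and> (\<exists>a b s. a \<noteq> b \<and> E = closed_segment a b \<and> b - a = s *\<^sub>R t))"

definition RT0 :: "(real ^ 'n \<Rightarrow> real ^ 'n) set" where
  "RT0 = {\<rho>. \<exists>a c. \<rho> = (\<lambda>x. a + c *\<^sub>R x)}"

definition Sigma_h_local ::
  "real \<Rightarrow> (real ^ 'n) set \<Rightarrow> real ^ 'n \<Rightarrow> (real ^ 'n \<Rightarrow> real ^ 'n) set" where
  "Sigma_h_local \<epsilon> T z = {\<tau>. \<exists>\<rho>\<in>RT0. \<exists>\<alpha> \<beta>. \<tau> = (\<lambda>x. \<rho> x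
     + (\<Sum>F | F facet_of T. (\<alpha> F * (if \<epsilon> < diameter T then facet_bubble_eps \<epsilon> T F x
          else facet_bubble T F x)) *\<^sub>R outer_normal T F)
     + (\<Sum>E | E edge_of T \<and> z \<in> E. (\<beta> E * edge_bubble T E x) *\<^sub>R edge_tangent E))}"

definition Sigma_h ::
  "real \<Rightarrow> (real ^ 'n) set \<Rightarrow> (real ^ 'n) set set \<Rightarrow> ((real ^ 'n) set \<Rightarrow> real ^ 'n) \<Rightarrow>
     (real ^ 'n \<Rightarrow> real ^ 'n) set" where
  "Sigma_h \<epsilon> \<Omega> \<T> zT = {\<tau> \<in> Hdiv_mesh \<Omega> \<T>.
     \<forall>T\<in>\<T>. \<exists>\<rho>\<in>Sigma_h_local \<epsilon> T (zT T). \<forall>x\<in>interior T. \<tau> x = \<rho> x}"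

text \<open>One-sided trace of the restriction to \<open>T\<close>, as a limit from the interior; elements of
  \<open>Sigma_h\<close> are determined only in the interior of each simplex.\<close>

definition trace_from :: "(real ^ 'n) set \<Rightarrow> (real ^ 'n \<Rightarrow> real ^ 'n) \<Rightarrow> real ^ 'n \<Rightarrow> real ^ 'n" where
  "trace_from T \<tau> x = Lim (at x within interior T) \<tau>"

definition normal_jump ::
  "(real ^ 'n) set set \<Rightarrow> (real ^ 'n) set \<Rightarrow> (real ^ 'n \<Rightarrow> real ^ 'n) \<Rightarrow> real ^ 'n \<Rightarrow> real" where
  "normal_jump \<T> F \<tau> x =
     (\<Sum>T | T \<in> \<T> \<and> F facet_of T. trace_from T \<tau> x \<bullet> outer_normal T F)"

text \<open>Surface integral over a set \<open>A\<close> contained in a hyperplane with unit normal \<open>n\<close>: by Fubini it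
  is the volume integral over the prism with base \<open>A\<close> and height 1 of the integrand extended
  constantly in direction \<open>n\<close>. The point \<open>p\<close> of \<open>A\<close> only serves to fix the hyperplane onto which
  \<open>x\<close> is projected.\<close>

definition flat_surface_integral ::
  "real ^ 'n \<Rightarrow> (real ^ 'n) set \<Rightarrow> (real ^ 'n \<Rightarrow> real) \<Rightarrow> real" where
  "flat_surface_integral n A g = (let p = (SOME p. p \<in> A) in
     LINT x|lebesgue_on {y + s *\<^sub>R n | y s. y \<in> A \<and> 0 \<le> s \<and> s \<le> 1}.
       g (x - ((x - p) \<bullet> n) *\<^sub>R n))"

definition jump_norm_sq ::
  "(real ^ 'n) set \<Rightarrow> (real ^ 'n) set set \<Rightarrow> (real ^ 'n \<Rightarrow> real ^ 'n) \<Rightarrow> (real ^ 'n) set \<Rightarrow> real" where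
  "jump_norm_sq \<Omega> \<T> \<tau> T = (\<Sum>F | F facet_of T.
     flat_surface_integral (outer_normal T F) (F - frontier \<Omega>) (\<lambda>x. (normal_jump \<T> F \<tau> x)\<^sup>2))"

definition estimator_sq ::
  "real \<Rightarrow> (real ^ 'n) set \<Rightarrow> (real ^ 'n) set set \<Rightarrow> (real ^ 'n \<Rightarrow> real) \<Rightarrow>
     (real ^ 'n \<Rightarrow> real ^ 'n) \<Rightarrow> (real ^ 'n) set \<Rightarrow> real" where
  "estimator_sq \<epsilon> \<Omega> \<T> f \<sigma>h T =
     (let r = (\<lambda>x. \<epsilon> * weak_div T \<sigma>h x + f x) in (l2_norm T (\<lambda>x. r x - proj0 T r))\<^sup>2)
     + (l2_norm T (\<lambda>x. \<sigma>h x - proj0 T \<sigma>h))\<^sup>2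
     + min \<epsilon> (diameter T) * jump_norm_sq \<Omega> \<T> \<sigma>h T"

end

theory Submission
  imports Defs
begin

text \<open>The two volume terms are handled by the best-approximation property of the projection and the
  triangle inequality. For the jump on an interior facet \<open>F\<close> shared by \<open>T\<close> and \<open>T'\<close>, the normal trace of a
  local shape function on \<open>F\<close> has the form \<open>a + b \<eta>\<close> with \<open>\<eta>\<close> the facet bubble, because all other bubbles
  vanish on \<open>F\<close> or are tangential. Hence the jump \<open>J\<close> is controlled on all of \<open>F\<close> by its value \<open>J p\<close> at a
  suitable point \<open>p\<close>, and it keeps its sign and size on a disc around \<open>p\<close> of radius
  \<open>r\<close> comparable to the diameter of \<open>T\<close>. Testing with a smooth bump \<open>\<phi>\<close> of
  radius \<open>r\<close> around \<open>p\<close>, squeezed to width \<open>\<delta> = min \<epsilon> r\<close> in the normal direction, gives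
  \<open>\<bar>J p\<bar> r\<^sup>d\<^sup>-\<^sup>1\<close> up to constants as a lower bound of the integral of \<open>\<phi> J\<close> over \<open>F\<close>. Since \<open>\<sigma>\<close> is
  annihilated by the trace of \<open>\<phi>\<close>, this integral equals, up to sign, the elementwise sum of
  \<open>(div (\<sigma> - \<sigma>h), \<phi>) + (\<sigma> - \<sigma>h, grad \<phi>)\<close>, and the squared norms of \<open>\<phi>\<close> and \<open>grad \<phi>\<close> are of order
  \<open>r\<^sup>d\<^sup>-\<^sup>1 \<delta>\<close> and \<open>r\<^sup>d\<^sup>-\<^sup>1 / \<delta>\<close>.\<close>

section \<open>Smooth functions\<close>

text \<open>Three scales meet: \<open>\<epsilon>\<close>, the element size \<open>h\<close> and the
  unit height of the layers that encode surface integrals. Squaring the tested identity gives, up to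
  constants, \<open>(J p)^2 r^(d-1) \<delta> \<le> \<delta>^2 |div e|^2 + |e|^2\<close> for the
  error \<open>e\<close>. Now \<open>\<delta> \<le> \<epsilon>\<close> yields the weighted
  divergence error, and \<open>r = c' * h\<close> with \<open>c' \<le> 1\<close> makes
  \<open>\<delta>\<close> at least \<open>c' * min \<epsilon> h\<close>; this is what keeps
  \<open>\<epsilon>\<close> out of the constants. The unit height is why \<open>r \<le> 1\<close> is
  imposed and why the diameter of the domain enters. A bump supported near the relative interior of
  the facet avoids a trace theory on simplices: on its support \<open>T\<close> coincides with a
  half-space, where the divergence theorem reduces to translation invariance of Lebesgue measure.
  The price is a ball around \<open>p\<close> that fits into \<open>T\<close> and its neighbour with
  radius comparable to \<open>h\<close>. It comes from the gradients of the barycentric coordinates,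
  bounded by shape regularity, and from an edge of the common facet, which compares the two
  diameters.\<close>

lemma grad_eqI:
  assumes "(f has_derivative D) (at x)"
  shows "grad f x $ i = D (axis i 1)"
  using frechet_derivative_at[OF assms] by (simp add: grad_def)

lemma grad_const [simp]: "grad (\<lambda>_. c) x = 0"
  by (vector grad_eqI[OF has_derivative_const])

lemma Ck_imp_continuous: "Ck k f \<Longrightarrow> continuous_on UNIV f"
  by (cases k) (auto intro: differentiable_imp_continuous_on)

lemma Ck_SucD: "Ck (Suc k) f \<Longrightarrow> Ck k f"
proof (induction k arbitrary: f)
  case 0
  then show ?case by (auto intro: differentiable_imp_continuous_on)
next
  case (Suc k)
  then show ?case by (meson Ck.simps(2))
qed

lemma Ck_const [simp]: "Ck k (\<lambda>_. c)"
  by (induction k arbitrary: c) (simp_all add: continuous_on_const)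

text \<open>A derivative is determined by its values on the coordinate axes, which are the
  components of \<open>grad\<close>. Smoothness of sums, products and compositions thus follows by
  induction on the order from the matching derivative rule.\<close>

lemma Ck_Suc_has_derivative:
  fixes f :: "real ^ 'n \<Rightarrow> real"
  assumes "\<And>x. (f has_derivative D x) (at x)" "\<And>i. Ck k (\<lambda>x. D x (axis i 1))"
  shows "Ck (Suc k) f"
proof -
  have "f differentiable_on UNIV"
    using assms(1) by (auto simp: differentiable_on_def differentiable_def)
  moreover have "(\<lambda>x. grad f x $ i) = (\<lambda>x. D x (axis i 1))" for i
    using grad_eqI[OF assms(1)] by auto
  ultimately show ?thesis using assms(2) by simp
qed

lemma Ck_linear: "linear f \<Longrightarrow> Ck k (f :: real ^ 'n \<Rightarrow> real)"
proof (cases k)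
  case 0
  then show "linear f \<Longrightarrow> ?thesis" by (simp add: linear_continuous_on linear_linear)
next
  case (Suc j)
  assume "linear f"
  have "(f has_derivative f) (at x)" for x
    using \<open>linear f\<close> by (simp add: bounded_linear_imp_has_derivative linear_linear)
  then show ?thesis unfolding Suc by (rule Ck_Suc_has_derivative) simp
qed

lemma Ck_differentiable:
  assumes "Ck (Suc k) f"
  shows "(f has_derivative frechet_derivative f (at x)) (at x)"
  using assms frechet_derivative_works by (auto simp: differentiable_on_def)

lemma grad_inner:
  fixes f :: "real ^ 'n \<Rightarrow> real"
  assumes "(f has_derivative D) (at x)"
  shows "D u = grad f x \<bullet> u"
proof -
  have l: "linear D" using assms has_derivative_linear by blast
  have "D u = D (\<Sum>i\<in>UNIV. (u $ i) *\<^sub>R axis i 1)"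
    using basis_expansion[of u] by (simp add: scalar_mult_eq_scaleR)
  also have "\<dots> = (\<Sum>i\<in>UNIV. u $ i * D (axis i 1))"
    using l by (simp add: linear_sum linear_cmul)
  finally show ?thesis
    by (simp add: inner_vec_def grad_eqI[OF assms] mult.commute)
qed

lemma Ck_has_derivative:
  assumes "Ck (Suc k) f"
  shows "(f has_derivative (\<lambda>u. grad f x \<bullet> u)) (at x)"
  using Ck_differentiable[OF assms, of x] grad_inner[OF Ck_differentiable[OF assms, of x]]
  by (metis (no_types, lifting) ext)

lemma Ck_add:
  fixes f g :: "real ^ 'n \<Rightarrow> real"
  assumes "Ck k f" "Ck k g" shows "Ck k (\<lambda>x. f x + g x)"
  using assms
proof (induction k arbitrary: f g)
  case 0
  then show ?case by (simp add: continuous_on_add)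
next
  case (Suc k)
  show ?case
  proof (rule Ck_Suc_has_derivative)
    show "((\<lambda>x. f x + g x) has_derivative (\<lambda>u. grad f x \<bullet> u + grad g x \<bullet> u)) (at x)" for x
      by (intro has_derivative_add Ck_has_derivative[OF Suc.prems(1)] Ck_has_derivative[OF Suc.prems(2)])
    show "Ck k (\<lambda>x. grad f x \<bullet> axis i 1 + grad g x \<bullet> axis i 1)" for i
      using Suc by (simp add: inner_axis)
  qed
qed

lemma Ck_mult:
  fixes f g :: "real ^ 'n \<Rightarrow> real"
  assumes "Ck k f" "Ck k g" shows "Ck k (\<lambda>x. f x * g x)"
  using assms
proof (induction k arbitrary: f g)
  case 0
  then show ?case by (simp add: continuous_on_mult)
next
  case (Suc k)
  show ?case
  proof (rule Ck_Suc_has_derivative)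
    show "((\<lambda>x. f x * g x) has_derivative (\<lambda>u. f x * (grad g x \<bullet> u) + (grad f x \<bullet> u) * g x)) (at x)" for x
      by (intro has_derivative_mult Ck_has_derivative[OF Suc.prems(1)] Ck_has_derivative[OF Suc.prems(2)])
    show "Ck k (\<lambda>x. f x * (grad g x \<bullet> axis i 1) + (grad f x \<bullet> axis i 1) * g x)" for i
      using Suc.prems Ck_SucD[OF Suc.prems(1)] Ck_SucD[OF Suc.prems(2)]
      by (intro Ck_add Suc.IH) (auto simp: inner_axis)
  qed
qed

lemma Ck_sum:
  fixes f :: "'a \<Rightarrow> real ^ 'n \<Rightarrow> real"
  assumes "\<And>i. i \<in> I \<Longrightarrow> Ck k (f i)" shows "Ck k (\<lambda>x. \<Sum>i\<in>I. f i x)"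
  using assms
  by (induction I rule: infinite_finite_induct) (auto intro!: Ck_add)

lemma Ck_prod:
  fixes f :: "'a \<Rightarrow> real ^ 'n \<Rightarrow> real"
  assumes "\<And>i. i \<in> I \<Longrightarrow> Ck k (f i)" shows "Ck k (\<lambda>x. \<Prod>i\<in>I. f i x)"
  using assms
  by (induction I rule: infinite_finite_induct) (auto intro!: Ck_mult)

lemma Ck_affine: "Ck k (\<lambda>x :: real ^ 'n. a + g \<bullet> x)"
  by (rule Ck_add[OF Ck_const Ck_linear]) (simp add: bounded_linear.linear bounded_linear_inner_right)

lemma Ck_exp:
  fixes f :: "real ^ 'n \<Rightarrow> real"
  assumes "Ck k f" shows "Ck k (\<lambda>x. exp (f x))"
  using assms
proof (induction k arbitrary: f)
  case 0
  then show ?case by (simp add: continuous_on_exp)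
next
  case (Suc k)
  show ?case
  proof (rule Ck_Suc_has_derivative)
    show "((\<lambda>x. exp (f x)) has_derivative (\<lambda>u. exp (f x) * (grad f x \<bullet> u))) (at x)" for x
      by (rule has_derivative_eq_rhs[OF has_derivative_exp[OF Ck_has_derivative[OF Suc.prems]]]) auto
    show "Ck k (\<lambda>x. exp (f x) * (grad f x \<bullet> axis i 1))" for i
      using Suc.prems Suc.IH[OF Ck_SucD[OF Suc.prems]] by (intro Ck_mult) (auto simp: inner_axis)
  qed
qed

section \<open>Smooth cut-offs on the real line built from the flat function
  \<open>exp (- inverse t)\<close>\<close>

definition exp_bump :: "nat \<Rightarrow> real \<Rightarrow> real" where
  "exp_bump m t = (if t \<le> 0 then 0 else inverse t ^ m * exp (- inverse t))"

lemma inverse_power_exp_tendsto_0: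
  "((\<lambda>t :: real. inverse t ^ m * exp (- inverse t)) \<longlongrightarrow> 0) (at_right 0)"
proof -
  have "((\<lambda>y. y ^ m / exp y) \<longlongrightarrow> (0::real)) at_top"
    by (rule tendsto_power_div_exp_0)
  from filterlim_compose[OF this filterlim_inverse_at_top_right] show ?thesis
    by (simp add: exp_minus divide_inverse)
qed

text \<open>The powers of \<open>inverse t\<close> are part of \<open>exp_bump\<close> because the
  family is then closed under differentiation. At \<open>t = 0\<close> the right difference quotient
  of index \<open>m\<close> is \<open>exp_bump (Suc m)\<close>, which tends to 0, and the left one
  is 0.\<close>

lemma exp_bump_deriv:
  "(exp_bump m has_real_derivative (- real m * exp_bump (Suc m) t + exp_bump (Suc (Suc m)) t)) (at t)"
proof (cases t "0 :: real" rule: linorder_cases)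
  case less
  have "((\<lambda>_. 0) has_real_derivative 0) (at t)" by simp
  then have "(exp_bump m has_real_derivative 0) (at t)"
    by (rule DERIV_cong_ev[THEN iffD1, rotated -1])
      (use less in \<open>auto simp: exp_bump_def intro!: eventually_mono[OF eventually_nhds_in_open[of "{..<0}"]]\<close>)
  then show ?thesis using less by (simp add: exp_bump_def)
next
  case greater
  have "((\<lambda>t. inverse t ^ m * exp (- inverse t)) has_real_derivative
      (- real m * (inverse t ^ Suc m * exp (- inverse t)) + inverse t ^ Suc (Suc m) * exp (- inverse t))) (at t)"
  proof (rule DERIV_cong)
    show "((\<lambda>t. inverse t ^ m * exp (- inverse t)) has_real_derivative
      (real m * (- (inverse t * 1 * inverse t) * inverse t ^ (m - Suc 0))) * exp (- inverse t)
        + exp (- inverse t) * (- (- (inverse t * 1 * inverse t))) * inverse t ^ m) (at t)"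
      using greater by (intro DERIV_mult DERIV_power DERIV_fun_exp DERIV_minus DERIV_inverse' DERIV_ident) auto
    \<comment> \<open>For \<open>m = 0\<close> the exponent \<open>m - Suc 0\<close> truncates to 0,
      but then the factor \<open>real m\<close> vanishes.\<close>
    have "real m * (- (inverse t * inverse t) * inverse t ^ (m - Suc 0)) = - real m * inverse t ^ Suc m"
      by (cases m) (simp_all add: algebra_simps)
    then show "(real m * (- (inverse t * 1 * inverse t) * inverse t ^ (m - Suc 0))) * exp (- inverse t)
        + exp (- inverse t) * (- (- (inverse t * 1 * inverse t))) * inverse t ^ m
      = - real m * (inverse t ^ Suc m * exp (- inverse t)) + inverse t ^ Suc (Suc m) * exp (- inverse t)"
      by simp
  qed
  then have "(exp_bump m has_real_derivative
      (- real m * (inverse t ^ Suc m * exp (- inverse t)) + inverse t ^ Suc (Suc m) * exp (- inverse t))) (at t)"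
    by (rule DERIV_cong_ev[THEN iffD1, rotated -1])
      (use greater in \<open>auto simp: exp_bump_def intro!: eventually_mono[OF eventually_nhds_in_open[of "{0<..}"]]\<close>)
  then show ?thesis using greater by (simp add: exp_bump_def)
next
  case equal
  have r: "((\<lambda>h. exp_bump m h / h) \<longlongrightarrow> 0) (at_right 0)"
    using inverse_power_exp_tendsto_0[of "Suc m"]
    by (rule tendsto_cong[THEN iffD1, rotated -1])
      (rule eventually_mono[OF eventually_at_right_less[of 0]], auto simp: exp_bump_def field_simps)
  have l: "((\<lambda>h. exp_bump m h / h) \<longlongrightarrow> 0) (at_left 0)"
    by (rule tendsto_eventually) (auto simp: exp_bump_def eventually_at_filter)
  have "((\<lambda>h. exp_bump m h / h) \<longlongrightarrow> 0) (at 0)"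
    using l r by (simp add: filterlim_split_at)
  then show ?thesis using equal by (simp add: DERIV_def exp_bump_def)
qed

lemma exp_bump_nonpos [simp]: "t \<le> 0 \<Longrightarrow> exp_bump m t = 0"
  and exp_bump_pos: "0 < t \<Longrightarrow> 0 < exp_bump m t"
  and exp_bump_nonneg [simp]: "0 \<le> exp_bump m t"
  by (auto simp: exp_bump_def)

lemma exp_bump_0_le_1: "exp_bump 0 t \<le> 1"
  by (simp add: exp_bump_def)

lemma exp_bump_0_mono: "s \<le> t \<Longrightarrow> exp_bump 0 s \<le> exp_bump 0 t"
  by (auto simp: exp_bump_def le_imp_inverse_le)

text \<open>The bound is \<open>y^2 / 2 \<le> exp y\<close> at \<open>y = inverse t\<close>. Since
  \<open>exp_bump 2\<close> is the derivative of \<open>exp_bump 0\<close>, it controls the gradient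
  of every cut-off built from \<open>exp_bump 0\<close>.\<close>

lemma exp_bump_2_le_2: "exp_bump 2 t \<le> 2"
proof (cases "t > 0")
  case True
  define y where "y = inverse t"
  have y: "y > 0" using True by (simp add: y_def)
  have "1 + y + y\<^sup>2 / 2 \<le> exp y" using y exp_lower_Taylor_quadratic[of y] by simp
  then have "y\<^sup>2 \<le> 2 * exp y" using y by (simp add: field_simps)
  then have "y\<^sup>2 * exp (- y) \<le> 2" by (simp add: exp_minus field_simps)
  then show ?thesis using True by (simp add: exp_bump_def y_def)
qed simp

text \<open>The induction on the order runs over all \<open>m\<close> at once, since each
  differentiation shifts the index by one and by two.\<close>

lemma Ck_exp_bump:
  fixes f :: "real ^ 'n \<Rightarrow> real"
  assumes "Ck k f" shows "Ck k (\<lambda>x. exp_bump m (f x))"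
  using assms
proof (induction k arbitrary: f m)
  case 0
  have "continuous_on UNIV (exp_bump m)"
    using exp_bump_deriv by (meson DERIV_continuous continuous_at_imp_continuous_on)
  with 0 show ?case
    using continuous_on_compose2[of UNIV "exp_bump m" UNIV f] by auto
next
  case (Suc k)
  let ?D = "\<lambda>x. - real m * exp_bump (Suc m) (f x) + exp_bump (Suc (Suc m)) (f x)"
  show ?case
  proof (rule Ck_Suc_has_derivative)
    show "((\<lambda>x. exp_bump m (f x)) has_derivative (\<lambda>u. ?D x * (grad f x \<bullet> u))) (at x)" for x
      using has_derivative_compose[OF Ck_has_derivative[OF Suc.prems]
          exp_bump_deriv[unfolded has_field_derivative_def]] by simp
    have "Ck k (\<lambda>x. exp_bump j (f x))" for j using Suc Ck_SucD by blast
    then show "Ck k (\<lambda>x. ?D x * (grad f x \<bullet> axis i 1))" for i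
      using Suc.prems by (intro Ck_mult Ck_add) (auto simp: inner_axis)
  qed
qed

section \<open>Square-integrable functions\<close>

lemma norm_inner_le_squares: "norm (x \<bullet> y) \<le> (norm x)\<^sup>2 + (norm (y :: 'a::real_inner))\<^sup>2"
proof -
  have "\<bar>x \<bullet> y\<bar> \<le> norm x * norm y" by (rule Cauchy_Schwarz_ineq2)
  also have "\<dots> \<le> (norm x)\<^sup>2 + (norm y)\<^sup>2"
    using sum_squares_bound[of "norm x" "norm y"] mult_nonneg_nonneg[OF norm_ge_zero[of x] norm_ge_zero[of y]]
    by linarith
  finally show ?thesis by simp
qed

lemma norm_add_squared_le: "(norm (x + y))\<^sup>2 \<le> 2 * (norm x)\<^sup>2 + 2 * (norm (y :: 'a::real_inner))\<^sup>2"
proof -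
  have "(norm (x + y))\<^sup>2 \<le> (norm x + norm y)\<^sup>2"
    by (rule power_mono[OF norm_triangle_ineq]) simp
  also have "\<dots> \<le> 2 * (norm x)\<^sup>2 + 2 * (norm y)\<^sup>2"
    using sum_squares_bound[of "norm x" "norm y"] by (simp add: power2_sum)
  finally show ?thesis .
qed

lemma L2_inner_integrable:
  assumes "f \<in> L2 S" "g \<in> L2 S"
  shows "integrable (lebesgue_on S) (\<lambda>x. f x \<bullet> g x)"
proof (rule Bochner_Integration.integrable_bound)
  show "integrable (lebesgue_on S) (\<lambda>x. (norm (f x))\<^sup>2 + (norm (g x))\<^sup>2)"
    using assms by (auto simp: L2_def)
  show "(\<lambda>x. f x \<bullet> g x) \<in> borel_measurable (lebesgue_on S)"
    using assms by (auto simp: L2_def)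
qed (use norm_inner_le_squares in \<open>force intro!: AE_I2\<close>)

lemma L2_add:
  assumes "f \<in> L2 S" "g \<in> L2 S"
  shows "(\<lambda>x. f x + g x) \<in> L2 S"
proof -
  have "integrable (lebesgue_on S) (\<lambda>x. (norm (f x + g x))\<^sup>2)"
  proof (rule Bochner_Integration.integrable_bound)
    show "integrable (lebesgue_on S) (\<lambda>x. 2 * (norm (f x))\<^sup>2 + 2 * (norm (g x))\<^sup>2)"
      using assms by (auto simp: L2_def)
    show "(\<lambda>x. (norm (f x + g x))\<^sup>2) \<in> borel_measurable (lebesgue_on S)"
      using assms by (auto simp: L2_def)
  qed (use norm_add_squared_le in \<open>force intro!: AE_I2\<close>)
  then show ?thesis using assms by (auto simp: L2_def)
qed

lemma L2_scaleR: "f \<in> L2 S \<Longrightarrow> (\<lambda>x. c *\<^sub>R f x) \<in> L2 S"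
  by (auto simp: L2_def power_mult_distrib)

lemma L2_cmult: "f \<in> L2 S \<Longrightarrow> (\<lambda>x. c * (f x :: real)) \<in> L2 S"
  using L2_scaleR[of f S c] by simp

lemma L2_diff: "f \<in> L2 S \<Longrightarrow> g \<in> L2 S \<Longrightarrow> (\<lambda>x. f x - g x) \<in> L2 S"
  using L2_add[of f S "\<lambda>x. (-1) *\<^sub>R g x"] L2_scaleR[of g S "-1"] by simp

lemma L2_component:
  fixes f :: "real ^ 'n \<Rightarrow> real ^ 'm"
  assumes "f \<in> L2 S" shows "(\<lambda>x. f x $ i) \<in> L2 S"
proof -
  have m: "(\<lambda>x. f x \<bullet> axis i 1) \<in> borel_measurable (lebesgue_on S)"
    using assms by (auto simp: L2_def)
  have "integrable (lebesgue_on S) (\<lambda>x. (norm (f x $ i))\<^sup>2)"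
  proof (rule Bochner_Integration.integrable_bound)
    show "integrable (lebesgue_on S) (\<lambda>x. (norm (f x))\<^sup>2)"
      using assms by (auto simp: L2_def)
    show "(\<lambda>x. (norm (f x $ i))\<^sup>2) \<in> borel_measurable (lebesgue_on S)"
      using m by (simp add: inner_axis)
  qed (use component_le_norm_cart[of "f _" i] in \<open>auto intro!: AE_I2 simp: abs_le_square_iff[symmetric]\<close>)
  then show ?thesis using m by (auto simp: L2_def inner_axis)
qed

lemma L2_const: "S \<in> lmeasurable \<Longrightarrow> (\<lambda>_. c) \<in> L2 S"
  by (auto simp: L2_def fmeasurable_def intro!: finite_measure.integrable_const finite_measureI
      simp: emeasure_restrict_space)

lemma l2_norm_sq: "(l2_norm S f)\<^sup>2 = (LINT x|lebesgue_on S. (norm (f x))\<^sup>2)"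
  by (simp add: l2_norm_def l2_inner_def power2_norm_eq_inner)

lemma l2_norm_nonneg [simp]: "0 \<le> l2_norm S f"
  by (simp add: l2_norm_def l2_inner_def)

lemma l2_inner_commute: "l2_inner S f g = l2_inner S g f"
  by (simp add: l2_inner_def inner_commute)

lemma l2_inner_diff:
  assumes "f \<in> L2 S" "g \<in> L2 S" "h \<in> L2 S"
  shows "l2_inner S (\<lambda>x. f x - g x) h = l2_inner S f h - l2_inner S g h"
  using L2_inner_integrable[OF assms(1,3)] L2_inner_integrable[OF assms(2,3)]
  by (simp add: l2_inner_def inner_diff_left)

text \<open>The squared norm of \<open>f - t g\<close> is a quadratic in \<open>t\<close> that is
  never negative; this is the discriminant condition, with the degenerate case \<open>C = 0\<close>
  treated apart.\<close>

lemma l2_Cauchy_Schwarz: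
  assumes f: "f \<in> L2 S" and g: "g \<in> L2 S"
  shows "\<bar>l2_inner S f g\<bar> \<le> l2_norm S f * l2_norm S g"
proof -
  define A B C where "A = l2_inner S f f" and "B = l2_inner S f g" and "C = l2_inner S g g"
  have C0: "0 \<le> C" and A0: "0 \<le> A" by (simp_all add: A_def C_def l2_inner_def)
  have key: "0 \<le> A - 2 * t * B + t\<^sup>2 * C" for t
  proof -
    have "0 \<le> (LINT x|lebesgue_on S. (f x - t *\<^sub>R g x) \<bullet> (f x - t *\<^sub>R g x))" by simp
    also have "\<dots> = (LINT x|lebesgue_on S. f x \<bullet> f x - 2 * t * (f x \<bullet> g x) + t\<^sup>2 * (g x \<bullet> g x))"
      by (intro Bochner_Integration.integral_cong)
        (auto simp: inner_diff_left inner_diff_right inner_commute power2_eq_square)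
    also have "\<dots> = A - 2 * t * B + t\<^sup>2 * C"
      using L2_inner_integrable[OF f f] L2_inner_integrable[OF f g] L2_inner_integrable[OF g g]
      by (simp add: A_def B_def C_def l2_inner_def)
    finally show ?thesis .
  qed
  have "B\<^sup>2 \<le> A * C"
  proof (cases "C = 0")
    case True
    have "B = 0"
    proof (rule ccontr)
      assume "B \<noteq> 0"
      \<comment> \<open>With \<open>C = 0\<close> the quadratic is linear in \<open>t\<close>, and
        this \<open>t\<close> gives it the value -1.\<close>
      with key[of "(A + 1) / (2 * B)"] True show False by (simp add: field_simps)
    qed
    then show ?thesis using True by simp
  next
    case False
    with C0 have "C > 0" by simp
    \<comment> \<open>The minimiser of the quadratic.\<close>
    with key[of "B / C"] show ?thesis by (simp add: field_simps power2_eq_square)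
  qed
  then have "\<bar>B\<bar> \<le> sqrt (A * C)" by (simp add: real_le_rsqrt)
  then show ?thesis by (simp add: l2_norm_def A_def B_def C_def real_sqrt_mult)
qed

section \<open>Restriction to subsets and changes on null sets\<close>

lemma l2_inner_set:
  "S \<in> sets lebesgue \<Longrightarrow> l2_inner S f g = (LINT x|lebesgue. indicator S x * (f x \<bullet> g x))"
  by (simp add: l2_inner_def integral_restrict_space)

lemma L2_iff:
  assumes "S \<in> sets lebesgue"
  shows "f \<in> L2 S \<longleftrightarrow> (\<lambda>x. indicator S x *\<^sub>R f x) \<in> borel_measurable lebesgue \<and>
    integrable lebesgue (\<lambda>x. indicator S x * (norm (f x))\<^sup>2)"
  using assms by (simp add: L2_def borel_measurable_restrict_space_iff integrable_restrict_space)

lemma L2_subset: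
  assumes "f \<in> L2 S" "S \<in> sets lebesgue" "R \<in> sets lebesgue" "R \<subseteq> S"
  shows "f \<in> L2 R"
proof -
  have eq: "indicator R x = indicator R x * (indicator S x :: real)" for x
    using assms(4) by (auto simp: indicator_def)
  have "(\<lambda>x. indicator R x *\<^sub>R (indicator S x *\<^sub>R f x)) \<in> borel_measurable lebesgue"
    by (rule borel_measurable_scaleR) (use assms in \<open>auto simp: L2_iff\<close>)
  moreover have "integrable lebesgue (\<lambda>x. indicator R x *\<^sub>R (indicator S x * (norm (f x))\<^sup>2))"
    using assms by (intro integrable_mult_indicator) (auto simp: L2_iff)
  ultimately show ?thesis
    using assms eq by (simp add: L2_iff mult.assoc[symmetric])
qed

lemma l2_norm_subset:
  assumes "f \<in> L2 S" "S \<in> sets lebesgue" "R \<in> sets lebesgue" "R \<subseteq> S"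
  shows "l2_norm R f \<le> l2_norm S f"
proof -
  have "integrable lebesgue (\<lambda>x. indicator R x * (f x \<bullet> f x))"
    using L2_subset[OF assms] assms by (simp add: L2_iff power2_norm_eq_inner)
  moreover have "integrable lebesgue (\<lambda>x. indicator S x * (f x \<bullet> f x))"
    using assms by (simp add: L2_iff power2_norm_eq_inner)
  ultimately have "l2_inner R f f \<le> l2_inner S f f"
    using assms unfolding l2_inner_set[OF assms(2)] l2_inner_set[OF assms(3)]
    by (intro integral_mono) (auto simp: indicator_def)
  then show ?thesis by (simp add: l2_norm_def)
qed

text \<open>Measurability of the modified function rests on the completeness of Lebesgue
  measure.\<close>

lemma L2_cong_AE:
  fixes g :: "real ^ 'n \<Rightarrow> 'b::euclidean_space"
  assumes "f \<in> L2 S" "S \<in> sets lebesgue" "AE x in lebesgue. x \<in> S \<longrightarrow> f x = g x"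
  shows "g \<in> L2 S"
proof -
  have ae: "AE x in lebesgue. indicator S x *\<^sub>R f x = indicator S x *\<^sub>R g x"
    "AE x in lebesgue. indicator S x * (norm (f x))\<^sup>2 = indicator S x * (norm (g x))\<^sup>2"
    using assms(3) by (auto simp: indicator_def elim: AE_mp)
  have m: "(\<lambda>x. indicator S x *\<^sub>R g x) \<in> borel_measurable lebesgue"
    by (rule borel_measurable_AE[OF _ ae(1)]) (use assms in \<open>simp add: L2_iff\<close>)
  have "(\<lambda>x. indicator S x * (norm (g x))\<^sup>2) \<in> borel_measurable lebesgue"
    by (rule borel_measurable_AE[OF _ ae(2)])
      (use assms borel_measurable_integrable in \<open>auto simp: L2_iff\<close>)
  then have "integrable lebesgue (\<lambda>x. indicator S x * (norm (g x))\<^sup>2)"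
    using assms by (intro integrable_cong_AE_imp[OF _ _ ae(2)]) (auto simp: L2_iff)
  with m show ?thesis using assms(2) by (simp add: L2_iff)
qed

lemma l2_inner_cong_AE:
  assumes "f \<in> L2 S" "f' \<in> L2 S" "g \<in> L2 S" "S \<in> sets lebesgue"
    "AE x in lebesgue. x \<in> S \<longrightarrow> f x = f' x"
  shows "l2_inner S f g = l2_inner S f' g"
  unfolding l2_inner_def
proof (rule integral_cong_AE)
  show "AE x in lebesgue_on S. f x \<bullet> g x = f' x \<bullet> g x"
    using assms(4,5) by (auto simp: AE_restrict_space_iff elim: AE_mp)
qed (use L2_inner_integrable assms in blast)+

lemma l2_norm_cong_AE:
  assumes "f \<in> L2 S" "f' \<in> L2 S" "S \<in> sets lebesgue" "AE x in lebesgue. x \<in> S \<longrightarrow> f x = f' x"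
  shows "l2_norm S f = l2_norm S f'"
  using l2_inner_cong_AE[OF assms(1,2,1,3,4)] l2_inner_cong_AE[OF assms(1,2,2,3,4)]
  by (simp add: l2_norm_def l2_inner_commute)

text \<open>Serves to pass from the interior of a simplex, where test functions and discrete fields
  are known, to the closed simplex, whose boundary is negligible.\<close>

lemma L2_null_extend:
  assumes "f \<in> L2 R" "R \<in> sets lebesgue" "S \<in> sets lebesgue" "R \<subseteq> S" "negligible (S - R)"
  shows "f \<in> L2 S"
proof -
  have n: "AE x in lebesgue. x \<notin> S - R"
    using AE_not_in[of "S - R" lebesgue] assms(5) by (simp add: negligible_iff_null_sets)
  have "AE x in lebesgue. indicator R x *\<^sub>R f x = indicator S x *\<^sub>R f x"
    "AE x in lebesgue. indicator R x * (norm (f x))\<^sup>2 = indicator S x * (norm (f x))\<^sup>2"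
    using n assms(4) by (auto simp: indicator_def elim!: AE_mp)
  note ae = this
  have m: "(\<lambda>x. indicator S x *\<^sub>R f x) \<in> borel_measurable lebesgue"
    by (rule borel_measurable_AE[OF _ ae(1)]) (use assms in \<open>simp add: L2_iff\<close>)
  have "(\<lambda>x. indicator S x * (norm (f x))\<^sup>2) \<in> borel_measurable lebesgue"
    by (rule borel_measurable_AE[OF _ ae(2)])
      (use assms borel_measurable_integrable in \<open>auto simp: L2_iff\<close>)
  then have "integrable lebesgue (\<lambda>x. indicator S x * (norm (f x))\<^sup>2)"
    using assms by (intro integrable_cong_AE_imp[OF _ _ ae(2)]) (auto simp: L2_iff)
  with m show ?thesis using assms(3) by (simp add: L2_iff)
qed

lemma l2_inner_null_extend:
  assumes "f \<in> L2 S" "g \<in> L2 S" "R \<in> sets lebesgue" "S \<in> sets lebesgue" "R \<subseteq> S" "negligible (S - R)"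
  shows "l2_inner S f g = l2_inner R f g"
proof -
  have "AE x in lebesgue. x \<notin> S - R"
    using AE_not_in[of "S - R" lebesgue] assms(6) by (simp add: negligible_iff_null_sets)
  then have ae: "AE x in lebesgue. indicator S x * (f x \<bullet> g x) = indicator R x * (f x \<bullet> g x)"
    using assms(5) by (auto simp: indicator_def elim!: AE_mp)
  have "integrable lebesgue (\<lambda>x. indicator S x *\<^sub>R (f x \<bullet> g x))"
    "integrable lebesgue (\<lambda>x. indicator R x *\<^sub>R (f x \<bullet> g x))"
    using L2_inner_integrable[OF assms(1,2)]
      L2_inner_integrable[OF L2_subset[OF assms(1,4,3,5)] L2_subset[OF assms(2,4,3,5)]] assms(3,4)
    by (simp_all add: integrable_restrict_space)
  then show ?thesis
    unfolding l2_inner_set[OF assms(3)] l2_inner_set[OF assms(4)]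
    by (intro integral_cong_AE ae) auto
qed

section \<open>Measures of slabs and prisms\<close>

lemma integral_lborel_translation:
  fixes f :: "'a::euclidean_space \<Rightarrow> real"
  assumes [measurable]: "f \<in> borel_measurable borel"
  shows "(LINT x|lborel. f (x + c)) = (LINT x|lborel. f x)"
proof -
  have "(LINT x|lborel. f x) = (LINT x|distr lborel borel ((+) c). f x)"
    by (simp add: lborel_distr_plus)
  also have "\<dots> = (LINT x|lborel. f (c + x))"
    by (rule integral_distr) auto
  finally show ?thesis by (simp add: add.commute)
qed

text \<open>A packing bound: pairwise disjoint translates have equal measure and together fit into
  \<open>B\<close>. It bounds measures from above when a small set is packed into a ball, and from
  below when balls are packed into a prism.\<close>

lemma disjoint_translates_measure_le:
  fixes A :: "'a::euclidean_space set"
  assumes A: "A \<in> lmeasurable" and B: "B \<in> lmeasurable"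
    and sub: "\<And>j x. j < N \<Longrightarrow> x \<in> A \<Longrightarrow> v j + x \<in> B"
    and disj: "\<And>i j x y. i < j \<Longrightarrow> x \<in> A \<Longrightarrow> y \<in> A \<Longrightarrow> v i + x \<noteq> v j + y"
  shows "real N * measure lebesgue A \<le> measure lebesgue B"
proof -
  have "pairwise (\<lambda>i j. disjnt ((+) (v i) ` A) ((+) (v j) ` A)) {..<N}"
    unfolding pairwise_def disjnt_def
  proof (intro ballI impI)
    fix i j :: nat assume "i \<noteq> j"
    then have "i < j \<or> j < i" by auto
    then show "(+) (v i) ` A \<inter> (+) (v j) ` A = {}" using disj[of i j] disj[of j i] by force
  qed
  then have "measure lebesgue (\<Union>j<N. (+) (v j) ` A) = (\<Sum>j<N. measure lebesgue ((+) (v j) ` A))"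
    using A by (intro measure_UNION') (auto intro: measurable_translation)
  also have "\<dots> = real N * measure lebesgue A"
    by (simp add: measure_translation)
  finally have "measure lebesgue (\<Union>j<N. (+) (v j) ` A) = real N * measure lebesgue A" .
  moreover have "measure lebesgue (\<Union>j<N. (+) (v j) ` A) \<le> measure lebesgue B"
    using A B sub
    by (intro measure_mono_fmeasurable) (auto intro!: sets.finite_UN fmeasurableD measurable_translation)
  ultimately show ?thesis by simp
qed

text \<open>Fubini is avoided here: disjoint translates in direction \<open>n\<close> fit into a larger ball.\<close>

lemma slab_measure_le:
  fixes n p q :: "real ^ 'n"
  assumes n: "norm n = 1" and d: "0 < d" "d \<le> R"
  shows "measure lebesgue {x \<in> cball q R. \<bar>(x - p) \<bullet> n\<bar> < d}
    \<le> 2 * 3 ^ CARD('n) * unit_ball_vol CARD('n) * R ^ (CARD('n) - 1) * d"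
proof -
  let ?A = "{x \<in> cball q R. \<bar>(x - p) \<bullet> n\<bar> < d}"
  \<comment> \<open>Steps of length \<open>2 * d\<close> keep slabs of half-width \<open>d\<close>
    disjoint. For \<open>j < N\<close> the shift is at most \<open>2 * R\<close>, so the translates
    stay in the ball of radius \<open>3 * R\<close>. Rounding down loses at most a factor 2 because
    \<open>d \<le> R\<close>.\<close>
  define N where "N = nat \<lfloor>R / d\<rfloor>"
  have nn: "n \<bullet> n = 1" using n by (simp add: norm_eq_1)
  have N: "real N \<le> R / d" "R / d < real N + 1" "1 \<le> real N"
    using d by (auto simp: N_def le_nat_floor le_floor_iff)
  have N2: "R / (2 * d) \<le> real N" using N by (simp add: field_simps)
  have "open {x. \<bar>(x - p) \<bullet> n\<bar> < d}"
    by (intro open_Collect_less continuous_intros)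
  then have "?A \<in> sets borel"
    by (simp add: Collect_conj_eq Int_def[symmetric])
  moreover have "bounded ?A" by (rule bounded_subset[OF bounded_cball]) auto
  ultimately have Am: "?A \<in> lmeasurable" by (simp add: bounded_set_imp_lmeasurable)
  have "real N * measure lebesgue ?A \<le> measure lebesgue (cball q (3 * R))"
  proof (rule disjoint_translates_measure_le[where v = "\<lambda>j. (2 * real j * d) *\<^sub>R n"])
    fix j x assume "j < N" "x \<in> ?A"
    have "real j < real N" using \<open>j < N\<close> by simp
    then have "real j \<le> R / d" using N(1) by linarith
    then have "real j * d \<le> R" using d(1) by (simp add: pos_le_divide_eq)
    moreover have "dist q ((2 * real j * d) *\<^sub>R n + x) \<le> dist q x + norm ((2 * real j * d) *\<^sub>R n)"
      using norm_triangle_ineq4[of "q - x" "(2 * real j * d) *\<^sub>R n"] by (simp add: dist_norm algebra_simps)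
    ultimately show "(2 * real j * d) *\<^sub>R n + x \<in> cball q (3 * R)"
      using \<open>x \<in> ?A\<close> n d by auto
  next
    fix i j :: nat and x y assume ij: "i < j" "x \<in> ?A" "y \<in> ?A"
    show "(2 * real i * d) *\<^sub>R n + x \<noteq> (2 * real j * d) *\<^sub>R n + y"
    proof
      assume "(2 * real i * d) *\<^sub>R n + x = (2 * real j * d) *\<^sub>R n + y"
      then have "((2 * real i * d) *\<^sub>R n + x - p) \<bullet> n = ((2 * real j * d) *\<^sub>R n + y - p) \<bullet> n" by simp
      then have "2 * (real j - real i) * d = (x - p) \<bullet> n - (y - p) \<bullet> n"
        by (simp add: inner_diff_left inner_add_left nn algebra_simps)
      moreover have "(x - p) \<bullet> n - (y - p) \<bullet> n < 2 * d" using ij by auto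
      moreover have "1 \<le> real j - real i" using ij(1) by simp
      then have "2 * 1 * d \<le> 2 * (real j - real i) * d" using d by (intro mult_right_mono) auto
      ultimately show False by simp
    qed
  qed (use Am in auto)
  also have "\<dots> = unit_ball_vol CARD('n) * (3 * R) ^ CARD('n)"
    using d by (simp add: content_cball)
  finally have 1: "real N * measure lebesgue ?A \<le> unit_ball_vol CARD('n) * (3 * R) ^ CARD('n)" .
  have "R / (2 * d) * measure lebesgue ?A \<le> real N * measure lebesgue ?A"
    by (intro mult_right_mono N2) simp
  with 1 have "R / (2 * d) * measure lebesgue ?A \<le> unit_ball_vol CARD('n) * (3 * R) ^ CARD('n)" by simp
  moreover have "(3 * R) ^ CARD('n) = 3 ^ CARD('n) * (R * R ^ (CARD('n) - 1))"
    by (simp add: power_mult_distrib power_eq_if[of R "CARD('n)"])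
  ultimately show ?thesis using d by (simp add: field_simps)
qed

text \<open>\<open>N\<close> balls of radius \<open>b = 1 / (2 * N)\<close>, stacked along
  \<open>n\<close>, fill a column of height one above the disc. With \<open>N\<close> about
  \<open>1 / r\<close> the radius lies between \<open>r / 4\<close> and \<open>r\<close>, and the
  total volume is of order \<open>(1 / r) * r ^ d\<close>. The upper bound
  \<open>N \<le> 2 / r\<close> is where \<open>r \<le> 1\<close> enters.\<close>

lemma prism_disc_measure_ge:
  fixes n p :: "real ^ 'n"
  assumes n: "norm n = 1" and r: "0 < r" "r \<le> 1"
  shows "unit_ball_vol CARD('n) / 4 ^ CARD('n) * r ^ (CARD('n) - 1)
    \<le> measure lebesgue {x. 0 < (x - p) \<bullet> n \<and> (x - p) \<bullet> n \<le> 1 \<and> norm (x - ((x - p) \<bullet> n) *\<^sub>R n - p) \<le> r}"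
proof -
  let ?B = "{x. 0 < (x - p) \<bullet> n \<and> (x - p) \<bullet> n \<le> 1 \<and> norm (x - ((x - p) \<bullet> n) *\<^sub>R n - p) \<le> r}"
  define N where "N = nat \<lceil>1 / r\<rceil>"
  have nn: "n \<bullet> n = 1" using n by (simp add: norm_eq_1)
  have N: "1 / r \<le> real N" "real N < 1 / r + 1"
    using r by (auto simp: N_def) linarith+
  have "0 < 1 / r" using r by simp
  with N(1) have N0: "0 < real N" by linarith
  have N1: "1 / real N \<le> r" using N(1) N0 r by (simp add: field_simps)
  have N2: "real N \<le> 2 / r" using N(2) r by (simp add: field_simps)
  define b where "b = 1 / (2 * real N)"
  have b: "0 < b" "b \<le> r" "r / 4 \<le> b" using N0 N1 N2 r by (simp_all add: b_def field_simps)
  have inn: "\<bar>z \<bullet> n\<bar> \<le> norm z" for z using Cauchy_Schwarz_ineq2[of z n] n by simp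
  have proj: "norm (z - (z \<bullet> n) *\<^sub>R n) \<le> norm z" for z
  proof -
    have "(norm (z - (z \<bullet> n) *\<^sub>R n))\<^sup>2 \<le> (norm z)\<^sup>2"
      unfolding power2_norm_eq_inner by (simp add: inner_diff_left inner_diff_right nn inner_commute)
    then show ?thesis by (simp add: abs_le_square_iff[symmetric])
  qed
  have cl: "closed {x. (x - p) \<bullet> n \<le> 1 \<and> norm (x - ((x - p) \<bullet> n) *\<^sub>R n - p) \<le> r}"
    by (intro closed_Collect_conj closed_Collect_le continuous_intros)
  have op: "open {x. 0 < (x - p) \<bullet> n}" by (intro open_Collect_less continuous_intros)
  have "?B = {x. 0 < (x - p) \<bullet> n} \<inter> {x. (x - p) \<bullet> n \<le> 1 \<and> norm (x - ((x - p) \<bullet> n) *\<^sub>R n - p) \<le> r}"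
    by auto
  then have "?B \<in> sets borel" using cl op by (simp add: borel_closed borel_open sets.Int)
  moreover have "?B \<subseteq> cball p (r + 1)"
  proof
    fix x assume x: "x \<in> ?B"
    have "x - p = (x - ((x - p) \<bullet> n) *\<^sub>R n - p) + ((x - p) \<bullet> n) *\<^sub>R n" by simp
    then have "norm (x - p) \<le> norm (x - ((x - p) \<bullet> n) *\<^sub>R n - p) + norm (((x - p) \<bullet> n) *\<^sub>R n)"
      by (metis norm_triangle_ineq)
    then show "x \<in> cball p (r + 1)" using x n by (auto simp: dist_norm norm_minus_commute)
  qed
  then have "bounded ?B" using bounded_cball bounded_subset by blast
  ultimately have Bm: "?B \<in> lmeasurable" by (simp add: bounded_set_imp_lmeasurable)
  have "real N * measure lebesgue (ball p b) \<le> measure lebesgue ?B"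
  proof (rule disjoint_translates_measure_le[where v = "\<lambda>j. ((2 * real j + 1) * b) *\<^sub>R n"])
    fix j x assume j: "j < N" and x: "x \<in> ball p b"
    have "norm (x - p) < b" using x by (simp add: dist_norm norm_minus_commute)
    with inn[of "x - p"] have s: "\<bar>(x - p) \<bullet> n\<bar> < b" by simp
    have e: "(((2 * real j + 1) * b) *\<^sub>R n + x - p) \<bullet> n = (2 * real j + 1) * b + (x - p) \<bullet> n"
      by (simp add: inner_diff_left inner_add_left nn)
    have "1 \<le> 2 * real j + 1" by simp
    then have "1 * b \<le> (2 * real j + 1) * b" using b by (intro mult_right_mono) auto
    then have s1: "0 < (2 * real j + 1) * b + (x - p) \<bullet> n" using s by linarith
    have "(2 * real j + 1) * b + b = (2 * real j + 2) * b" by (simp add: algebra_simps)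
    also have "\<dots> \<le> 2 * real N * b"
      using j b by (intro mult_right_mono) auto
    also have "2 * real N * b = 1" using N0 by (simp add: b_def)
    finally have s2: "(2 * real j + 1) * b + (x - p) \<bullet> n \<le> 1" using s by linarith
    have "((2 * real j + 1) * b) *\<^sub>R n + x - ((2 * real j + 1) * b + (x - p) \<bullet> n) *\<^sub>R n - p
        = (x - p) - ((x - p) \<bullet> n) *\<^sub>R n" (is "?l = _") by (simp add: algebra_simps)
    then have "norm ?l = norm ((x - p) - ((x - p) \<bullet> n) *\<^sub>R n)" by (rule arg_cong)
    then have s3: "norm (((2 * real j + 1) * b) *\<^sub>R n + x - ((2 * real j + 1) * b + (x - p) \<bullet> n) *\<^sub>R n - p) \<le> r"
      using proj[of "x - p"] \<open>norm (x - p) < b\<close> b by linarith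
    show "((2 * real j + 1) * b) *\<^sub>R n + x \<in> ?B"
      unfolding mem_Collect_eq e by (intro conjI s1 s2 s3)
  next
    fix i j :: nat and x y assume ij: "i < j" "x \<in> ball p b" "y \<in> ball p b"
    show "((2 * real i + 1) * b) *\<^sub>R n + x \<noteq> ((2 * real j + 1) * b) *\<^sub>R n + y"
    proof
      assume "((2 * real i + 1) * b) *\<^sub>R n + x = ((2 * real j + 1) * b) *\<^sub>R n + y"
      then have "x - y = ((2 * (real j - real i)) * b) *\<^sub>R n" by (simp add: algebra_simps)
      then have "norm (x - y) = 2 * (real j - real i) * b" using n ij(1) b by simp
      moreover have "norm (x - y) < 2 * b"
        using ij norm_triangle_ineq4[of "x - p" "y - p"] by (simp add: dist_norm norm_minus_commute)
      moreover have "1 \<le> real j - real i" using ij(1) by simp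
      then have "2 * 1 * b \<le> 2 * (real j - real i) * b" using b by (intro mult_right_mono) auto
      ultimately show False by simp
    qed
  qed (use Bm in auto)
  moreover have "measure lebesgue (ball p b) = unit_ball_vol CARD('n) * b ^ CARD('n)"
    using b by (simp add: content_ball)
  moreover have "real N * (unit_ball_vol CARD('n) * b ^ CARD('n))
      \<ge> (1 / r) * (unit_ball_vol CARD('n) * (r / 4) ^ CARD('n))"
    using N(1) b r by (intro mult_mono power_mono) (auto simp: )
  moreover have "(1 / r) * (unit_ball_vol CARD('n) * (r / 4) ^ CARD('n))
      = unit_ball_vol CARD('n) / 4 ^ CARD('n) * r ^ (CARD('n) - 1)"
    using r by (simp add: power_divide power_eq_if[of r "CARD('n)"])
  ultimately show ?thesis by simp
qed

text \<open>A covering bound: balls of radius \<open>2 * h\<close>, centred at spacing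
  \<open>h\<close> on the axis, cover the prism of height one. Their number is at most
  \<open>1 / h + 1\<close>, hence at most \<open>(2 + D) / h\<close>; the constant \<open>D\<close>
  matters for \<open>h > 1\<close>, where a single ball remains.\<close>

lemma prism_measure_le:
  fixes n p :: "real ^ 'n"
  assumes n: "norm n = 1" and h: "0 < h" "h \<le> D"
    and S: "S \<in> sets lebesgue"
      "S \<subseteq> {x. 0 \<le> (x - p) \<bullet> n \<and> (x - p) \<bullet> n \<le> 1 \<and> norm (x - ((x - p) \<bullet> n) *\<^sub>R n - p) \<le> h}"
  shows "measure lebesgue S \<le> (2 + D) * 2 ^ CARD('n) * unit_ball_vol CARD('n) * h ^ (CARD('n) - 1)"
proof -
  define N where "N = nat \<lfloor>1 / h\<rfloor>"
  have N: "real N \<le> 1 / h" "1 / h < real N + 1"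
    using h by (auto simp: N_def)
  have sub: "S \<subseteq> (\<Union>j<Suc N. cball (p + (real j * h) *\<^sub>R n) (2 * h))"
  proof
    fix x assume "x \<in> S"
    then have x: "0 \<le> (x - p) \<bullet> n" "(x - p) \<bullet> n \<le> 1" "norm (x - ((x - p) \<bullet> n) *\<^sub>R n - p) \<le> h"
      using S by auto
    define j where "j = nat \<lfloor>(x - p) \<bullet> n / h\<rfloor>"
    have j: "real j \<le> (x - p) \<bullet> n / h" "(x - p) \<bullet> n / h < real j + 1"
      using h x by (auto simp: j_def)
    have "(x - p) \<bullet> n / h \<le> 1 / h" using x h by (simp add: divide_right_mono)
    then have "j < Suc N" using j N by linarith
    have "\<bar>(x - p) \<bullet> n - real j * h\<bar> \<le> h" using j h by (simp add: field_simps abs_le_iff)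
    moreover have "x - (p + (real j * h) *\<^sub>R n)
      = (x - ((x - p) \<bullet> n) *\<^sub>R n - p) + ((x - p) \<bullet> n - real j * h) *\<^sub>R n" by (simp add: algebra_simps)
    then have "norm (x - (p + (real j * h) *\<^sub>R n))
      \<le> norm (x - ((x - p) \<bullet> n) *\<^sub>R n - p) + norm (((x - p) \<bullet> n - real j * h) *\<^sub>R n)"
      by (metis norm_triangle_ineq)
    ultimately have "norm (x - (p + (real j * h) *\<^sub>R n)) \<le> 2 * h" using x n by simp
    then show "x \<in> (\<Union>j<Suc N. cball (p + (real j * h) *\<^sub>R n) (2 * h))"
      using \<open>j < Suc N\<close> by (intro UN_I[of j]) (auto simp: dist_norm norm_minus_commute)
  qed
  have "measure lebesgue S \<le> measure lebesgue (\<Union>j<Suc N. cball (p + (real j * h) *\<^sub>R n) (2 * h))"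
    using S by (intro measure_mono_fmeasurable[OF sub]) (auto intro!: fmeasurable.finite_UN)
  also have "\<dots> \<le> (\<Sum>j<Suc N. measure lebesgue (cball (p + (real j * h) *\<^sub>R n) (2 * h)))"
    by (intro measure_UNION_le) auto
  also have "\<dots> = real (Suc N) * (unit_ball_vol CARD('n) * (2 * h) ^ CARD('n))"
    using h by (simp add: content_cball)
  also have "\<dots> \<le> ((2 + D) / h) * (unit_ball_vol CARD('n) * (2 * h) ^ CARD('n))"
    using N h by (intro mult_right_mono) (auto simp: field_simps)
  also have "\<dots> = (2 + D) * 2 ^ CARD('n) * unit_ball_vol CARD('n) * h ^ (CARD('n) - 1)"
    using h by (simp add: power_mult_distrib power_eq_if[of h "CARD('n)"])
  finally show ?thesis .
qed

section \<open>The divergence theorem on a half-space\<close>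

lemma grad_cong_open:
  assumes "open S" "x \<in> S" "\<And>y. y \<in> S \<Longrightarrow> f y = g y"
  shows "grad f x = grad g x"
proof -
  have "(f has_derivative D) (at x) \<longleftrightarrow> (g has_derivative D) (at x)" for D
    using has_derivative_transform_within_open[of f D x UNIV S g]
      has_derivative_transform_within_open[of g D x UNIV S f] assms by auto
  then show ?thesis by (simp add: grad_def frechet_derivative_def)
qed

lemma grad_eq_0_outside:
  assumes "\<And>x. x \<notin> cball q R \<Longrightarrow> f x = 0" "x \<notin> cball q R"
  shows "grad f x = 0"
  using grad_cong_open[of "- cball q R" x f "\<lambda>_. 0"] assms by auto

lemma Ck1_continuous_grad: "Ck (Suc 0) f \<Longrightarrow> continuous_on UNIV (grad f)"
  using continuous_on_vec_lambda[of UNIV "\<lambda>i x. grad f x $ i"] by simp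

lemma Ck1_grad_bounded:
  assumes "Ck (Suc 0) f" "\<And>x. x \<notin> cball q R \<Longrightarrow> f x = 0"
  obtains L where "0 \<le> L" "\<And>x. norm (grad f x) \<le> L"
proof -
  have "compact (grad f ` cball q R)"
    using Ck1_continuous_grad[OF assms(1)] by (intro compact_continuous_image) (auto intro: continuous_on_subset)
  then obtain L where L: "\<And>y. y \<in> grad f ` cball q R \<Longrightarrow> norm y \<le> L"
    using compact_imp_bounded bounded_iff by metis
  show ?thesis
  proof (rule that[of "max L 0"])
    show "norm (grad f x) \<le> max L 0" for x
      using L[of "grad f x"] grad_eq_0_outside[OF assms(2)] by (cases "x \<in> cball q R") fastforce+
  qed simp
qed

lemma Ck1_Lipschitz:
  assumes "Ck (Suc 0) f" "\<And>x. norm (grad f x) \<le> L"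
  shows "\<bar>f x - f y\<bar> \<le> L * norm (x - y)"
proof -
  have "norm (f x - f y) \<le> L * norm (x - y)"
  proof (rule differentiable_bound[of UNIV f "\<lambda>x u. grad f x \<bullet> u"])
    show "(f has_derivative (\<lambda>u. grad f x \<bullet> u)) (at x)" for x
      by (rule Ck_has_derivative[OF assms(1)])
    show "onorm (\<lambda>u. grad f x \<bullet> u) \<le> L" for x
    proof (rule onorm_bound)
      show "norm (grad f x \<bullet> u) \<le> L * norm u" for u
        using Cauchy_Schwarz_ineq2[of "grad f x" u] mult_right_mono[OF assms(2)[of x] norm_ge_zero[of u]]
        by (simp add: order_trans)
      show "0 \<le> L" using assms(2)[of x] norm_ge_zero order_trans by blast
    qed
  qed auto
  then show ?thesis by simp
qed

lemma integrable_indicator_cball: "integrable lborel (indicator (cball q R) :: 'a::euclidean_space \<Rightarrow> real)"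
  using emeasure_bounded_finite[OF bounded_cball[of q R]] by (intro integrable_real_indicator) auto

lemma integrable_bounded_support:
  fixes g :: "'a::euclidean_space \<Rightarrow> real"
  assumes "g \<in> borel_measurable borel" "\<And>x. \<bar>g x\<bar> \<le> C" "\<And>x. x \<notin> cball q R \<Longrightarrow> g x = 0"
  shows "integrable lborel g"
proof (rule Bochner_Integration.integrable_bound)
  show "integrable lborel (\<lambda>x. C * indicator (cball q R) x)"
    by (intro integrable_mult_right integrable_indicator_cball)
  show "AE x in lborel. norm (g x) \<le> norm (C * indicator (cball q R) x)"
    using assms(2,3) abs_ge_self order_trans by (fastforce simp: indicator_def intro!: AE_I2)
qed (use assms in auto)

lemma continuous_compact_support_bounded:
  fixes f :: "'a::euclidean_space \<Rightarrow> real"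
  assumes "continuous_on UNIV f" "\<And>x. x \<notin> cball q R \<Longrightarrow> f x = 0"
  obtains C where "0 \<le> C" "\<And>x. \<bar>f x\<bar> \<le> C"
proof -
  have "compact (f ` cball q R)"
    using assms(1) by (intro compact_continuous_image) (auto intro: continuous_on_subset)
  then obtain C where C: "\<And>y. y \<in> f ` cball q R \<Longrightarrow> norm y \<le> C"
    using compact_imp_bounded bounded_iff by metis
  show ?thesis
  proof (rule that[of "max C 0"])
    show "\<bar>f x\<bar> \<le> max C 0" for x
      using C[of "f x"] assms(2) by (cases "x \<in> cball q R") fastforce+
  qed simp
qed

text \<open>Turns derivatives into translations. Convergence is dominated by the Lipschitz bound
  \<open>L * norm u\<close> on a ball enlarged by \<open>norm u\<close>, because the shifted support
  leaves the original ball.\<close>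

lemma difference_quotient_integral:
  fixes \<Psi> :: "real ^ 'n \<Rightarrow> real"
  assumes \<Psi>: "Ck (Suc 0) \<Psi>" and supp: "\<And>x. x \<notin> cball q R \<Longrightarrow> \<Psi> x = 0"
    and H: "H \<in> sets borel"
  shows "(\<lambda>N. LINT x|lborel. indicator H x * (real (Suc N) * (\<Psi> (x + (1 / real (Suc N)) *\<^sub>R u) - \<Psi> x)))
    \<longlonglongrightarrow> (LINT x|lborel. indicator H x * (grad \<Psi> x \<bullet> u))"
proof -
  obtain L where L0: "0 \<le> L" and L: "\<And>x. norm (grad \<Psi> x) \<le> L"
    using Ck1_grad_bounded[OF \<Psi> supp] by blast
  note Lip = Ck1_Lipschitz[OF \<Psi> L]
  have cont: "continuous_on UNIV \<Psi>" using Ck_imp_continuous[OF \<Psi>] .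
  have [measurable]: "\<Psi> \<in> borel_measurable borel" by (rule borel_measurable_continuous_onI[OF cont])
  have [measurable]: "grad \<Psi> \<in> borel_measurable borel"
    by (rule borel_measurable_continuous_onI[OF Ck1_continuous_grad[OF \<Psi>]])
  note [measurable] = H
  show ?thesis
  proof (rule integral_dominated_convergence)
    show "integrable lborel (\<lambda>x. L * norm u * indicator (cball q (R + norm u)) x)"
      by (intro integrable_mult_right integrable_indicator_cball)
    show "AE x in lborel. (\<lambda>N. indicator H x * (real (Suc N) * (\<Psi> (x + (1 / real (Suc N)) *\<^sub>R u) - \<Psi> x)))
        \<longlonglongrightarrow> indicator H x * (grad \<Psi> x \<bullet> u)"
    proof (intro AE_I2 tendsto_mult_left)
      fix x
      have "((\<lambda>t. x + t *\<^sub>R u) has_derivative (\<lambda>t. t *\<^sub>R u)) (at 0)"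
        by (auto intro!: derivative_eq_intros)
      moreover have "(\<Psi> has_derivative (\<lambda>v. grad \<Psi> x \<bullet> v)) (at (x + 0 *\<^sub>R u))"
        using Ck_has_derivative[OF \<Psi>, of x] by simp
      ultimately have "((\<lambda>t. \<Psi> (x + t *\<^sub>R u)) has_derivative (\<lambda>t. grad \<Psi> x \<bullet> (t *\<^sub>R u))) (at 0)"
        by (rule has_derivative_compose)
      then have "((\<lambda>t. \<Psi> (x + t *\<^sub>R u)) has_real_derivative (grad \<Psi> x \<bullet> u)) (at 0)"
        by (simp add: has_field_derivative_def mult.commute[of _ "grad \<Psi> x \<bullet> u"] mult_commute_abs)
      then have "((\<lambda>h. (\<Psi> (x + h *\<^sub>R u) - \<Psi> x) / h) \<longlongrightarrow> grad \<Psi> x \<bullet> u) (at 0)"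
        by (simp add: DERIV_def)
      moreover have "filterlim (\<lambda>N. 1 / real (Suc N)) (at 0) sequentially"
        unfolding filterlim_at using lim_inverse_n'[THEN LIMSEQ_Suc] by (auto simp del: of_nat_Suc)
      ultimately have "(\<lambda>N. (\<Psi> (x + (1 / real (Suc N)) *\<^sub>R u) - \<Psi> x) / (1 / real (Suc N))) \<longlonglongrightarrow> grad \<Psi> x \<bullet> u"
        by (rule filterlim_compose)
      then show "(\<lambda>N. real (Suc N) * (\<Psi> (x + (1 / real (Suc N)) *\<^sub>R u) - \<Psi> x)) \<longlonglongrightarrow> grad \<Psi> x \<bullet> u"
        by (simp add: mult.commute)
    qed
    show "AE x in lborel. norm (indicator H x * (real (Suc N) * (\<Psi> (x + (1 / real (Suc N)) *\<^sub>R u) - \<Psi> x)))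
        \<le> L * norm u * indicator (cball q (R + norm u)) x" for N
    proof (intro AE_I2)
      fix x
      let ?y = "x + (1 / real (Suc N)) *\<^sub>R u"
      have n: "norm ((1 / real (Suc N)) *\<^sub>R u) \<le> norm u"
        using mult_left_mono[of 1 "real (Suc N)" "norm u"] by (simp add: divide_simps)
      show "norm (indicator H x * (real (Suc N) * (\<Psi> ?y - \<Psi> x))) \<le> L * norm u * indicator (cball q (R + norm u)) x"
      proof (cases "x \<in> cball q (R + norm u)")
        case True
        have "\<bar>\<Psi> ?y - \<Psi> x\<bar> \<le> L * (norm u / real (Suc N))"
          using Lip[of ?y x] by simp
        then have "real (Suc N) * \<bar>\<Psi> ?y - \<Psi> x\<bar> \<le> real (Suc N) * (L * (norm u / real (Suc N)))"
          by (intro mult_left_mono) auto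
        also have "\<dots> = L * norm u" by simp
        finally show ?thesis using True L0 by (simp add: indicator_def abs_mult)
      next
        case False
        have "dist q x \<le> dist q ?y + norm ((1 / real (Suc N)) *\<^sub>R u)"
          using norm_triangle_ineq[of "q - ?y" "(1 / real (Suc N)) *\<^sub>R u"] by (simp add: dist_norm)
        with False n have "?y \<notin> cball q R" by auto
        moreover have "x \<notin> cball q R" using False norm_ge_zero[of u] by (auto simp del: norm_ge_zero)
        ultimately show ?thesis using supp by (simp add: L0)
      qed
    qed
  qed measurable
qed

text \<open>A volume integral over a layer of height 1, as in \<open>flat_surface_integral\<close>.\<close>

definition hyperplane_integral :: "real ^ 'n \<Rightarrow> real ^ 'n \<Rightarrow> (real ^ 'n \<Rightarrow> real) \<Rightarrow> real" where
  "hyperplane_integral p n g = (LINT x|lborel.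
     indicator {x. 0 < (x - p) \<bullet> n \<and> (x - p) \<bullet> n \<le> 1} x * g (x - ((x - p) \<bullet> n) *\<^sub>R n))"

lemma sets_layer [measurable]: "{x :: real ^ 'n. a < (x - p) \<bullet> n \<and> (x - p) \<bullet> n \<le> b} \<in> sets borel"
  and sets_halfspace [measurable]: "{x :: real ^ 'n. (x - p) \<bullet> n \<le> b} \<in> sets borel"
  by measurable

lemma hyperplane_projection_dist:
  fixes n :: "real ^ 'n"
  assumes "norm n = 1" "x - ((x - p) \<bullet> n) *\<^sub>R n \<in> cball q R" "\<bar>(x - p) \<bullet> n\<bar> \<le> b"
  shows "x \<in> cball q (R + b)"
proof -
  have "dist q x \<le> dist q (x - ((x - p) \<bullet> n) *\<^sub>R n) + norm (((x - p) \<bullet> n) *\<^sub>R n)"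
    using norm_triangle_ineq4[of "q - (x - ((x - p) \<bullet> n) *\<^sub>R n)" "((x - p) \<bullet> n) *\<^sub>R n"]
    by (simp add: dist_norm)
  then show ?thesis using assms by auto
qed

text \<open>The integrand is constant in direction \<open>n\<close>, so the \<open>Suc N\<close>
  slices of thickness \<open>1 / real (Suc N)\<close> are translates with equal integrals. Half-open
  layers make the slices an exact partition.\<close>

lemma hyperplane_integral_slices:
  fixes \<Psi> :: "real ^ 'n \<Rightarrow> real"
  assumes cont: "continuous_on UNIV \<Psi>" and supp: "\<And>x. x \<notin> cball q R \<Longrightarrow> \<Psi> x = 0"
    and n: "norm n = 1"
  shows "hyperplane_integral p n \<Psi> = real (Suc N) * (LINT x|lborel.
    indicator {x. 0 < (x - p) \<bullet> n \<and> (x - p) \<bullet> n \<le> 1 / real (Suc N)} x * \<Psi> (x - ((x - p) \<bullet> n) *\<^sub>R n))"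
proof -
  define b where "b = 1 / real (Suc N)"
  have b: "0 < b" "b * real (Suc N) = 1" by (simp_all add: b_def del: of_nat_Suc)
  let ?\<pi> = "\<lambda>x. x - ((x - p) \<bullet> n) *\<^sub>R n"
  let ?l = "\<lambda>c d x. indicator {x. c < (x - p) \<bullet> n \<and> (x - p) \<bullet> n \<le> d} x :: real"
  have nn: "n \<bullet> n = 1" using n by (simp add: norm_eq_1)
  have [measurable]: "\<Psi> \<in> borel_measurable borel" by (rule borel_measurable_continuous_onI[OF cont])
  obtain C where C: "0 \<le> C" "\<And>x. \<bar>\<Psi> x\<bar> \<le> C"
    using continuous_compact_support_bounded[OF cont supp] by blast
  have int: "integrable lborel (\<lambda>x. ?l c d x * \<Psi> (?\<pi> x))" for c d
  proof (rule integrable_bounded_support)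
    show "\<bar>?l c d x * \<Psi> (?\<pi> x)\<bar> \<le> C" for x using C by (auto simp: indicator_def)
    show "?l c d x * \<Psi> (?\<pi> x) = 0" if "x \<notin> cball q (R + max \<bar>c\<bar> \<bar>d\<bar>)" for x
    proof (cases "c < (x - p) \<bullet> n \<and> (x - p) \<bullet> n \<le> d")
      case True
      then have "\<bar>(x - p) \<bullet> n\<bar> \<le> max \<bar>c\<bar> \<bar>d\<bar>" by auto
      then have "?\<pi> x \<notin> cball q R"
        using that hyperplane_projection_dist[OF n] by blast
      then show ?thesis using supp by simp
    qed auto
  qed measurable
  have sum: "(\<Sum>j<m. ?l (real j * b) (real (Suc j) * b) x) = ?l 0 (real m * b) x" for m x
  proof (induction m)
    case (Suc m)
    define c where "c = real m * b"
    have "0 \<le> c" "real (Suc m) * b = c + b" using b by (simp_all add: c_def algebra_simps)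
    with b(1) show ?case
      unfolding sum.lessThan_Suc Suc.IH c_def[symmetric] by (auto simp: indicator_def)
  qed (use b in \<open>auto simp: indicator_def\<close>)
  have "hyperplane_integral p n \<Psi> = (LINT x|lborel. (\<Sum>j<Suc N. ?l (real j * b) (real (Suc j) * b) x) * \<Psi> (?\<pi> x))"
    unfolding sum hyperplane_integral_def using b by (simp add: mult.commute)
  also have "\<dots> = (\<Sum>j<Suc N. LINT x|lborel. ?l (real j * b) (real (Suc j) * b) x * \<Psi> (?\<pi> x))"
    using int by (simp only: sum_distrib_right Bochner_Integration.integral_sum)
  also have "\<dots> = (\<Sum>j<Suc N. LINT x|lborel. ?l 0 b x * \<Psi> (?\<pi> x))"
  proof (rule sum.cong[OF refl])
    fix j
    have s: "(x + (real j * b) *\<^sub>R n - p) \<bullet> n = (x - p) \<bullet> n + real j * b" for x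
      by (simp add: inner_add_left inner_diff_left nn)
    have "(LINT x|lborel. ?l (real j * b) (real (Suc j) * b) x * \<Psi> (?\<pi> x))
      = (LINT x|lborel. ?l (real j * b) (real (Suc j) * b) (x + (real j * b) *\<^sub>R n) * \<Psi> (?\<pi> (x + (real j * b) *\<^sub>R n)))"
      by (rule integral_lborel_translation[symmetric]) measurable
    also have "\<dots> = (LINT x|lborel. ?l 0 b x * \<Psi> (?\<pi> x))"
      unfolding s by (intro Bochner_Integration.integral_cong)
        (auto simp: indicator_def s algebra_simps nn)
    finally show "(LINT x|lborel. ?l (real j * b) (real (Suc j) * b) x * \<Psi> (?\<pi> x)) = (LINT x|lborel. ?l 0 b x * \<Psi> (?\<pi> x))" .
  qed
  finally show ?thesis by (simp add: b_def)
qed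

text \<open>The difference quotients of step \<open>b N\<close> in direction \<open>n\<close>
  integrate over the half-space to \<open>Suc N\<close> times the integral of \<open>\<Psi>\<close>
  over a slice of thickness \<open>b N\<close>. There \<open>\<Psi>\<close> differs from its value
  at the projected point by at most \<open>L * b N\<close>, on a set of measure of order
  \<open>b N\<close>, so that even after multiplication by \<open>Suc N\<close> the error vanishes
  in the limit.\<close>

lemma halfspace_integral_grad_normal:
  fixes \<Psi> :: "real ^ 'n \<Rightarrow> real"
  assumes \<Psi>: "Ck (Suc 0) \<Psi>" and supp: "\<And>x. x \<notin> cball q R \<Longrightarrow> \<Psi> x = 0" and n: "norm n = 1"
  shows "(LINT x|lborel. indicator {x. (x - p) \<bullet> n \<le> 0} x * (grad \<Psi> x \<bullet> n)) = hyperplane_integral p n \<Psi>"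
proof -
  let ?\<pi> = "\<lambda>x. x - ((x - p) \<bullet> n) *\<^sub>R n"
  let ?l = "\<lambda>c d x. indicator {x. c < (x - p) \<bullet> n \<and> (x - p) \<bullet> n \<le> d} x :: real"
  let ?h = "\<lambda>d x. indicator {x. (x - p) \<bullet> n \<le> d} x :: real"
  have nn: "n \<bullet> n = 1" using n by (simp add: norm_eq_1)
  obtain L where L0: "0 \<le> L" and L: "\<And>x. norm (grad \<Psi> x) \<le> L"
    using Ck1_grad_bounded[OF \<Psi> supp] by blast
  note Lip = Ck1_Lipschitz[OF \<Psi> L]
  have cont: "continuous_on UNIV \<Psi>" using Ck_imp_continuous[OF \<Psi>] .
  have [measurable]: "\<Psi> \<in> borel_measurable borel" by (rule borel_measurable_continuous_onI[OF cont])
  obtain C where C: "0 \<le> C" "\<And>x. \<bar>\<Psi> x\<bar> \<le> C"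
    using continuous_compact_support_bounded[OF cont supp] by blast
  have int\<Psi>: "integrable lborel (\<lambda>x. g x * \<Psi> x)" if "g \<in> borel_measurable borel" "\<And>x. \<bar>g x\<bar> \<le> 1" for g
  proof (rule integrable_bounded_support)
    show "\<bar>g x * \<Psi> x\<bar> \<le> C" for x
      using mult_mono[OF that(2)[of x] C(2)[of x]] by (simp add: abs_mult)
    show "g x * \<Psi> x = 0" if "x \<notin> cball q R" for x using supp[OF that] by simp
  qed (use that(1) in measurable)
  have int\<pi>: "integrable lborel (\<lambda>x. ?l c d x * \<Psi> (?\<pi> x))" for c d
  proof (rule integrable_bounded_support)
    show "\<bar>?l c d x * \<Psi> (?\<pi> x)\<bar> \<le> C" for x using C by (auto simp: indicator_def)
    show "?l c d x * \<Psi> (?\<pi> x) = 0" if "x \<notin> cball q (R + max \<bar>c\<bar> \<bar>d\<bar>)" for x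
    proof (cases "c < (x - p) \<bullet> n \<and> (x - p) \<bullet> n \<le> d")
      case True
      then have "\<bar>(x - p) \<bullet> n\<bar> \<le> max \<bar>c\<bar> \<bar>d\<bar>" by auto
      then have "?\<pi> x \<notin> cball q R"
        using that hyperplane_projection_dist[OF n] by blast
      then show ?thesis using supp by simp
    qed auto
  qed measurable
  define a where "a N = (LINT x|lborel. ?h 0 x * (real (Suc N) * (\<Psi> (x + (1 / real (Suc N)) *\<^sub>R n) - \<Psi> x)))" for N
  define b where "b N = 1 / real (Suc N)" for N
  have b: "0 < b N" "b N \<le> 1" "real (Suc N) * b N = 1" for N by (simp_all add: b_def del: of_nat_Suc)
  \<comment> \<open>Translating the shifted term moves the half-space instead of the function; the
    difference of the two half-spaces is the slice.\<close>
  have a: "a N = real (Suc N) * (LINT x|lborel. ?l 0 (b N) x * \<Psi> x)" for N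
  proof -
    have s: "(x + b N *\<^sub>R n - p) \<bullet> n = (x - p) \<bullet> n + b N" for x
      by (simp add: inner_add_left inner_diff_left nn)
    have "(LINT x|lborel. ?h (b N) x * \<Psi> x) = (LINT x|lborel. ?h (b N) (x + b N *\<^sub>R n) * \<Psi> (x + b N *\<^sub>R n))"
      by (rule integral_lborel_translation[symmetric]) measurable
    also have "\<dots> = (LINT x|lborel. ?h 0 x * \<Psi> (x + b N *\<^sub>R n))"
      by (intro Bochner_Integration.integral_cong) (auto simp: indicator_def s)
    finally have e: "(LINT x|lborel. ?h (b N) x * \<Psi> x) = (LINT x|lborel. ?h 0 x * \<Psi> (x + b N *\<^sub>R n))" .
    have i: "integrable lborel (\<lambda>x. ?h 0 x * \<Psi> (x + b N *\<^sub>R n))"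
    proof (rule integrable_bounded_support)
      show "\<bar>?h 0 x * \<Psi> (x + b N *\<^sub>R n)\<bar> \<le> C" for x using C by (auto simp: indicator_def)
      show "?h 0 x * \<Psi> (x + b N *\<^sub>R n) = 0" if "x \<notin> cball (q - b N *\<^sub>R n) R" for x
        using supp[of "x + b N *\<^sub>R n"] that by (auto simp: dist_norm algebra_simps)
    qed measurable
    have "a N = real (Suc N) * ((LINT x|lborel. ?h 0 x * \<Psi> (x + b N *\<^sub>R n)) - (LINT x|lborel. ?h 0 x * \<Psi> x))"
    proof -
      have "(LINT x|lborel. ?h 0 x * \<Psi> (x + b N *\<^sub>R n)) - (LINT x|lborel. ?h 0 x * \<Psi> x)
        = (LINT x|lborel. ?h 0 x * \<Psi> (x + b N *\<^sub>R n) - ?h 0 x * \<Psi> x)"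
        by (rule Bochner_Integration.integral_diff[symmetric]) (use i int\<Psi>[of "?h 0"] in \<open>auto simp: indicator_def\<close>)
      then show ?thesis
        unfolding a_def b_def[symmetric] by (simp add: algebra_simps flip: Bochner_Integration.integral_mult_right_zero)
    qed
    also have "(LINT x|lborel. ?h 0 x * \<Psi> (x + b N *\<^sub>R n)) - (LINT x|lborel. ?h 0 x * \<Psi> x)
      = (LINT x|lborel. ?h (b N) x * \<Psi> x - ?h 0 x * \<Psi> x)"
      unfolding e[symmetric]
      by (rule Bochner_Integration.integral_diff[symmetric]) (use int\<Psi>[of "?h 0"] int\<Psi>[of "?h (b N)"] in \<open>auto simp: indicator_def\<close>)
    also have "\<dots> = (LINT x|lborel. ?l 0 (b N) x * \<Psi> x)"
      using b[of N] by (intro Bochner_Integration.integral_cong) (auto simp: indicator_def)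
    finally show ?thesis .
  qed
  \<comment> \<open>The radius exceeds \<open>R + 1\<close>, so outside the larger ball both
    \<open>x\<close> and its projection miss the support. It is also at least 2, as
    \<open>slab_measure_le\<close> is applied with half-width
    \<open>2 * b N \<le> 2\<close>.\<close>
  define R' where "R' = max R 0 + 2"
  define K where "K = 2 * 3 ^ CARD('n) * unit_ball_vol CARD('n) * R' ^ (CARD('n) - 1)"
  have bound: "\<bar>a N - hyperplane_integral p n \<Psi>\<bar> \<le> L * K * 2 * b N" for N
  proof -
    let ?A = "{x \<in> cball q R'. \<bar>(x - p) \<bullet> n\<bar> < 2 * b N}"
    have Ab[measurable]: "?A \<in> sets borel"
      by measurable
    have Af: "emeasure lborel ?A < \<infinity>"
      by (rule emeasure_bounded_finite[OF bounded_subset[OF bounded_cball[of q R']]]) auto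
    have "\<bar>(LINT x|lborel. ?l 0 (b N) x * \<Psi> x) - (LINT x|lborel. ?l 0 (b N) x * \<Psi> (?\<pi> x))\<bar>
      = \<bar>LINT x|lborel. ?l 0 (b N) x * \<Psi> x - ?l 0 (b N) x * \<Psi> (?\<pi> x)\<bar>"
      by (subst Bochner_Integration.integral_diff) (use int\<Psi>[of "?l 0 (b N)"] int\<pi>[of 0 "b N"] in \<open>auto simp: indicator_def\<close>)
    also have "\<dots> \<le> (LINT x|lborel. L * b N * indicator ?A x)"
    proof (rule integral_abs_bound_integral)
      show "integrable lborel (\<lambda>x. ?l 0 (b N) x * \<Psi> x - ?l 0 (b N) x * \<Psi> (?\<pi> x))"
        by (intro Bochner_Integration.integrable_diff int\<Psi> int\<pi>) (auto simp: indicator_def)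
      show "integrable lborel (\<lambda>x. L * b N * indicator ?A x)"
        using Af Ab by (intro integrable_mult_right) simp
      fix x
      show "\<bar>?l 0 (b N) x * \<Psi> x - ?l 0 (b N) x * \<Psi> (?\<pi> x)\<bar> \<le> L * b N * indicator ?A x"
      proof (cases "0 < (x - p) \<bullet> n \<and> (x - p) \<bullet> n \<le> b N")
        case True
        show ?thesis
        proof (cases "x \<in> cball q R'")
          case True': True
          have "\<bar>\<Psi> x - \<Psi> (?\<pi> x)\<bar> \<le> L * ((x - p) \<bullet> n)"
            using Lip[of x "?\<pi> x"] n True by simp
          also have "\<dots> \<le> L * b N" using True L0 by (intro mult_left_mono) auto
          finally show ?thesis using True True' b[of N] by (simp add: indicator_def)
        next
          case False
          then have "x \<notin> cball q (R + 1)" "x \<notin> cball q R" by (auto simp: R'_def)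
          moreover have "\<bar>(x - p) \<bullet> n\<bar> \<le> 1" using True b[of N] by simp
          ultimately have "?\<pi> x \<notin> cball q R" "x \<notin> cball q R"
            using hyperplane_projection_dist[OF n] by blast+
          then show ?thesis using supp L0 b[of N] by (simp add: indicator_def)
        qed
      qed (use L0 b[of N] in \<open>auto simp: indicator_def\<close>)
    qed
    also have "\<dots> = L * b N * measure lebesgue ?A" using Ab by simp
    also have "\<dots> \<le> L * b N * (K * (2 * b N))"
      using slab_measure_le[OF n, of "2 * b N" R' q p] b[of N] L0
      by (intro mult_left_mono) (auto simp: K_def R'_def mult.assoc)
    finally have "real (Suc N) * \<bar>(LINT x|lborel. ?l 0 (b N) x * \<Psi> x) - (LINT x|lborel. ?l 0 (b N) x * \<Psi> (?\<pi> x))\<bar>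
      \<le> real (Suc N) * (L * b N * (K * (2 * b N)))"
      by (intro mult_left_mono) auto
    note le = this
    have "a N - hyperplane_integral p n \<Psi>
      = real (Suc N) * ((LINT x|lborel. ?l 0 (b N) x * \<Psi> x) - (LINT x|lborel. ?l 0 (b N) x * \<Psi> (?\<pi> x)))"
      using hyperplane_integral_slices[where q = q and R = R and p = p and N = N, OF cont supp n]
      unfolding a b_def by (simp add: right_diff_distrib del: of_nat_Suc)
    then have "\<bar>a N - hyperplane_integral p n \<Psi>\<bar>
      = real (Suc N) * \<bar>(LINT x|lborel. ?l 0 (b N) x * \<Psi> x) - (LINT x|lborel. ?l 0 (b N) x * \<Psi> (?\<pi> x))\<bar>"
      by (simp only: abs_mult abs_of_nat)
    also note le
    also have "real (Suc N) * (L * b N * (K * (2 * b N))) = (real (Suc N) * b N) * (L * K * 2 * b N)"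
      by (simp only: ac_simps)
    also have "\<dots> = L * K * 2 * b N" by (simp only: b(3) mult_1_left)
    finally show ?thesis .
  qed
  have "(\<lambda>N. L * K * 2 * b N) \<longlonglongrightarrow> L * K * 2 * 0"
    unfolding b_def using lim_inverse_n'[THEN LIMSEQ_Suc] by (intro tendsto_mult_left)
  then have lim0: "(\<lambda>N. L * K * 2 * b N) \<longlonglongrightarrow> 0" by (simp only: mult_zero_right)
  have "(\<lambda>N. a N - hyperplane_integral p n \<Psi>) \<longlonglongrightarrow> 0"
    by (rule Lim_null_comparison[OF always_eventually lim0]) (simp only: real_norm_def bound simp_thms)
  then have "a \<longlonglongrightarrow> hyperplane_integral p n \<Psi>" by (simp add: LIM_zero_iff)
  moreover have "a \<longlonglongrightarrow> (LINT x|lborel. ?h 0 x * (grad \<Psi> x \<bullet> n))"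
    unfolding a_def by (rule difference_quotient_integral[OF \<Psi> supp]) measurable
  ultimately show ?thesis using LIMSEQ_unique by blast
qed

text \<open>Along a direction that leaves \<open>H\<close> invariant, translation invariance makes
  the integral of every difference quotient zero.\<close>

lemma invariant_set_integral_grad:
  fixes \<Psi> :: "real ^ 'n \<Rightarrow> real"
  assumes \<Psi>: "Ck (Suc 0) \<Psi>" and supp: "\<And>x. x \<notin> cball q R \<Longrightarrow> \<Psi> x = 0"
    and H: "H \<in> sets borel" "\<And>x t. x + t *\<^sub>R u \<in> H \<longleftrightarrow> x \<in> H"
  shows "(LINT x|lborel. indicator H x * (grad \<Psi> x \<bullet> u)) = 0"
proof -
  have cont: "continuous_on UNIV \<Psi>" using Ck_imp_continuous[OF \<Psi>] .
  have [measurable]: "\<Psi> \<in> borel_measurable borel" by (rule borel_measurable_continuous_onI[OF cont])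
  note [measurable] = H(1)
  obtain C where C: "0 \<le> C" "\<And>x. \<bar>\<Psi> x\<bar> \<le> C"
    using continuous_compact_support_bounded[OF cont supp] by blast
  have "(LINT x|lborel. indicator H x * (c * (\<Psi> (x + t *\<^sub>R u) - \<Psi> x))) = 0" for c t
  proof -
    have i: "integrable lborel (\<lambda>x. indicator H x * \<Psi> x)"
      using C supp by (intro integrable_bounded_support[where C = C and q = q and R = R]) (auto simp: indicator_def)
    have i': "integrable lborel (\<lambda>x. indicator H x * \<Psi> (x + t *\<^sub>R u))"
    proof (rule integrable_bounded_support)
      show "\<bar>indicator H x * \<Psi> (x + t *\<^sub>R u)\<bar> \<le> C" for x using C by (auto simp: indicator_def)
      show "indicator H x * \<Psi> (x + t *\<^sub>R u) = 0" if "x \<notin> cball (q - t *\<^sub>R u) R" for x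
        using supp[of "x + t *\<^sub>R u"] that by (auto simp: dist_norm algebra_simps)
    qed measurable
    have "(LINT x|lborel. indicator H x * \<Psi> x) = (LINT x|lborel. indicator H (x + t *\<^sub>R u) * \<Psi> (x + t *\<^sub>R u))"
      by (rule integral_lborel_translation[symmetric]) measurable
    then have "(LINT x|lborel. indicator H x * \<Psi> x) = (LINT x|lborel. indicator H x * \<Psi> (x + t *\<^sub>R u))"
      using H(2) by (simp add: indicator_def)
    then have "(LINT x|lborel. indicator H x * \<Psi> (x + t *\<^sub>R u) - indicator H x * \<Psi> x) = 0"
      using i i' by simp
    then have "(LINT x|lborel. c * (indicator H x * \<Psi> (x + t *\<^sub>R u) - indicator H x * \<Psi> x)) = 0" by simp
    then show ?thesis by (simp add: algebra_simps)
  qed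
  then have "(\<lambda>N::nat. 0 :: real) \<longlonglongrightarrow> (LINT x|lborel. indicator H x * (grad \<Psi> x \<bullet> u))"
    using difference_quotient_integral[where u = u, OF \<Psi> supp H(1)] by (simp only:)
  then show ?thesis using LIMSEQ_unique tendsto_const by blast
qed

text \<open>Each axis splits into a multiple of \<open>n\<close> and a part \<open>u\<close>
  orthogonal to \<open>n\<close>. The half-space is invariant under \<open>u\<close>, so only the
  normal part contributes.\<close>

lemma halfspace_integral_grad:
  fixes \<Psi> :: "real ^ 'n \<Rightarrow> real"
  assumes \<Psi>: "Ck (Suc 0) \<Psi>" and supp: "\<And>x. x \<notin> cball q R \<Longrightarrow> \<Psi> x = 0" and n: "norm n = 1"
  shows "(LINT x|lborel. indicator {x. (x - p) \<bullet> n \<le> 0} x * grad \<Psi> x $ i) = n $ i * hyperplane_integral p n \<Psi>"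
proof -
  define u where "u = axis i 1 - (n $ i) *\<^sub>R n"
  let ?h = "\<lambda>x. indicator {x. (x - p) \<bullet> n \<le> 0} x :: real"
  have nn: "n \<bullet> n = 1" using n by (simp add: norm_eq_1)
  have un: "u \<bullet> n = 0" by (simp add: u_def inner_diff_left nn inner_axis')
  have [measurable]: "grad \<Psi> \<in> borel_measurable borel"
    by (rule borel_measurable_continuous_onI[OF Ck1_continuous_grad[OF \<Psi>]])
  obtain L where L0: "0 \<le> L" and L: "\<And>x. norm (grad \<Psi> x) \<le> L"
    using Ck1_grad_bounded[OF \<Psi> supp] by blast
  have int: "integrable lborel (\<lambda>x. ?h x * (grad \<Psi> x \<bullet> v))" for v
  proof (rule integrable_bounded_support)
    show "\<bar>?h x * (grad \<Psi> x \<bullet> v)\<bar> \<le> L * norm v" for x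
      using order_trans[OF Cauchy_Schwarz_ineq2 mult_right_mono[OF L[of x] norm_ge_zero[of v]]] L0
      by (auto simp: indicator_def)
    show "?h x * (grad \<Psi> x \<bullet> v) = 0" if "x \<notin> cball q R" for x
      using grad_eq_0_outside[OF supp that] by simp
  qed measurable
  have "(LINT x|lborel. ?h x * grad \<Psi> x $ i)
    = (LINT x|lborel. ?h x * (grad \<Psi> x \<bullet> u) + n $ i * (?h x * (grad \<Psi> x \<bullet> n)))"
    by (intro Bochner_Integration.integral_cong)
      (auto simp: u_def inner_diff_right inner_axis algebra_simps)
  also have "\<dots> = (LINT x|lborel. ?h x * (grad \<Psi> x \<bullet> u)) + n $ i * (LINT x|lborel. ?h x * (grad \<Psi> x \<bullet> n))"
    using int by simp
  also have "(LINT x|lborel. ?h x * (grad \<Psi> x \<bullet> u)) = 0"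
    by (rule invariant_set_integral_grad[OF \<Psi> supp]) (use un in \<open>auto simp: inner_add_left inner_diff_left\<close>)
  finally show ?thesis
    using halfspace_integral_grad_normal[where q = q and R = R and p = p, OF \<Psi> supp n] by simp
qed

lemma integral_grad_0:
  fixes \<Psi> :: "real ^ 'n \<Rightarrow> real"
  assumes "Ck (Suc 0) \<Psi>" and "\<And>x. x \<notin> cball q R \<Longrightarrow> \<Psi> x = 0"
  shows "(LINT x|lborel. grad \<Psi> x $ i) = 0"
  using invariant_set_integral_grad[where H = UNIV and u = "axis i 1", OF assms] by (simp add: inner_axis)

section \<open>Test functions and weak derivatives\<close>

lemma L2_continuous_bounded:
  fixes f :: "real ^ 'n \<Rightarrow> 'b::euclidean_space"
  assumes f: "continuous_on UNIV f" and S: "S \<in> sets lebesgue" "bounded S"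
  shows "f \<in> L2 S"
proof -
  obtain R where R: "S \<subseteq> cball 0 R" using bounded_subset_ballD[OF S(2)] ball_subset_cball by blast
  have "compact (f ` cball 0 R)"
    using f by (intro compact_continuous_image) (auto intro: continuous_on_subset)
  then obtain C where C: "\<And>y. y \<in> f ` cball 0 R \<Longrightarrow> norm y \<le> C"
    using compact_imp_bounded bounded_iff by metis
  have m: "f \<in> borel_measurable borel" by (rule borel_measurable_continuous_onI[OF f])
  have "integrable lborel (\<lambda>x. indicator (cball 0 R) x * (norm (f x))\<^sup>2)"
  proof (rule integrable_bounded_support)
    show "\<bar>indicator (cball 0 R) x * (norm (f x))\<^sup>2\<bar> \<le> C\<^sup>2" for x
      using C[of "f x"] by (auto simp: indicator_def abs_le_square_iff[symmetric])
    show "indicator (cball 0 R) x * (norm (f x))\<^sup>2 = 0" if "x \<notin> cball 0 R" for x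
      using that by simp
    show m2: "(\<lambda>x. indicator (cball 0 R) x * (norm (f x))\<^sup>2) \<in> borel_measurable borel"
      using m by (intro borel_measurable_times borel_measurable_indicator borel_measurable_power borel_measurable_norm) auto
  qed
  then have "integrable lebesgue (\<lambda>x. indicator (cball 0 R) x * (norm (f x))\<^sup>2)"
    using borel_measurable_integrable by (subst integrable_completion) auto
  moreover have "(\<lambda>x. indicator (cball 0 R) x *\<^sub>R f x) \<in> borel_measurable lebesgue"
    by (intro measurable_completion borel_measurable_scaleR borel_measurable_indicator) (use m in auto)
  ultimately have "f \<in> L2 (cball 0 R)" by (simp add: L2_iff)
  then show ?thesis by (rule L2_subset) (use S R in auto)
qed

lemma l2_inner_lborel:
  fixes f g :: "real ^ 'n \<Rightarrow> 'b::euclidean_space"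
  assumes "S \<in> sets lebesgue" "continuous_on UNIV f" "continuous_on UNIV g" "\<And>x. x \<notin> S \<Longrightarrow> f x \<bullet> g x = 0"
  shows "l2_inner S f g = (LINT x|lborel. f x \<bullet> g x)"
proof -
  have "l2_inner S f g = (LINT x|lebesgue. f x \<bullet> g x)"
    unfolding l2_inner_set[OF assms(1)]
    by (intro Bochner_Integration.integral_cong) (use assms(4) in \<open>auto simp: indicator_def\<close>)
  also have "\<dots> = (LINT x|lborel. f x \<bullet> g x)"
    using assms(2,3) by (intro integral_completion) (auto intro!: borel_measurable_continuous_onI continuous_on_inner)
  finally show ?thesis .
qed

lemma test_functions_Ck: "\<phi> \<in> test_functions U \<Longrightarrow> Ck k \<phi>"
  by (simp add: test_functions_def)

lemma test_functions_outside:
  assumes "\<phi> \<in> test_functions U" "x \<notin> U"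
  shows "\<phi> x = 0" "grad \<phi> x = 0"
proof -
  have x: "x \<in> - closure {x. \<phi> x \<noteq> 0}" using assms by (auto simp: test_functions_def)
  have zero: "\<phi> y = 0" if "y \<in> - closure {x. \<phi> x \<noteq> 0}" for y
    using that closure_subset[of "{x. \<phi> x \<noteq> 0}"] by (cases "\<phi> y = 0") auto
  then show "\<phi> x = 0" using x by blast
  have "grad \<phi> x = grad (\<lambda>_. 0) x"
    by (rule grad_cong_open[OF _ x zero]) auto
  then show "grad \<phi> x = 0" by simp
qed

lemma test_functions_support:
  assumes "\<phi> \<in> test_functions U"
  obtains R where "\<And>x. x \<notin> cball 0 R \<Longrightarrow> \<phi> x = 0"
proof -
  have "bounded (closure {x. \<phi> x \<noteq> 0})" using assms by (simp add: test_functions_def compact_imp_bounded)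
  then obtain R where "closure {x. \<phi> x \<noteq> 0} \<subseteq> cball 0 R" using bounded_subset_ballD ball_subset_cball by (meson subset_trans)
  then have "\<phi> x = 0" if "x \<notin> cball 0 R" for x
    using that closure_subset[of "{x. \<phi> x \<noteq> 0}"] by (cases "\<phi> x = 0") auto
  then show ?thesis by (rule that)
qed

lemma test_functionsI:
  assumes "\<And>k. Ck k \<phi>" "compact K" "K \<subseteq> U" "\<And>x. x \<notin> K \<Longrightarrow> \<phi> x = 0"
  shows "\<phi> \<in> test_functions U"
proof -
  have "closure {x. \<phi> x \<noteq> 0} \<subseteq> K"
    using assms by (intro closure_minimal) (auto intro: compact_imp_closed)
  moreover have "compact (closure {x. \<phi> x \<noteq> 0})"
    using compact_Int_closed[OF assms(2) closed_closure] calculation by (metis Int_absorb1)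
  ultimately show ?thesis using assms(1,3) by (auto simp: test_functions_def)
qed

lemma test_functions_continuous:
  assumes "\<phi> \<in> test_functions U"
  shows "continuous_on UNIV \<phi>" "continuous_on UNIV (grad \<phi>)"
  using Ck_imp_continuous[OF test_functions_Ck[OF assms]] Ck1_continuous_grad[OF test_functions_Ck[OF assms]]
  by auto

lemma L2_compact_support:
  fixes f :: "real ^ 'n \<Rightarrow> 'b::euclidean_space"
  assumes f: "continuous_on UNIV f" and supp: "\<And>x. x \<notin> cball 0 R \<Longrightarrow> f x = 0" and S: "S \<in> sets lebesgue"
  shows "f \<in> L2 S"
proof -
  have "f \<in> L2 (cball 0 R)" by (rule L2_continuous_bounded[OF f]) auto
  moreover have "indicator (cball 0 R) x *\<^sub>R f x = f x" "indicator (cball 0 R) x * (norm (f x))\<^sup>2 = (norm (f x))\<^sup>2" for x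
    using supp[of x] by (auto simp: indicator_def)
  ultimately have "f \<in> L2 UNIV" by (simp add: L2_iff)
  then show ?thesis by (rule L2_subset) (use S in auto)
qed

lemma test_functions_L2:
  assumes \<phi>: "\<phi> \<in> test_functions U" and S: "S \<in> sets lebesgue"
  shows "\<phi> \<in> L2 S" "grad \<phi> \<in> L2 S"
proof -
  obtain R where R: "\<And>x. x \<notin> cball 0 R \<Longrightarrow> \<phi> x = 0" using test_functions_support[OF \<phi>] by blast
  show "\<phi> \<in> L2 S" using L2_compact_support[OF test_functions_continuous(1)[OF \<phi>] _ S] R by blast
  show "grad \<phi> \<in> L2 S"
    using L2_compact_support[OF test_functions_continuous(2)[OF \<phi>] _ S] grad_eq_0_outside[of 0 R \<phi>] R by blast
qed

section \<open>The fundamental lemma of the calculus of variations\<close>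

lemma exp_bump_scaled_tendsto:
  assumes "0 < t" shows "(\<lambda>k. exp_bump 0 (real k * t)) \<longlonglongrightarrow> 1"
proof -
  have "(\<lambda>k. exp (- (inverse (real k) * inverse t))) \<longlonglongrightarrow> exp (- (0 * inverse t))"
    by (intro tendsto_intros lim_inverse_n)
  moreover have "eventually (\<lambda>k. exp (- (inverse (real k) * inverse t)) = exp_bump 0 (real k * t)) sequentially"
    using eventually_gt_at_top[of 0] by eventually_elim (use assms in \<open>auto simp: exp_bump_def zero_less_mult_iff not_le mult_le_0_iff\<close>)
  ultimately show ?thesis using tendsto_cong by fastforce
qed

text \<open>For growing \<open>k\<close> the function \<open>exp_bump 0 (k * t)\<close> tends to 1
  for \<open>t > 0\<close> and stays 0 for \<open>t \<le> 0\<close>. A product over the two faces in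
  every coordinate therefore approximates the open box from inside, with support in the closed
  box.\<close>

lemma box_indicator_approx:
  fixes a b :: "real ^ 'n"
  assumes "cbox a b \<subseteq> U"
  obtains \<phi> where "\<And>k. \<phi> k \<in> test_functions U" "\<And>k x. \<bar>\<phi> k x\<bar> \<le> indicator (cbox a b) x"
    "\<And>x. (\<lambda>k. \<phi> k x) \<longlonglongrightarrow> indicator (box a b) x"
proof
  define \<phi> where "\<phi> k x = (\<Prod>i\<in>UNIV. exp_bump 0 (real k * (x $ i - a $ i)) * exp_bump 0 (real k * (b $ i - x $ i)))"
    for k :: nat and x :: "real ^ 'n"
  have out: "\<phi> k x = 0" if "x \<notin> box a b" for k x
  proof -
    have "\<exists>i. \<not> (a $ i < x $ i \<and> x $ i < b $ i)" using that unfolding mem_box_cart by simp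
    then obtain i where "\<not> (a $ i < x $ i \<and> x $ i < b $ i)" by (rule exE)
    then have "real k * (x $ i - a $ i) \<le> 0 \<or> real k * (b $ i - x $ i) \<le> 0"
      by (auto simp: mult_le_0_iff)
    then have "exp_bump 0 (real k * (x $ i - a $ i)) * exp_bump 0 (real k * (b $ i - x $ i)) = 0" by auto
    then show ?thesis unfolding \<phi>_def by (intro prod_zero) auto
  qed
  have Ck: "Ck m (\<phi> k)" for m k
  proof -
    have c: "Ck m (\<lambda>x :: real ^ 'n. c + d * x $ i)" for c d i
      using Ck_affine[of m c "d *\<^sub>R axis i 1"] by (simp add: inner_axis')
    have "Ck m (\<lambda>x. real k * (x $ i - a $ i))" "Ck m (\<lambda>x. real k * (b $ i - x $ i))" for i
      using c[of "- real k * a $ i" "real k" i] c[of "real k * b $ i" "- real k" i] by (simp_all add: algebra_simps)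
    then show ?thesis unfolding \<phi>_def by (intro Ck_prod Ck_mult[OF Ck_exp_bump Ck_exp_bump])
  qed
  show "\<phi> k \<in> test_functions U" for k
    by (rule test_functionsI[OF Ck, of "cbox a b"]) (use assms out box_subset_cbox[of a b] in auto)
  show "\<bar>\<phi> k x\<bar> \<le> indicator (cbox a b) x" for k x
  proof (cases "x \<in> cbox a b")
    case True
    have "0 \<le> \<phi> k x \<and> \<phi> k x \<le> 1"
      unfolding \<phi>_def by (intro conjI prod_nonneg prod_le_1) (auto intro: mult_le_one exp_bump_0_le_1)
    then show ?thesis using True by simp
  next
    case False
    then show ?thesis using out[of x k] box_subset_cbox by auto
  qed
  show "(\<lambda>k. \<phi> k x) \<longlonglongrightarrow> indicator (box a b) x" for x
  proof (cases "x \<in> box a b")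
    case True
    then have "(\<lambda>k. \<phi> k x) \<longlonglongrightarrow> (\<Prod>i::'n\<in>UNIV. 1 * 1)"
      unfolding \<phi>_def by (intro tendsto_prod tendsto_mult exp_bump_scaled_tendsto) (auto simp: mem_box_cart)
    then show ?thesis using True by simp
  qed (use out in auto)
qed

lemma test_functions_box_integral_0:
  fixes g :: "real ^ 'n \<Rightarrow> real"
  assumes g: "g \<in> L2 S" and S: "S \<in> sets lebesgue"
    and zero: "\<And>\<phi>. \<phi> \<in> test_functions (interior S) \<Longrightarrow> l2_inner S g \<phi> = 0"
    and ab: "cbox a b \<subseteq> interior S"
  shows "(LINT x|lebesgue. indicator (box a b) x * g x) = 0"
proof -
  obtain \<phi> where \<phi>: "\<And>k. \<phi> k \<in> test_functions (interior S)" "\<And>k x. \<bar>\<phi> k x\<bar> \<le> indicator (cbox a b) x"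
    "\<And>x. (\<lambda>k. \<phi> k x) \<longlonglongrightarrow> indicator (box a b) x"
    using box_indicator_approx[OF ab] by blast
  have sub: "cbox a b \<subseteq> S" using ab interior_subset by blast
  have "g \<in> L2 (cbox a b)" by (rule L2_subset[OF g S _ sub]) auto
  moreover have "(\<lambda>_. 1::real) \<in> L2 (cbox a b)" by (rule L2_const) auto
  ultimately have int: "integrable lebesgue (\<lambda>x. indicator (cbox a b) x * g x)"
    using L2_inner_integrable[of g "cbox a b" "\<lambda>_. 1"] by (simp add: integrable_restrict_space)
  have "(\<lambda>k. LINT x|lebesgue. (indicator (cbox a b) x * g x) * \<phi> k x)
    \<longlonglongrightarrow> (LINT x|lebesgue. (indicator (cbox a b) x * g x) * indicator (box a b) x)"
  proof (rule integral_dominated_convergence)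
    show "integrable lebesgue (\<lambda>x. \<bar>indicator (cbox a b) x * g x\<bar>)" using int by simp
    show "AE x in lebesgue. (\<lambda>k. (indicator (cbox a b) x * g x) * \<phi> k x)
        \<longlonglongrightarrow> (indicator (cbox a b) x * g x) * indicator (box a b) x"
      using \<phi>(3) by (intro AE_I2 tendsto_mult_left) auto
    show "AE x in lebesgue. norm ((indicator (cbox a b) x * g x) * \<phi> k x) \<le> \<bar>indicator (cbox a b) x * g x\<bar>" for k
    proof (intro AE_I2)
      fix x
      have "\<bar>\<phi> k x\<bar> \<le> 1" using \<phi>(2)[of k x] indicator_le_1 order_trans by blast
      then show "norm ((indicator (cbox a b) x * g x) * \<phi> k x) \<le> \<bar>indicator (cbox a b) x * g x\<bar>"
        by (simp add: abs_mult mult_left_le)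
    qed
    show "(\<lambda>x. (indicator (cbox a b) x * g x) * \<phi> k x) \<in> borel_measurable lebesgue" for k
      using borel_measurable_continuous_onI[OF test_functions_continuous(1)[OF \<phi>(1)], of k]
      by (intro borel_measurable_times[OF borel_measurable_integrable[OF int]]) (auto intro: measurable_completion)
    show "(\<lambda>x. (indicator (cbox a b) x * g x) * indicator (box a b) x) \<in> borel_measurable lebesgue"
      by (intro borel_measurable_times[OF borel_measurable_integrable[OF int]] borel_measurable_indicator) auto
  qed
  moreover have "(LINT x|lebesgue. (indicator (cbox a b) x * g x) * \<phi> k x) = 0" for k
  proof -
    have "(LINT x|lebesgue. (indicator (cbox a b) x * g x) * \<phi> k x) = l2_inner S g (\<phi> k)"
      unfolding l2_inner_set[OF S]
    proof (intro Bochner_Integration.integral_cong refl)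
      fix x
      show "indicator (cbox a b) x * g x * \<phi> k x = indicator S x * (g x \<bullet> \<phi> k x)"
        using \<phi>(2)[of k x] sub by (cases "x \<in> cbox a b") auto
    qed
    then show ?thesis using zero[OF \<phi>(1)] by simp
  qed
  ultimately have "(LINT x|lebesgue. (indicator (cbox a b) x * g x) * indicator (box a b) x) = 0"
    by (simp add: LIMSEQ_const_iff)
  moreover have "(indicator (cbox a b) x * g x) * indicator (box a b) x = indicator (box a b) x * g x" for x
    using box_subset_cbox[of a b] by (auto simp: indicator_def)
  ultimately show ?thesis by simp
qed

text \<open>Boxes are stable under intersection and generate the Borel sets, so a Dynkin argument
  carries the vanishing of the integrals to all Borel sets. The whole space is not a box, hence the
  separate assumption, which the step for complements uses. Uniqueness of densities then
  finishes.\<close>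

lemma AE_eq_0_from_box_integrals:
  fixes h :: "'a::euclidean_space \<Rightarrow> real"
  assumes int: "integrable lebesgue h"
    and UNIV: "(LINT x|lebesgue. h x) = 0"
    and box: "\<And>a b. (LINT x|lebesgue. indicator (box a b) x * h x) = 0"
  shows "AE x in lebesgue. h x = 0"
proof -
  have si: "set_integrable lebesgue A h" if "A \<in> sets lebesgue" for A
    using int that unfolding set_integrable_def by (rule integrable_mult_indicator[rotated])
  have borel: "(LINT x:A|lebesgue. h x) = 0" if "A \<in> sets borel" for A
  proof -
    let ?G = "range (\<lambda>(a, b). box a b :: 'a set)"
    have sub: "sigma_sets UNIV ?G = sets borel" by (simp add: borel_eq_box)
    have A: "A \<in> sigma_sets UNIV ?G" using that sub by simp
    have "Int_stable ?G" by (auto simp: Int_stable_def box_Int_box)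
    then show ?thesis
    proof (rule sigma_sets_induct_disjoint[where P = "\<lambda>A. (LINT x:A|lebesgue. h x) = 0", OF _ _ A])
      show "(LINT x:A|lebesgue. h x) = 0" if "A \<in> ?G" for A
        using that box by (auto simp: set_lebesgue_integral_def)
      show "(LINT x:UNIV - A|lebesgue. h x) = 0"
        if "A \<in> sigma_sets UNIV ?G" "(LINT x:A|lebesgue. h x) = 0" for A
      proof -
        have A: "A \<in> sets lebesgue" using sub that by auto
        have "indicator (UNIV - A) x *\<^sub>R h x = h x - indicator A x *\<^sub>R h x" for x
          by (auto simp: indicator_def)
        then show ?thesis
          using si[OF A] int UNIV that(2) unfolding set_lebesgue_integral_def set_integrable_def by simp
      qed
      show "(LINT x:(\<Union>i. A i)|lebesgue. h x) = 0"
        if "disjoint_family A" "range A \<subseteq> sigma_sets UNIV ?G" "\<And>i. (LINT x:A i|lebesgue. h x) = 0"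
        for A :: "nat \<Rightarrow> 'a set"
      proof -
        have m: "A i \<in> sets lebesgue" for i using sub that(2) by auto
        have "(LINT x:(\<Union>i. A i)|lebesgue. h x) = (\<Sum>i. LINT x:A i|lebesgue. h x)"
          by (rule lebesgue_integral_countable_add[OF m])
            (use that(1) m in \<open>auto simp: disjoint_family_on_def intro!: si\<close>)
        then show ?thesis using that(3) by simp
      qed
    qed (auto simp: set_lebesgue_integral_def)
  qed
  have "AE x in lebesgue. h x = (\<lambda>_. 0) x"
  proof (rule density_unique_real[OF int])
    fix A :: "'a set" assume "A \<in> sets lebesgue"
    \<comment> \<open>A Lebesgue set is a Borel set up to a subset of a null set, which does not
      change the integral.\<close>
    then obtain B N N' where B: "A = B \<union> N" "N \<subseteq> N'" "N' \<in> null_sets lborel" "B \<in> sets lborel"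
      by (auto elim: sets_completionE)
    then have "N' \<in> null_sets lebesgue" using null_sets_completionI by blast
    have ae: "AE x in lebesgue. indicator A x *\<^sub>R h x = indicator B x *\<^sub>R h x"
      using AE_not_in[OF \<open>N' \<in> null_sets lebesgue\<close>] by eventually_elim (use B in \<open>auto simp: indicator_def\<close>)
    have "(LINT x:A|lebesgue. h x) = (LINT x:B|lebesgue. h x)"
      unfolding set_lebesgue_integral_def
      using si[OF \<open>A \<in> sets lebesgue\<close>] si[of B] B
      by (intro integral_cong_AE ae) (auto simp: set_integrable_def)
    then show "(LINT x:A|lebesgue. h x) = (LINT x:A|lebesgue. 0)"
      using borel[of B] B by simp
  qed simp
  then show ?thesis by simp
qed

text \<open>Square-integrability gives integrability only on sets of finite measure, so the argument
  runs on closed boxes inside the interior. Countably many of them exhaust it.\<close>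

lemma fundamental_lemma_variations:
  fixes g :: "real ^ 'n \<Rightarrow> real"
  assumes g: "g \<in> L2 S" and S: "S \<in> sets lebesgue"
    and zero: "\<And>\<phi>. \<phi> \<in> test_functions (interior S) \<Longrightarrow> l2_inner S g \<phi> = 0"
  shows "AE x in lebesgue. x \<in> interior S \<longrightarrow> g x = 0"
proof -
  have cbox: "AE x in lebesgue. x \<in> cbox c d \<longrightarrow> g x = 0" if cd: "cbox c d \<subseteq> interior S" for c d
  proof -
    have sub: "box c d \<subseteq> S" "cbox c d \<subseteq> S" using cd interior_subset box_subset_cbox by blast+
    have "g \<in> L2 (box c d)" by (rule L2_subset[OF g S _ sub(1)]) auto
    moreover have "(\<lambda>_. 1::real) \<in> L2 (box c d)" by (rule L2_const) auto
    ultimately have int: "integrable lebesgue (\<lambda>x. indicator (box c d) x * g x)"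
      using L2_inner_integrable[of g "box c d" "\<lambda>_. 1"] by (simp add: integrable_restrict_space)
    have "AE x in lebesgue. indicator (box c d) x * g x = 0"
    proof (rule AE_eq_0_from_box_integrals[OF int])
      show "(LINT x|lebesgue. indicator (box c d) x * g x) = 0"
        by (rule test_functions_box_integral_0[OF g S zero cd])
      fix a b
      \<comment> \<open>An arbitrary box cut with \<open>box c d\<close> is again a box, and its
        closed version stays inside \<open>cbox c d\<close>, where test functions are
        available.\<close>
      define a' b' where "a' = (\<Sum>i\<in>Basis. max (a\<bullet>i) (c\<bullet>i) *\<^sub>R i)" and "b' = (\<Sum>i\<in>Basis. min (b\<bullet>i) (d\<bullet>i) *\<^sub>R i)"
      have "box a b \<inter> box c d = box a' b'" unfolding a'_def b'_def by (rule box_Int_box)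
      then have "indicator (box a b) x * (indicator (box c d) x * g x) = indicator (box a' b') x * g x" for x
        by (auto simp: indicator_def set_eq_iff)
      moreover have "cbox a' b' \<subseteq> cbox c d"
        unfolding a'_def b'_def by (auto simp: mem_box)
      then have "(LINT x|lebesgue. indicator (box a' b') x * g x) = 0"
        using test_functions_box_integral_0[OF g S zero] cd by blast
      ultimately show "(LINT x|lebesgue. indicator (box a b) x * (indicator (box c d) x * g x)) = 0" by (simp only:)
    qed
    moreover have "AE x in lebesgue. x \<notin> cbox c d - box c d"
      using negligible_frontier_interval[of c d] by (intro AE_not_in) (simp add: negligible_iff_null_sets)
    ultimately show ?thesis by eventually_elim (auto simp: indicator_def split: if_splits)
  qed
  obtain \<D> where \<D>: "countable \<D>" "\<D> \<subseteq> Pow (interior S)" "\<And>X. X \<in> \<D> \<Longrightarrow> \<exists>a b. X = cbox a b" "\<Union>\<D> = interior S"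
    by (rule open_countable_Union_open_cbox[OF open_interior[of S]]) (rule that)
  have "\<forall>X\<in>\<D>. AE x in lebesgue. x \<in> X \<longrightarrow> g x = 0"
  proof
    fix X assume X: "X \<in> \<D>"
    then obtain a b where "X = cbox a b" using \<D>(3) by blast
    then show "AE x in lebesgue. x \<in> X \<longrightarrow> g x = 0" using cbox[of a b] X \<D>(2) by auto
  qed
  then have "AE x in lebesgue. \<forall>X\<in>\<D>. x \<in> X \<longrightarrow> g x = 0"
    by (subst AE_ball_countable[OF \<D>(1)])
  then show ?thesis by eventually_elim (use \<D>(4) in auto)
qed

section \<open>Weak derivatives: uniqueness and agreement with classical ones\<close>

lemma weak_div_works:
  assumes "\<tau> \<in> Hdiv S"
  shows "weak_div S \<tau> \<in> L2 S" "is_weak_div S \<tau> (weak_div S \<tau>)"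
  using someI_ex[of "\<lambda>g. g \<in> L2 S \<and> is_weak_div S \<tau> g"] assms
  unfolding weak_div_def[symmetric] Hdiv_def by blast+

text \<open>Makes the choice hidden in \<open>weak_div\<close> harmless. Only the interior is
  reached, because the test functions live there.\<close>

lemma weak_div_unique:
  assumes S: "S \<in> sets lebesgue"
    and g: "g \<in> L2 S" "is_weak_div S \<tau> g" and h: "h \<in> L2 S" "is_weak_div S \<tau> h"
  shows "AE x in lebesgue. x \<in> interior S \<longrightarrow> g x = h x"
proof -
  have "AE x in lebesgue. x \<in> interior S \<longrightarrow> g x - h x = 0"
  proof (rule fundamental_lemma_variations[OF L2_diff[OF g(1) h(1)] S])
    fix \<phi> assume \<phi>: "\<phi> \<in> test_functions (interior S)"
    then have "l2_inner S g \<phi> = l2_inner S h \<phi>"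
      using g(2) h(2) unfolding is_weak_div_def by (metis neg_equal_iff_equal)
    then show "l2_inner S (\<lambda>x. g x - h x) \<phi> = 0"
      by (simp add: l2_inner_diff g h test_functions_L2[OF \<phi> S])
  qed
  then show ?thesis by eventually_elim auto
qed

lemma weak_grad_unique:
  fixes g h :: "real ^ 'n \<Rightarrow> real ^ 'n"
  assumes S: "S \<in> sets lebesgue"
    and g: "g \<in> L2 S" "is_weak_grad S v g" and h: "h \<in> L2 S" "is_weak_grad S v h"
  shows "AE x in lebesgue. x \<in> interior S \<longrightarrow> g x = h x"
proof -
  have "AE x in lebesgue. x \<in> interior S \<longrightarrow> g x $ i - h x $ i = 0" for i
  proof (rule fundamental_lemma_variations[OF L2_diff[OF L2_component[OF g(1)] L2_component[OF h(1)]] S])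
    fix \<phi> assume \<phi>: "\<phi> \<in> test_functions (interior S)"
    then have "l2_inner S (\<lambda>x. g x $ i) \<phi> = l2_inner S (\<lambda>x. h x $ i) \<phi>"
      using g(2) h(2) unfolding is_weak_grad_def by (metis neg_equal_iff_equal)
    then show "l2_inner S (\<lambda>x. g x $ i - h x $ i) \<phi> = 0"
      by (simp add: l2_inner_diff L2_component g h test_functions_L2[OF \<phi> S])
  qed
  then have "AE x in lebesgue. \<forall>i. x \<in> interior S \<longrightarrow> g x $ i - h x $ i = 0"
    by (subst AE_all_countable) blast
  then show ?thesis by eventually_elim (auto simp: vec_eq_iff)
qed

lemma grad_mult:
  assumes "Ck (Suc 0) f" "Ck (Suc 0) g"
  shows "grad (\<lambda>x. f x * g x) x = f x *\<^sub>R grad g x + g x *\<^sub>R grad f x"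
  using grad_eqI[OF has_derivative_mult[OF Ck_has_derivative[OF assms(1)] Ck_has_derivative[OF assms(2)]]]
  by (simp add: vec_eq_iff inner_axis)

text \<open>The product inherits the bounded support of \<open>g\<close>, so its gradient integrates
  to zero over the whole space.\<close>

lemma integration_by_parts:
  fixes f g :: "real ^ 'n \<Rightarrow> real"
  assumes f: "Ck (Suc 0) f" and g: "Ck (Suc 0) g" and supp: "\<And>x. x \<notin> cball q R \<Longrightarrow> g x = 0"
  shows "(LINT x|lborel. f x * grad g x $ i) = - (LINT x|lborel. grad f x $ i * g x)"
proof -
  have fg: "Ck (Suc 0) (\<lambda>x. f x * g x)" by (rule Ck_mult[OF f g])
  have int: "integrable lborel h" if "continuous_on UNIV h" "\<And>x. x \<notin> cball q R \<Longrightarrow> h x = 0" for h :: "real ^ 'n \<Rightarrow> real"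
    using continuous_compact_support_bounded[OF that] integrable_bounded_support that
      borel_measurable_continuous_onI by metis
  have c: "continuous_on UNIV (\<lambda>x. grad h x $ i)" if "Ck (Suc 0) h" for h using that by simp
  have z: "x \<notin> cball q R \<Longrightarrow> grad g x = 0" for x using grad_eq_0_outside[of q R g] supp by blast
  have i1: "integrable lborel (\<lambda>x. f x * grad g x $ i)"
    by (intro int continuous_on_mult c[OF g] Ck_imp_continuous[OF f])
      (simp add: z)
  have i2: "integrable lborel (\<lambda>x. grad f x $ i * g x)"
    using supp by (intro int continuous_on_mult c[OF f] Ck_imp_continuous[OF g]) auto
  have "0 = (LINT x|lborel. grad (\<lambda>x. f x * g x) x $ i)"
    using integral_grad_0[OF fg, of q R i] supp by simp
  also have "\<dots> = (LINT x|lborel. f x * grad g x $ i) + (LINT x|lborel. grad f x $ i * g x)"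
    using i1 i2 by (simp add: grad_mult[OF f g] mult.commute)
  finally show ?thesis by simp
qed

lemma classical_weak_grad:
  fixes f :: "real ^ 'n \<Rightarrow> real"
  assumes f: "Ck (Suc 0) f" and S: "S \<in> sets lebesgue"
  shows "is_weak_grad S f (grad f)"
  unfolding is_weak_grad_def
proof (intro ballI allI)
  fix \<psi> i assume \<psi>: "\<psi> \<in> test_functions (interior S)"
  obtain R where R: "\<And>x. x \<notin> cball 0 R \<Longrightarrow> \<psi> x = 0" using test_functions_support[OF \<psi>] by blast
  have out: "\<psi> x = 0" "grad \<psi> x = 0" if "x \<notin> S" for x
    using test_functions_outside[OF \<psi>] that interior_subset by blast+
  have k: "Ck (Suc 0) \<psi>" by (rule test_functions_Ck[OF \<psi>])
  have "l2_inner S f (\<lambda>x. grad \<psi> x $ i) = (LINT x|lborel. f x * grad \<psi> x $ i)"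
    using l2_inner_lborel[OF S Ck_imp_continuous[OF f], of "\<lambda>x. grad \<psi> x $ i"] k out by simp
  also have "\<dots> = - (LINT x|lborel. grad f x $ i * \<psi> x)"
    by (rule integration_by_parts[OF f k R])
  also have "(LINT x|lborel. grad f x $ i * \<psi> x) = l2_inner S (\<lambda>x. grad f x $ i) \<psi>"
    using l2_inner_lborel[OF S _ Ck_imp_continuous[OF k], of "\<lambda>x. grad f x $ i"] f out by simp
  finally show "l2_inner S f (\<lambda>x. grad \<psi> x $ i) = - l2_inner S (\<lambda>x. grad f x $ i) \<psi>" .
qed

lemma test_function_weak_grad:
  assumes \<phi>: "\<phi> \<in> test_functions (interior S)" and S: "S \<in> sets lebesgue"
  shows "\<phi> \<in> H1 S" "weak_grad S \<phi> \<in> L2 S" "AE x in lebesgue. x \<in> interior S \<longrightarrow> weak_grad S \<phi> x = grad \<phi> x"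
proof -
  note g = test_functions_L2[OF \<phi> S] classical_weak_grad[OF test_functions_Ck[OF \<phi>] S]
  show "\<phi> \<in> H1 S" using g by (auto simp: H1_def)
  have w: "weak_grad S \<phi> \<in> L2 S \<and> is_weak_grad S \<phi> (weak_grad S \<phi>)"
    unfolding weak_grad_def by (rule someI[of _ "grad \<phi>"]) (use g in auto)
  then show "weak_grad S \<phi> \<in> L2 S" by simp
  show "AE x in lebesgue. x \<in> interior S \<longrightarrow> weak_grad S \<phi> x = grad \<phi> x"
    using weak_grad_unique[OF S] w g by blast
qed

text \<open>The approximating sequence is constantly \<open>\<phi>\<close>; the chosen weak gradient
  and the classical one differ only on a null set. This brings the traces of test functions into
  \<open>W_space\<close>.\<close>

lemma test_functions_H10:
  assumes \<phi>: "\<phi> \<in> test_functions \<Omega>" and \<Omega>: "open \<Omega>"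
  shows "\<phi> \<in> H10 \<Omega>"
proof -
  have S: "\<Omega> \<in> sets lebesgue" using \<Omega> by auto
  have \<phi>': "\<phi> \<in> test_functions (interior \<Omega>)" using \<phi> \<Omega> by (simp add: interior_open)
  note w = test_function_weak_grad[OF \<phi>' S]
  have "l2_norm \<Omega> (\<lambda>x. weak_grad \<Omega> \<phi> x - grad \<phi> x) = l2_norm \<Omega> (\<lambda>_. 0 :: real ^ 'a)"
  proof (rule l2_norm_cong_AE[OF _ _ S])
    show "(\<lambda>x. weak_grad \<Omega> \<phi> x - grad \<phi> x) \<in> L2 \<Omega>"
      by (rule L2_diff[OF w(2) test_functions_L2(2)[OF \<phi> S]])
    show "AE x in lebesgue. x \<in> \<Omega> \<longrightarrow> weak_grad \<Omega> \<phi> x - grad \<phi> x = 0"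
      using w(3) \<Omega> by (simp add: interior_open)
  qed (simp add: L2_def)
  then show ?thesis
    using w(1) \<phi>' unfolding H10_def by (auto simp: l2_norm_def l2_inner_def intro!: bexI[of _ \<phi>])
qed

definition divergence :: "(real ^ 'n \<Rightarrow> real ^ 'n) \<Rightarrow> real ^ 'n \<Rightarrow> real" where
  "divergence \<rho> x = (\<Sum>i\<in>UNIV. grad (\<lambda>y. \<rho> y $ i) x $ i)"

lemma divergence_mult:
  fixes \<rho> :: "real ^ 'n \<Rightarrow> real ^ 'n"
  assumes "\<And>i. Ck (Suc 0) (\<lambda>x. \<rho> x $ i)" "Ck (Suc 0) \<psi>"
  shows "divergence (\<lambda>x. \<psi> x *\<^sub>R \<rho> x) x = \<psi> x * divergence \<rho> x + \<rho> x \<bullet> grad \<psi> x"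
  by (simp add: divergence_def grad_mult[OF assms(2,1)] inner_vec_def sum.distrib sum_distrib_left)

lemma divergence_continuous:
  fixes \<rho> :: "real ^ 'n \<Rightarrow> real ^ 'n"
  assumes "\<And>i. Ck (Suc 0) (\<lambda>x. \<rho> x $ i)"
  shows "continuous_on UNIV (divergence \<rho>)"
  unfolding divergence_def using assms by (intro continuous_on_sum) simp

lemma Ck_vec_continuous:
  fixes \<rho> :: "real ^ 'n \<Rightarrow> real ^ 'n"
  assumes "\<And>i. Ck k (\<lambda>x. \<rho> x $ i)"
  shows "continuous_on UNIV \<rho>"
  using continuous_on_vec_lambda[of UNIV "\<lambda>i x. \<rho> x $ i"] Ck_imp_continuous[OF assms] by simp

lemma integral_divergence_0:
  fixes \<rho> :: "real ^ 'n \<Rightarrow> real ^ 'n"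
  assumes \<rho>: "\<And>i. Ck (Suc 0) (\<lambda>x. \<rho> x $ i)" and supp: "\<And>x. x \<notin> cball q R \<Longrightarrow> \<rho> x = 0"
  shows "(LINT x|lborel. divergence \<rho> x) = 0"
proof -
  have supp': "x \<notin> cball q R \<Longrightarrow> \<rho> x $ i = 0" for x i using supp by simp
  have "integrable lborel (\<lambda>x. grad (\<lambda>y. \<rho> y $ i) x $ i)" for i
  proof -
    have c: "continuous_on UNIV (\<lambda>x. grad (\<lambda>y. \<rho> y $ i) x $ i)" using \<rho>[of i] by simp
    have z: "grad (\<lambda>y. \<rho> y $ i) x $ i = 0" if "x \<notin> cball q R" for x
      using grad_eq_0_outside[of q R "\<lambda>y. \<rho> y $ i" x] supp' that by simp
    obtain C where "0 \<le> C" "\<And>x. \<bar>grad (\<lambda>y. \<rho> y $ i) x $ i\<bar> \<le> C"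
      using continuous_compact_support_bounded[of "\<lambda>x. grad (\<lambda>y. \<rho> y $ i) x $ i" q R] c z by blast
    then show ?thesis
      using integrable_bounded_support[OF borel_measurable_continuous_onI[OF c]] z by blast
  qed
  then have "(LINT x|lborel. divergence \<rho> x) = (\<Sum>i\<in>UNIV. LINT x|lborel. grad (\<lambda>y. \<rho> y $ i) x $ i)"
    unfolding divergence_def by (intro Bochner_Integration.integral_sum)
  also have "\<dots> = 0"
    using integral_grad_0[OF \<rho> supp'] by simp
  finally show ?thesis .
qed

text \<open>A test function and its gradient vanish off the interior, so agreement of
  \<open>\<tau>\<close> with the smooth field there is enough. The rest is that the divergence of
  \<open>\<psi> \<rho>\<close> integrates to zero.\<close>

lemma classical_weak_div:
  fixes \<rho> :: "real ^ 'n \<Rightarrow> real ^ 'n"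
  assumes \<rho>: "\<And>i. Ck (Suc 0) (\<lambda>x. \<rho> x $ i)" and S: "S \<in> sets lebesgue"
    and eq: "\<And>x. x \<in> interior S \<Longrightarrow> \<tau> x = \<rho> x"
  shows "is_weak_div S \<tau> (divergence \<rho>)"
  unfolding is_weak_div_def
proof (intro ballI)
  fix \<psi> assume \<psi>: "\<psi> \<in> test_functions (interior S)"
  have k: "Ck (Suc 0) \<psi>" by (rule test_functions_Ck[OF \<psi>])
  have out: "\<psi> x = 0" "grad \<psi> x = 0" if "x \<notin> interior S" for x
    using test_functions_outside[OF \<psi>] that by blast+
  then have out': "\<psi> x = 0" "grad \<psi> x = 0" if "x \<notin> S" for x
    using that interior_subset by blast+
  obtain R where R: "\<And>x. x \<notin> cball 0 R \<Longrightarrow> \<psi> x = 0" using test_functions_support[OF \<psi>] by blast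
  have R': "grad \<psi> x = 0" if "x \<notin> cball 0 R" for x using grad_eq_0_outside[of 0 R \<psi>] R that by blast
  note c = test_functions_continuous[OF \<psi>] divergence_continuous[OF \<rho>] Ck_vec_continuous[OF \<rho>]
  have int: "integrable lborel h" if "continuous_on UNIV h" "\<And>x. x \<notin> cball 0 R \<Longrightarrow> h x = 0" for h :: "real ^ 'n \<Rightarrow> real"
    using continuous_compact_support_bounded[OF that] integrable_bounded_support that
      borel_measurable_continuous_onI by metis
  have i1: "integrable lborel (\<lambda>x. \<rho> x \<bullet> grad \<psi> x)"
    using R' by (intro int continuous_on_inner c) auto
  have i2: "integrable lborel (\<lambda>x. \<psi> x * divergence \<rho> x)"
    using R by (intro int continuous_on_mult c) auto
  have "l2_inner S \<tau> (grad \<psi>) = l2_inner S \<rho> (grad \<psi>)"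
    unfolding l2_inner_set[OF S]
  proof (intro Bochner_Integration.integral_cong refl)
    show "indicator S x * (\<tau> x \<bullet> grad \<psi> x) = indicator S x * (\<rho> x \<bullet> grad \<psi> x)" for x
      using eq[of x] out(2)[of x] by (cases "x \<in> interior S") auto
  qed
  also have "\<dots> = (LINT x|lborel. \<rho> x \<bullet> grad \<psi> x)"
    by (rule l2_inner_lborel[OF S c(4,2)]) (simp add: out')
  also have "\<dots> = (LINT x|lborel. divergence (\<lambda>x. \<psi> x *\<^sub>R \<rho> x) x) - (LINT x|lborel. \<psi> x * divergence \<rho> x)"
    using i1 i2 by (simp add: divergence_mult[OF \<rho> k])
  also have "(LINT x|lborel. divergence (\<lambda>x. \<psi> x *\<^sub>R \<rho> x) x) = 0"
  proof (rule integral_divergence_0[of _ 0 R])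
    show "Ck (Suc 0) (\<lambda>x. (\<psi> x *\<^sub>R \<rho> x) $ i)" for i using Ck_mult[OF k \<rho>] by simp
  qed (simp add: R)
  also have "(LINT x|lborel. \<psi> x * divergence \<rho> x) = l2_inner S (divergence \<rho>) \<psi>"
    using l2_inner_lborel[OF S c(3,1)] out' by (simp add: mult.commute)
  finally show "l2_inner S \<tau> (grad \<psi>) = - l2_inner S (divergence \<rho>) \<psi>" by simp
qed

lemma weak_div_classical:
  fixes \<rho> :: "real ^ 'n \<Rightarrow> real ^ 'n"
  assumes \<rho>: "\<And>i. Ck (Suc 0) (\<lambda>x. \<rho> x $ i)" and S: "S \<in> sets lebesgue" "bounded S"
    and eq: "\<And>x. x \<in> interior S \<Longrightarrow> \<tau> x = \<rho> x" and \<tau>: "\<tau> \<in> Hdiv S"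
  shows "AE x in lebesgue. x \<in> interior S \<longrightarrow> weak_div S \<tau> x = divergence \<rho> x"
  using weak_div_unique[OF S(1) weak_div_works[OF \<tau>]
      L2_continuous_bounded[OF divergence_continuous[OF \<rho>] S] classical_weak_div[OF \<rho> S(1) eq]] .

lemma is_weak_div_diff:
  assumes S: "S \<in> sets lebesgue" and \<sigma>: "\<sigma> \<in> L2 S" "\<tau> \<in> L2 S" "g \<in> L2 S" "h \<in> L2 S"
    and "is_weak_div S \<sigma> g" "is_weak_div S \<tau> h"
  shows "is_weak_div S (\<lambda>x. \<sigma> x - \<tau> x) (\<lambda>x. g x - h x)"
  unfolding is_weak_div_def
proof (intro ballI)
  fix \<phi> assume \<phi>: "\<phi> \<in> test_functions (interior S)"
  then show "l2_inner S (\<lambda>x. \<sigma> x - \<tau> x) (grad \<phi>) = - l2_inner S (\<lambda>x. g x - h x) \<phi>"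
    using assms(6,7) unfolding is_weak_div_def
    by (simp add: l2_inner_diff \<sigma> test_functions_L2[OF \<phi> S])
qed

text \<open>As a choice, \<open>weak_div\<close> is linear only almost everywhere; uniqueness
  supplies this.\<close>

lemma Hdiv_diff:
  assumes S: "S \<in> sets lebesgue" and \<sigma>: "\<sigma> \<in> Hdiv S" and \<tau>: "\<tau> \<in> Hdiv S"
  shows "(\<lambda>x. \<sigma> x - \<tau> x) \<in> Hdiv S"
    "AE x in lebesgue. x \<in> interior S \<longrightarrow> weak_div S (\<lambda>x. \<sigma> x - \<tau> x) x = weak_div S \<sigma> x - weak_div S \<tau> x"
proof -
  have L: "\<sigma> \<in> L2 S" "\<tau> \<in> L2 S" using \<sigma> \<tau> by (auto simp: Hdiv_def)
  note d = L2_diff[OF weak_div_works(1)[OF \<sigma>] weak_div_works(1)[OF \<tau>]]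
    is_weak_div_diff[OF S L weak_div_works(1)[OF \<sigma>] weak_div_works(1)[OF \<tau>] weak_div_works(2)[OF \<sigma>] weak_div_works(2)[OF \<tau>]]
  show H: "(\<lambda>x. \<sigma> x - \<tau> x) \<in> Hdiv S" using L2_diff[OF L] d by (auto simp: Hdiv_def)
  show "AE x in lebesgue. x \<in> interior S \<longrightarrow> weak_div S (\<lambda>x. \<sigma> x - \<tau> x) x = weak_div S \<sigma> x - weak_div S \<tau> x"
    by (rule weak_div_unique[OF S weak_div_works[OF H] d])
qed

section \<open>Simplices and barycentric coordinates\<close>

locale full_simplex =
  fixes T :: "(real ^ 'n) set"
  assumes simplex: "int CARD('n) simplex T"
begin

lemma vertices_simplex:
  shows finite_vertices: "finite (vertices T)"
    and independent_vertices: "\<not> affine_dependent (vertices T)"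
    and card_vertices: "card (vertices T) = Suc CARD('n)"
    and hull_vertices: "T = convex hull (vertices T)"
proof -
  obtain C where C: "\<not> affine_dependent C" "int (card C) = int CARD('n) + 1" "T = convex hull C"
    using simplex by (auto simp: simplex_def)
  have "vertices T = C"
    unfolding vertices_def C(3) using extreme_point_of_convex_hull_affine_independent[OF C(1)] by auto
  with C show "finite (vertices T)" "\<not> affine_dependent (vertices T)"
    "card (vertices T) = Suc CARD('n)" "T = convex hull (vertices T)"
    using aff_independent_finite by auto
qed

text \<open>A full simplex has one vertex more than the dimension, so its affinely independent
  vertices span the space; independence gives uniqueness. Requiring zero weights off the vertices
  makes the weight unique as a total function.\<close>

lemma bary_ex1:
  "\<exists>!u. (\<forall>y. y \<notin> vertices T \<longrightarrow> u y = 0) \<and> sum u (vertices T) = 1 \<and> (\<Sum>y\<in>vertices T. u y *\<^sub>R y) = x"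
proof (rule ex_ex1I)
  have "affine hull (vertices T) = UNIV"
    using affine_independent_span_eq[OF independent_vertices] card_vertices by simp
  then have "x \<in> affine hull (vertices T)" by simp
  then obtain u where u: "sum u (vertices T) = 1" "(\<Sum>y\<in>vertices T. u y *\<^sub>R y) = x"
    by (auto simp: affine_hull_finite[OF finite_vertices])
  let ?u = "\<lambda>y. if y \<in> vertices T then u y else 0"
  have "sum ?u (vertices T) = 1" "(\<Sum>y\<in>vertices T. ?u y *\<^sub>R y) = x"
    using u by (auto cong: sum.cong)
  then show "\<exists>u. (\<forall>y. y \<notin> vertices T \<longrightarrow> u y = 0) \<and> sum u (vertices T) = 1 \<and> (\<Sum>y\<in>vertices T. u y *\<^sub>R y) = x"
    by (intro exI[of _ ?u]) auto
next
  fix u w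
  assume u: "(\<forall>y. y \<notin> vertices T \<longrightarrow> u y = 0) \<and> sum u (vertices T) = 1 \<and> (\<Sum>y\<in>vertices T. u y *\<^sub>R y) = x"
    and w: "(\<forall>y. y \<notin> vertices T \<longrightarrow> w y = 0) \<and> sum w (vertices T) = 1 \<and> (\<Sum>y\<in>vertices T. w y *\<^sub>R y) = x"
  have "sum (\<lambda>y. u y - w y) (vertices T) = 0" "(\<Sum>y\<in>vertices T. (u y - w y) *\<^sub>R y) = 0"
    using u w by (simp_all add: sum_subtractf scaleR_diff_left)
  then have "\<forall>y\<in>vertices T. u y - w y = 0"
    using independent_vertices unfolding affine_dependent_explicit_finite[OF finite_vertices] by blast
  then show "u = w" using u w by (intro ext) (metis eq_iff_diff_eq_0)
qed

lemma bary_props: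
  shows bary_outside: "y \<notin> vertices T \<Longrightarrow> bary T y x = 0"
    and bary_sum: "(\<Sum>y\<in>vertices T. bary T y x) = 1"
    and bary_combination: "(\<Sum>y\<in>vertices T. bary T y x *\<^sub>R y) = x"
  using theI'[OF bary_ex1[of x]] unfolding bary_def by auto

text \<open>The way to compute a coordinate: any weights with the two sum conditions will do, as
  their values off the vertices can be reset to zero.\<close>

lemma bary_unique:
  assumes "sum u (vertices T) = 1" "(\<Sum>y\<in>vertices T. u y *\<^sub>R y) = x" "z \<in> vertices T"
  shows "bary T z x = u z"
proof -
  let ?u = "\<lambda>y. if y \<in> vertices T then u y else 0"
  have "(\<forall>y. y \<notin> vertices T \<longrightarrow> ?u y = 0) \<and> sum ?u (vertices T) = 1 \<and> (\<Sum>y\<in>vertices T. ?u y *\<^sub>R y) = x"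
    using assms by (auto cong: sum.cong)
  then have "(THE u. (\<forall>y. y \<notin> vertices T \<longrightarrow> u y = 0) \<and> sum u (vertices T) = 1 \<and> (\<Sum>y\<in>vertices T. u y *\<^sub>R y) = x) = ?u"
    by (rule the1_equality[OF bary_ex1])
  then show ?thesis using assms(3) by (simp add: bary_def)
qed

definition bary_grad :: "real ^ 'n \<Rightarrow> real ^ 'n" where
  "bary_grad z = (\<chi> i. bary T z (axis i 1) - bary T z 0)"

text \<open>Coordinates are affine by uniqueness: the weights of \<open>x\<close>, plus those of
  \<open>y\<close>, minus those of 0 sum to one and represent \<open>x + y\<close>. Subtracting the
  value at 0 leaves a linear form, read off at the axes by \<open>bary_grad\<close>.\<close>

lemma bary_eq: "bary T z x = bary T z 0 + bary_grad z \<bullet> x"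
proof (cases "z \<in> vertices T")
  case True
  have add: "bary T z (x + y) - bary T z 0 = (bary T z x - bary T z 0) + (bary T z y - bary T z 0)" for x y
  proof -
    have "bary T z (x + y) = bary T z x + bary T z y - bary T z 0"
      by (rule bary_unique)
        (use True in \<open>simp_all add: sum.distrib sum_subtractf bary_sum bary_combination scaleR_add_left scaleR_diff_left\<close>)
    then show ?thesis by simp
  qed
  have scale: "bary T z (c *\<^sub>R x) - bary T z 0 = c * (bary T z x - bary T z 0)" for c x
  proof -
    have "bary T z (c *\<^sub>R x) = c * bary T z x + (1 - c) * bary T z 0"
      by (rule bary_unique)
        (use True in \<open>simp_all add: sum.distrib bary_sum bary_combination scaleR_add_left
          flip: sum_distrib_left scaleR_scaleR scaleR_sum_right\<close>)
    then show ?thesis by (simp add: algebra_simps)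
  qed
  have lin: "linear (\<lambda>x. bary T z x - bary T z 0)"
    by (rule linearI) (use add scale in auto)
  have "bary T z x - bary T z 0 = bary T z (\<Sum>i\<in>UNIV. (x $ i) *\<^sub>R axis i 1) - bary T z 0"
    using basis_expansion[of x] by (simp add: scalar_mult_eq_scaleR)
  also have "\<dots> = (\<Sum>i\<in>UNIV. x $ i * (bary T z (axis i 1) - bary T z 0))"
    using linear_sum[OF lin, of "\<lambda>i. (x $ i) *\<^sub>R axis i 1" UNIV] scale by simp
  also have "\<dots> = bary_grad z \<bullet> x" by (simp add: inner_vec_def bary_grad_def mult.commute)
  finally show ?thesis by simp
next
  case False
  then have "bary_grad z = 0" by (simp add: bary_grad_def bary_outside vec_eq_iff)
  then show ?thesis using False by (simp add: bary_outside)
qed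

lemma bary_diff: "bary T z x - bary T z y = bary_grad z \<bullet> (x - y)"
  using bary_eq[of z x] bary_eq[of z y] by (simp add: inner_diff_right)

lemma Ck_bary: "Ck k (bary T z)"
  using Ck_affine[of k "bary T z 0" "bary_grad z"] bary_eq by (metis (no_types, lifting) ext)

lemma continuous_bary: "continuous_on S (bary T z)"
  using Ck_imp_continuous[OF Ck_bary] continuous_on_subset by blast

lemma bary_vertex:
  assumes "w \<in> vertices T" "z \<in> vertices T"
  shows "bary T z w = (if z = w then 1 else 0)"
proof (rule bary_unique[OF _ _ assms(2)])
  show "(\<Sum>y\<in>vertices T. if y = w then 1 else 0) = (1 :: real)"
    using assms finite_vertices by simp
  have "(\<Sum>y\<in>vertices T. (if y = w then 1 else 0) *\<^sub>R y) = (\<Sum>y\<in>vertices T. if y = w then y else 0)"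
    by (intro sum.cong) auto
  then show "(\<Sum>y\<in>vertices T. (if y = w then 1 else 0) *\<^sub>R y) = w"
    using assms finite_vertices by simp
qed

lemma mem_hull_iff:
  assumes "C \<subseteq> vertices T"
  shows "x \<in> convex hull C \<longleftrightarrow> (\<forall>z\<in>vertices T. 0 \<le> bary T z x) \<and> (\<forall>z\<in>vertices T - C. bary T z x = 0)"
proof
  have fin: "finite C" using assms finite_vertices finite_subset by blast
  assume "x \<in> convex hull C"
  then obtain u where u: "\<forall>y\<in>C. 0 \<le> u y" "sum u C = 1" "(\<Sum>y\<in>C. u y *\<^sub>R y) = x"
    by (auto simp: convex_hull_finite[OF fin])
  let ?u = "\<lambda>y. if y \<in> C then u y else 0"
  have "bary T z x = ?u z" if "z \<in> vertices T" for z
  proof (rule bary_unique[OF _ _ that])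
    show "sum ?u (vertices T) = 1"
      using sum.mono_neutral_cong_right[OF finite_vertices assms, of ?u u] u by auto
    show "(\<Sum>y\<in>vertices T. ?u y *\<^sub>R y) = x"
      using sum.mono_neutral_cong_right[OF finite_vertices assms, of "\<lambda>y. ?u y *\<^sub>R y" "\<lambda>y. u y *\<^sub>R y"] u by auto
  qed
  then show "(\<forall>z\<in>vertices T. 0 \<le> bary T z x) \<and> (\<forall>z\<in>vertices T - C. bary T z x = 0)" using u by auto
next
  have fin: "finite C" using assms finite_vertices finite_subset by blast
  assume b: "(\<forall>z\<in>vertices T. 0 \<le> bary T z x) \<and> (\<forall>z\<in>vertices T - C. bary T z x = 0)"
  have "(\<Sum>y\<in>C. bary T y x) = 1"
    using sum.mono_neutral_right[OF finite_vertices assms, of "\<lambda>y. bary T y x"] b bary_sum by auto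
  moreover have "(\<Sum>y\<in>C. bary T y x *\<^sub>R y) = x"
    using sum.mono_neutral_right[OF finite_vertices assms, of "\<lambda>y. bary T y x *\<^sub>R y"] b bary_combination[of x] by auto
  ultimately show "x \<in> convex hull C"
    using b assms by (auto simp: convex_hull_finite[OF fin] intro!: exI[of _ "\<lambda>y. bary T y x"])
qed

lemma mem_simplex_iff: "x \<in> T \<longleftrightarrow> (\<forall>z\<in>vertices T. 0 \<le> bary T z x)"
  using mem_hull_iff[of "vertices T" x] hull_vertices by simp

lemma bary_le_1: "x \<in> T \<Longrightarrow> bary T z x \<le> 1"
proof (cases "z \<in> vertices T")
  case True
  assume "x \<in> T"
  then have "bary T z x \<le> (\<Sum>y\<in>vertices T. bary T y x)"
    using True mem_simplex_iff finite_vertices by (intro member_le_sum) auto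
  then show ?thesis by (simp add: bary_sum)
qed (simp add: bary_outside)

lemma bary_nonneg: "x \<in> T \<Longrightarrow> 0 \<le> bary T z x"
  using mem_simplex_iff bary_outside by (cases "z \<in> vertices T") auto

lemma mem_interior_bary:
  assumes "\<And>z. z \<in> vertices T \<Longrightarrow> 0 < bary T z x"
  shows "x \<in> interior T"
proof (rule interiorI[of "\<Inter>z\<in>vertices T. {x. 0 < bary T z x}"])
  show "open (\<Inter>z\<in>vertices T. {x. 0 < bary T z x})"
    using finite_vertices by (intro open_INT ballI open_Collect_less continuous_on_const continuous_bary)
  show "x \<in> (\<Inter>z\<in>vertices T. {x. 0 < bary T z x})" using assms by simp
  show "(\<Inter>z\<in>vertices T. {x. 0 < bary T z x}) \<subseteq> T"
  proof
    fix y assume "y \<in> (\<Inter>z\<in>vertices T. {x. 0 < bary T z x})"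
    then show "y \<in> T" unfolding mem_simplex_iff by (simp add: less_imp_le)
  qed
qed

lemma compact_T: "compact T" and convex_T: "convex T"
  using compact_simplex[OF simplex] convex_simplex[OF simplex] by auto

lemma interior_nonempty: "interior T \<noteq> {}"
proof -
  let ?x = "\<Sum>y\<in>vertices T. (1 / real (Suc CARD('n))) *\<^sub>R y"
  have "bary T z ?x = 1 / real (Suc CARD('n))" if "z \<in> vertices T" for z
    by (rule bary_unique[OF _ refl that]) (simp add: card_vertices)
  then have "?x \<in> interior T" by (intro mem_interior_bary) simp
  then show ?thesis by blast
qed

lemma closure_interior_T: "closure (interior T) = T"
  using convex_closure_interior[OF convex_T interior_nonempty] compact_T by (simp add: compact_imp_closed)

text \<open>Makes the limit in \<open>trace_from\<close> unique also at boundary points of the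
  simplex.\<close>

lemma at_within_interior_nontrivial: "x \<in> T \<Longrightarrow> at x within interior T \<noteq> bot"
proof -
  assume x: "x \<in> T"
  have "x islimpt interior T"
  proof (cases "x \<in> interior T")
    case True
    then show ?thesis using interior_limit_point[of x "interior T"] by simp
  next
    case False
    then show ?thesis using x closure_interior_T by (auto simp: closure_def)
  qed
  then show ?thesis by (simp add: trivial_limit_within)
qed

lemma T_sets: "T \<in> sets lebesgue" and T_lmeasurable: "T \<in> lmeasurable"
  using compact_T lmeasurable_compact by auto

lemma negligible_boundary: "negligible (T - interior T)"
  using negligible_convex_frontier[OF convex_T] compact_T by (simp add: frontier_def compact_imp_closed)

lemma measure_pos: "0 < measure lebesgue T"
proof -
  have "\<not> negligible T"
    using interior_nonempty open_not_negligible[OF open_interior] negligible_subset interior_subset by metis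
  then show ?thesis using T_lmeasurable negligible_iff_measure measure_nonneg by (metis less_eq_real_def)
qed

lemma dist_le_diameter: "x \<in> T \<Longrightarrow> y \<in> T \<Longrightarrow> dist x y \<le> diameter T"
  using diameter_bounded_bound compact_T compact_imp_bounded by blast

lemma vertices_subset: "z \<in> vertices T \<Longrightarrow> z \<in> T"
  using hull_vertices hull_inc by metis

lemma ex_other_vertex:
  obtains w where "w \<in> vertices T" "w \<noteq> z"
proof -
  have "vertices T - {z} \<noteq> {}"
    using card_vertices finite_vertices zero_less_card_finite[where 'a = 'n]
    by (metis card_Suc_Diff1 card_eq_0_iff Diff_empty Diff_insert0 nat.distinct(1) nat.inject neq0_conv finite_Diff)
  then show ?thesis using that by blast
qed

text \<open>Along an edge from \<open>z\<close> the coordinate falls from one to zero over a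
  distance of at most the diameter.\<close>

lemma bary_grad_diameter:
  assumes "z \<in> vertices T" shows "1 \<le> norm (bary_grad z) * diameter T"
proof -
  obtain w where w: "w \<in> vertices T" "w \<noteq> z" using ex_other_vertex .
  have "1 = bary T z z - bary T z w" using assms w by (simp add: bary_vertex)
  also have "\<dots> = bary_grad z \<bullet> (z - w)" by (rule bary_diff)
  also have "\<dots> \<le> norm (bary_grad z) * norm (z - w)" by (rule norm_cauchy_schwarz)
  also have "\<dots> \<le> norm (bary_grad z) * diameter T"
    using dist_le_diameter[OF vertices_subset[OF assms] vertices_subset[OF w(1)]]
    by (intro mult_left_mono) (auto simp: dist_norm)
  finally show ?thesis .
qed

lemma diameter_pos: "0 < diameter T"
proof -
  obtain z where "z \<in> vertices T" using ex_other_vertex by metis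
  from bary_grad_diameter[OF this] have "0 < norm (bary_grad z) * diameter T" by linarith
  then show ?thesis by (simp add: zero_less_mult_iff)
qed

lemma bary_grad_nonzero: "z \<in> vertices T \<Longrightarrow> bary_grad z \<noteq> 0"
  using bary_grad_diameter by force

text \<open>A simplex lies in a slab of width equal to its height over a facet, which bounds the height
  from below in terms of the volume.\<close>

lemma bary_grad_le:
  assumes "diameter T ^ CARD('n) / measure lebesgue T \<le> \<kappa>" "z \<in> vertices T"
  shows "norm (bary_grad z) * diameter T \<le> 2 * 6 ^ CARD('n) * unit_ball_vol CARD('n) * \<kappa>"
proof -
  let ?g = "bary_grad z" and ?h = "diameter T"
  let ?n = "(1 / norm ?g) *\<^sub>R ?g"
  obtain w where w: "w \<in> vertices T" "w \<noteq> z" using ex_other_vertex .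
  have g: "0 < norm ?g" using bary_grad_nonzero[OF assms(2)] by simp
  have d: "2 / norm ?g \<le> 2 * ?h"
    using bary_grad_diameter[OF assms(2)] g by (simp add: field_simps)
  \<comment> \<open>The vertex \<open>w\<close> lies on the opposite facet, and the distance of
    \<open>x\<close> to its hyperplane is the coordinate divided by \<open>norm ?g\<close>, hence at
    most \<open>1 / norm ?g\<close>. Twice that value gives the strict inequality and is still at
    most the radius \<open>2 * ?h\<close>.\<close>
  have sub: "T \<subseteq> {x \<in> cball w (2 * ?h). \<bar>(x - w) \<bullet> ?n\<bar> < 2 / norm ?g}"
  proof
    fix x assume x: "x \<in> T"
    have "dist w x \<le> 2 * ?h" using dist_le_diameter[OF vertices_subset[OF w(1)] x] diameter_pos by simp
    moreover have "(x - w) \<bullet> ?g = bary T z x"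
      using bary_diff[of z x w] w assms(2) by (simp add: bary_vertex inner_commute)
    then have "\<bar>(x - w) \<bullet> ?g\<bar> < 2"
      using bary_nonneg[OF x, of z] bary_le_1[OF x, of z] by simp
    ultimately show "x \<in> {x \<in> cball w (2 * ?h). \<bar>(x - w) \<bullet> ?n\<bar> < 2 / norm ?g}"
      using g by (simp add: divide_strict_right_mono)
  qed
  have "measure lebesgue T \<le> measure lebesgue {x \<in> cball w (2 * ?h). \<bar>(x - w) \<bullet> ?n\<bar> < 2 / norm ?g}"
  proof (rule measure_mono_fmeasurable[OF sub T_sets])
    have "open {x. \<bar>(x - w) \<bullet> ?n\<bar> < 2 / norm ?g}"
      by (intro open_Collect_less continuous_intros)
    then have "cball w (2 * ?h) \<inter> {x. \<bar>(x - w) \<bullet> ?n\<bar> < 2 / norm ?g} \<in> lmeasurable"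
      by (intro fmeasurable_Int_fmeasurable) auto
    moreover have "cball w (2 * ?h) \<inter> {x. \<bar>(x - w) \<bullet> ?n\<bar> < 2 / norm ?g}
      = {x \<in> cball w (2 * ?h). \<bar>(x - w) \<bullet> ?n\<bar> < 2 / norm ?g}" by auto
    ultimately show "{x \<in> cball w (2 * ?h). \<bar>(x - w) \<bullet> ?n\<bar> < 2 / norm ?g} \<in> lmeasurable"
      by (simp only:)
  qed
  also have "\<dots> \<le> 2 * 3 ^ CARD('n) * unit_ball_vol CARD('n) * (2 * ?h) ^ (CARD('n) - 1) * (2 / norm ?g)"
    using g d by (intro slab_measure_le) auto
  finally have "measure lebesgue T * (norm ?g * ?h)
      \<le> 2 * 3 ^ CARD('n) * unit_ball_vol CARD('n) * (2 * ?h) ^ (CARD('n) - 1) * (2 / norm ?g) * (norm ?g * ?h)"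
    using g diameter_pos by (intro mult_right_mono) auto
  also have "\<dots> = 2 * 6 ^ CARD('n) * unit_ball_vol CARD('n) * ?h ^ CARD('n)"
  proof -
    have "(6 :: real) ^ CARD('n) = 3 ^ CARD('n) * (2 * 2 ^ (CARD('n) - 1))"
      using power_eq_if[of "2 :: real" "CARD('n)"] power_mult_distrib[of "3 :: real" 2 "CARD('n)"] by simp
    moreover have "?h ^ CARD('n) = ?h * ?h ^ (CARD('n) - 1)"
      using power_eq_if[of ?h "CARD('n)"] by simp
    ultimately show ?thesis using g by (simp add: power_mult_distrib)
  qed
  also have "\<dots> \<le> 2 * 6 ^ CARD('n) * unit_ball_vol CARD('n) * (\<kappa> * measure lebesgue T)"
    using assms(1) measure_pos by (intro mult_left_mono) (auto simp: field_simps)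
  finally show ?thesis using measure_pos by (simp add: field_simps)
qed

lemma facet_iff: "F facet_of T \<longleftrightarrow> (\<exists>z\<in>vertices T. F = convex hull (vertices T - {z}))"
proof -
  have "convex hull (vertices T - {z}) \<noteq> {}" for z
    using ex_other_vertex[of z] by auto
  then show ?thesis
    using facet_of_convex_hull_affine_independent[OF independent_vertices] hull_vertices by auto
qed

end

section \<open>A facet with its opposite vertex and outer normal\<close>

locale simplex_facet = full_simplex T for T :: "(real ^ 'n) set" +
  fixes F :: "(real ^ 'n) set"
  assumes facet: "F facet_of T"
begin

abbreviation "apex \<equiv> opposite_vertex T F"
abbreviation "n \<equiv> outer_normal T F"

lemma apex: "apex \<in> vertices T" and F_hull: "F = convex hull (vertices T - {apex})"
proof -
  obtain z where z: "z \<in> vertices T" "F = convex hull (vertices T - {z})" using facet facet_iff by blast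
  have "w \<in> F \<longleftrightarrow> w \<noteq> z" if "w \<in> vertices T" for w
    using mem_hull_iff[of "vertices T - {z}" w] z that by (auto simp: bary_vertex hull_inc)
  then have "apex = z" unfolding opposite_vertex_def using z by (intro the_equality) auto
  then show "apex \<in> vertices T" "F = convex hull (vertices T - {apex})" using z by auto
qed

lemma mem_F_iff: "x \<in> F \<longleftrightarrow> x \<in> T \<and> bary T apex x = 0"
proof -
  have "vertices T - (vertices T - {apex}) = {apex}" using apex by auto
  then show ?thesis using mem_hull_iff[of "vertices T - {apex}" x] F_hull mem_simplex_iff by auto
qed

lemma F_subset: "F \<subseteq> T" using mem_F_iff by blast

lemma vertices_F: "vertices F = vertices T - {apex}"
proof -
  have "\<not> affine_dependent (vertices T - {apex})"
    by (rule affine_independent_Diff[OF independent_vertices])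
  from extreme_point_of_convex_hull_affine_independent[OF this] show ?thesis
    unfolding vertices_def[of F] by (subst F_hull) auto
qed

lemma finite_vertices_F: "finite (vertices F)" and card_vertices_F: "card (vertices F) = CARD('n)"
  using vertices_F finite_vertices card_vertices apex by auto

lemma sum_vertices: "(\<Sum>y\<in>vertices T. f y) = f apex + (\<Sum>y\<in>vertices F. f y :: 'b::comm_monoid_add)"
  using vertices_F apex finite_vertices by (simp add: sum.remove)

lemma facet_point:
  assumes "\<And>y. y \<in> vertices F \<Longrightarrow> 0 \<le> u y" "sum u (vertices F) = 1"
  defines "x \<equiv> \<Sum>y\<in>vertices F. u y *\<^sub>R y"
  shows "x \<in> F" "\<And>y. y \<in> vertices F \<Longrightarrow> bary T y x = u y"
proof -
  let ?u = "\<lambda>y. if y = apex then 0 else u y"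
  have n: "apex \<notin> vertices F" using vertices_F by auto
  have "sum ?u (vertices F) = sum u (vertices F)" "(\<Sum>y\<in>vertices F. ?u y *\<^sub>R y) = (\<Sum>y\<in>vertices F. u y *\<^sub>R y)"
    using n by (auto intro!: sum.cong)
  then have "sum ?u (vertices T) = 1" "(\<Sum>y\<in>vertices T. ?u y *\<^sub>R y) = x"
    using assms(2) by (auto simp: sum_vertices x_def)
  then have b: "bary T y x = ?u y" if "y \<in> vertices T" for y
    using that bary_unique by blast
  then show "bary T y x = u y" if "y \<in> vertices F" for y
    using b[of y] that n vertices_F by auto
  show "x \<in> F"
    unfolding mem_F_iff mem_simplex_iff using b apex assms(1) vertices_F by auto
qed

lemma ex_facet_center:
  obtains p where "p \<in> F" "\<And>y. y \<in> vertices F \<Longrightarrow> 0 < bary T y p"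
  using facet_point[of "\<lambda>_. 1 / real CARD('n)"] card_vertices_F by force

text \<open>Around a relative interior point of the facet, small moves in any direction keep the
  coordinates at the facet vertices positive; only the sign of the apex coordinate is then left to
  decide membership in \<open>T\<close>.\<close>

lemma bary_perturb:
  assumes "\<And>y. y \<in> vertices F \<Longrightarrow> 0 < bary T y p"
  obtains t where "0 < t" "\<And>s y. \<bar>s\<bar> \<le> t \<Longrightarrow> y \<in> vertices F \<Longrightarrow> 0 < bary T y (p + s *\<^sub>R w)"
proof -
  have c: "isCont (\<lambda>s. bary T y (p + s *\<^sub>R w)) 0" for y
    unfolding bary_eq[of y "p + _"] by (intro continuous_intros)
  have "eventually (\<lambda>s. 0 < bary T y (p + s *\<^sub>R w)) (nhds 0)" if "y \<in> vertices F" for y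
  proof -
    have "((\<lambda>s. bary T y (p + s *\<^sub>R w)) \<longlongrightarrow> bary T y p) (nhds 0)"
      using c[of y] tendsto_at_iff_tendsto_nhds[of "\<lambda>s. bary T y (p + s *\<^sub>R w)" 0] by (simp add: isCont_def)
    then show ?thesis using assms[OF that] by (rule order_tendstoD(1))
  qed
  then have "eventually (\<lambda>s. \<forall>y\<in>vertices F. 0 < bary T y (p + s *\<^sub>R w)) (nhds 0)"
    using finite_vertices_F by (simp add: eventually_ball_finite)
  then obtain d where d: "d > 0" "\<And>s. dist s 0 < d \<Longrightarrow> \<forall>y\<in>vertices F. 0 < bary T y (p + s *\<^sub>R w)"
    unfolding eventually_nhds_metric by blast
  show ?thesis by (rule that[of "d / 2"]) (use d in auto)
qed

text \<open>Identifies the normal that \<open>outer_normal\<close> describes by inequalities: it is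
  the normalised descent direction of the apex coordinate. The work is in the uniqueness part, which
  the definite description requires.\<close>

lemma normal_eq: "n = - (1 / norm (bary_grad apex)) *\<^sub>R bary_grad apex"
proof -
  let ?g = "bary_grad apex"
  let ?n = "- (1 / norm ?g) *\<^sub>R ?g"
  have g: "0 < norm ?g" using bary_grad_nonzero[OF apex] by simp
  have nn: "norm ?n = 1" using g by simp
  have gn: "?g = - norm ?g *\<^sub>R ?n" using g by simp
  have ip: "?n \<bullet> (y - x) = - (bary T apex y - bary T apex x) / norm ?g" for x y
    using bary_diff[of apex y x] by simp
  show ?thesis
    unfolding outer_normal_def
  proof (rule the_equality, intro conjI ballI)
    show "norm ?n = 1" by (rule nn)
    show "?n \<bullet> (y - x) \<le> 0" if "x \<in> F" "y \<in> T" for x y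
      unfolding ip using that g bary_nonneg[of y apex] mem_F_iff[of x] by simp
  next
    fix m assume m: "norm m = 1 \<and> (\<forall>x\<in>F. \<forall>y\<in>T. m \<bullet> (y - x) \<le> 0)"
    obtain p where p: "p \<in> F" "\<And>y. y \<in> vertices F \<Longrightarrow> 0 < bary T y p" using ex_facet_center by blast
    \<comment> \<open>The tangential part of a competitor \<open>m\<close>. From a relative interior
      point a short step along \<open>w\<close> stays in \<open>T\<close>, so
      \<open>m \<bullet> w\<close>, which equals \<open>w \<bullet> w\<close>, cannot be
      positive.\<close>
    define w where "w = m - (m \<bullet> ?n) *\<^sub>R ?n"
    have wn: "w \<bullet> ?n = 0"
    proof -
      define k where "k = ?n"
      have "k \<bullet> k = 1" using nn unfolding k_def[symmetric] norm_eq_1 .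
      then have "(m - (m \<bullet> k) *\<^sub>R k) \<bullet> k = 0" by (simp add: inner_diff_left)
      then show ?thesis unfolding w_def k_def .
    qed
    obtain t where t: "0 < t" "\<And>s y. \<bar>s\<bar> \<le> t \<Longrightarrow> y \<in> vertices F \<Longrightarrow> 0 < bary T y (p + s *\<^sub>R w)"
      using bary_perturb[OF p(2)] by blast
    have "bary T apex (p + t *\<^sub>R w) - bary T apex p = 0"
      unfolding bary_diff using wn g by (simp add: inner_commute)
    then have "bary T apex (p + t *\<^sub>R w) = 0" using p(1) mem_F_iff by simp
    then have "0 \<le> bary T y (p + t *\<^sub>R w)" if "y \<in> vertices T" for y
      using t(2)[of t y] t(1) that vertices_F by (cases "y = apex") auto
    then have "p + t *\<^sub>R w \<in> T" unfolding mem_simplex_iff by blast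
    then have "m \<bullet> (p + t *\<^sub>R w - p) \<le> 0" using m p(1) by blast
    then have "m \<bullet> (t *\<^sub>R w) \<le> 0" by simp
    then have "m \<bullet> w \<le> 0" using t(1) by (simp add: mult_le_0_iff)
    moreover have "m \<bullet> w = w \<bullet> w"
    proof -
      have "m \<bullet> w = (w + (m \<bullet> ?n) *\<^sub>R ?n) \<bullet> w" unfolding w_def by simp
      also have "\<dots> = w \<bullet> w + (m \<bullet> ?n) * (w \<bullet> ?n)"
        by (simp only: inner_add_left inner_scaleR_left[of "m \<bullet> ?n"] inner_commute[of ?n w])
      finally show ?thesis by (simp only: wn mult_zero_right add_0_right)
    qed
    ultimately have "w = 0" by (metis inner_eq_zero_iff inner_ge_zero order_antisym)
    then have mn: "m = (m \<bullet> ?n) *\<^sub>R ?n" by (simp add: w_def)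
    then have "\<bar>m \<bullet> ?n\<bar> = 1" using m nn by (metis mult.right_neutral norm_scaleR)
    \<comment> \<open>The inward orientation is ruled out by the apex, the vertex of
      \<open>T\<close> off the facet.\<close>
    moreover have "m \<bullet> ?n \<noteq> -1"
    proof
      assume minus: "m \<bullet> ?n = -1"
      have "m = - ?n" using mn unfolding minus scaleR_minus1_left .
      then have "m \<bullet> (apex - p) = 1 / norm ?g"
        using ip[of apex p] p(1) mem_F_iff apex by (simp add: bary_vertex)
      moreover have "m \<bullet> (apex - p) \<le> 0" using m p(1) vertices_subset[OF apex] by blast
      ultimately show False using g by simp
    qed
    ultimately have one: "m \<bullet> ?n = 1" by linarith
    show "m = ?n" using mn unfolding one scaleR_one .
  qed
qed

lemma norm_n [simp]: "norm n = 1"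
  using bary_grad_nonzero[OF apex] by (simp add: normal_eq)

text \<open>Up to a negative factor the apex coordinate is the signed distance to the hyperplane of
  the facet; the half-space arguments near a facet rest on this.\<close>

lemma bary_apex: "x \<in> F \<Longrightarrow> bary T apex y = - norm (bary_grad apex) * ((y - x) \<bullet> n)"
  using bary_diff[of apex y x] mem_F_iff[of x] bary_grad_nonzero[OF apex]
  by (simp add: normal_eq inner_commute)

lemma facet_bubble_eq: "facet_bubble T F x = (\<Prod>y\<in>vertices F. bary T y x)"
  by (simp add: facet_bubble_def vertices_F)

end

section \<open>Normal traces on a facet\<close>

context full_simplex
begin

lemma Ck_facet_bubble: "Ck k (facet_bubble T F)"
  unfolding facet_bubble_def[abs_def] by (intro Ck_prod Ck_bary)

lemma Ck_edge_bubble: "Ck k (edge_bubble T E)"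
  unfolding edge_bubble_def[abs_def] by (intro Ck_prod Ck_bary)

lemma Ck_facet_bubble_eps: "Ck k (facet_bubble_eps \<epsilon> T F)"
  unfolding facet_bubble_eps_def[abs_def]
  by (intro Ck_mult[OF Ck_exp Ck_facet_bubble] Ck_mult[OF Ck_const Ck_bary])

text \<open>The shape functions are given by formulas that are smooth on the whole space, so a
  discrete field has a smooth extension across its element: its weak divergence is classical and its
  one-sided traces are values of the extension.\<close>

lemma Sigma_h_local_Ck:
  assumes "\<rho> \<in> Sigma_h_local \<epsilon> T z" shows "Ck k (\<lambda>x. \<rho> x $ i)"
proof -
  obtain \<alpha> \<beta> a c where \<rho>: "\<rho> = (\<lambda>x. (a + c *\<^sub>R x)
     + (\<Sum>F | F facet_of T. (\<alpha> F * (if \<epsilon> < diameter T then facet_bubble_eps \<epsilon> T F x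
          else facet_bubble T F x)) *\<^sub>R outer_normal T F)
     + (\<Sum>E | E edge_of T \<and> z \<in> E. (\<beta> E * edge_bubble T E x) *\<^sub>R edge_tangent E))"
    using assms unfolding Sigma_h_local_def RT0_def by blast
  have "Ck k (\<lambda>x. (a $ i + (c *\<^sub>R axis i 1) \<bullet> x)
     + (\<Sum>F | F facet_of T. (\<alpha> F * (if \<epsilon> < diameter T then facet_bubble_eps \<epsilon> T F x
          else facet_bubble T F x)) * outer_normal T F $ i)
     + (\<Sum>E | E edge_of T \<and> z \<in> E. (\<beta> E * edge_bubble T E x) * edge_tangent E $ i))"
    by (intro Ck_add[OF Ck_add[OF Ck_affine]] Ck_sum Ck_mult[OF Ck_mult[OF Ck_const] Ck_const])
      (cases "\<epsilon> < diameter T"; simp add: Ck_facet_bubble Ck_facet_bubble_eps Ck_edge_bubble del: Ck.simps)+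
  then show ?thesis by (simp add: \<rho> inner_axis' del: Ck.simps)
qed

lemma edge_of_simplex:
  assumes "E edge_of T"
  obtains a b where "a \<in> vertices T" "b \<in> vertices T" "a \<noteq> b" "vertices E = {a, b}" "E = closed_segment a b"
proof -
  have "E face_of convex hull (vertices T)" using assms hull_vertices by (simp add: edge_of_def)
  then obtain c where c: "c \<subseteq> vertices T" "E = convex hull c"
    using face_of_convex_hull_affine_independent[OF independent_vertices] by auto
  have ind: "\<not> affine_dependent c" using affine_independent_subset[OF independent_vertices c(1)] .
  have "aff_dim E = 1" using assms by (simp add: edge_of_def)
  then have "card c = 2" using aff_dim_affine_independent[OF ind] c(2) by (simp add: aff_dim_convex_hull)
  then obtain a b where ab: "c = {a, b}" "a \<noteq> b" by (auto simp: card_2_iff)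
  have "vertices E = c"
    unfolding vertices_def c(2) using extreme_point_of_convex_hull_affine_independent[OF ind] by auto
  then show ?thesis by (intro that[of a b]) (use c ab in \<open>auto simp: segment_convex_hull\<close>)
qed

end

text \<open>\<open>edge_tangent\<close> is chosen without an orientation. Being a multiple of a
  difference of two points of the edge is enough to see that it is tangential to any facet
  containing the edge.\<close>

lemma edge_tangent_parallel:
  assumes "E = closed_segment a b" "a \<noteq> b"
  obtains x y s where "x \<in> E" "y \<in> E" "edge_tangent E = s *\<^sub>R (y - x)"
proof -
  let ?P = "\<lambda>t. norm t = 1 \<and> (\<exists>a b s. a \<noteq> b \<and> E = closed_segment a b \<and> b - a = s *\<^sub>R t)"
  have "?P ((1 / norm (b - a)) *\<^sub>R (b - a))"
  proof (intro conjI exI)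
    show "b - a = norm (b - a) *\<^sub>R ((1 / norm (b - a)) *\<^sub>R (b - a))" using assms by simp
  qed (use assms in auto)
  then have "?P (edge_tangent E)" unfolding edge_tangent_def by (rule someI)
  then obtain x y s where xy: "x \<noteq> y" "E = closed_segment x y" "y - x = s *\<^sub>R edge_tangent E" by blast
  then have "s \<noteq> 0" by auto
  then have "edge_tangent E = (1 / s) *\<^sub>R (y - x)" using xy(3) by simp
  then show ?thesis using that xy(2) by auto
qed

context simplex_facet
begin

lemma F_normal: "x \<in> F \<Longrightarrow> y \<in> F \<Longrightarrow> (y - x) \<bullet> n = 0"
  using bary_apex[of x y] mem_F_iff[of y] bary_grad_nonzero[OF apex] by auto

lemma bubble_zero_on_F:
  assumes "apex \<in> C" "C \<subseteq> vertices T" "x \<in> F"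
  shows "(\<Prod>y\<in>C. bary T y x) = 0"
  using assms mem_F_iff finite_vertices finite_subset by (intro prod_zero) blast+

text \<open>On \<open>F\<close> the normal component of the lowest-order Raviart-Thomas part is constant, the
  exponential factor of the bubble of \<open>F\<close> is 1 and all other bubbles vanish or are tangential.\<close>

lemma Sigma_h_local_normal_trace:
  assumes "\<rho> \<in> Sigma_h_local \<epsilon> T z"
  obtains a b where "\<And>x. x \<in> F \<Longrightarrow> \<rho> x \<bullet> n = a + b * facet_bubble T F x"
proof -
  obtain \<alpha> \<beta> a c where \<rho>: "\<rho> = (\<lambda>x. (a + c *\<^sub>R x)
     + (\<Sum>G | G facet_of T. (\<alpha> G * (if \<epsilon> < diameter T then facet_bubble_eps \<epsilon> T G x
          else facet_bubble T G x)) *\<^sub>R outer_normal T G)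
     + (\<Sum>E | E edge_of T \<and> z \<in> E. (\<beta> E * edge_bubble T E x) *\<^sub>R edge_tangent E))"
    using assms unfolding Sigma_h_local_def RT0_def by blast
  obtain p where p: "p \<in> F" using ex_facet_center by blast
  have fin: "finite {G. G facet_of T}"
    using finite_polytope_facets simplex_imp_polytope[OF simplex] by blast
  show ?thesis
  proof (rule that[of "a \<bullet> n + c * (p \<bullet> n)" "\<alpha> F"])
    fix x assume x: "x \<in> F"
    have facets: "(\<Sum>G | G facet_of T. (\<alpha> G * (if \<epsilon> < diameter T then facet_bubble_eps \<epsilon> T G x
          else facet_bubble T G x)) * (outer_normal T G \<bullet> n)) = \<alpha> F * facet_bubble T F x"
    proof -
      have z: "facet_bubble T G x = 0" if G: "G facet_of T" "G \<noteq> F" for G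
      proof -
        interpret G: simplex_facet T G by unfold_locales (rule G(1))
        \<comment> \<open>Another facet has another opposite vertex, so its bubble contains the
          coordinate of \<open>apex\<close> as a factor, and this vanishes on
          \<open>F\<close>.\<close>
        have "apex \<noteq> opposite_vertex T G" using F_hull G.F_hull G(2) by auto
        then show ?thesis
          unfolding facet_bubble_def using x apex by (intro bubble_zero_on_F) auto
      qed
      have "(\<Sum>G | G facet_of T. (\<alpha> G * (if \<epsilon> < diameter T then facet_bubble_eps \<epsilon> T G x
          else facet_bubble T G x)) * (outer_normal T G \<bullet> n))
        = (\<Sum>G\<in>{F}. (\<alpha> G * (if \<epsilon> < diameter T then facet_bubble_eps \<epsilon> T G x
          else facet_bubble T G x)) * (outer_normal T G \<bullet> n))"
        by (rule sum.mono_neutral_right[OF fin]) (use facet z in \<open>auto simp: facet_bubble_eps_def\<close>)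
      also have "\<dots> = \<alpha> F * facet_bubble T F x"
        using x mem_F_iff[of x] norm_n[unfolded norm_eq_1] by (simp add: facet_bubble_eps_def)
      finally show ?thesis .
    qed
    have edges: "edge_bubble T E x * (edge_tangent E \<bullet> n) = 0" if E: "E edge_of T" for E
    proof -
      obtain u v where uv: "u \<in> vertices T" "v \<in> vertices T" "u \<noteq> v" "vertices E = {u, v}" "E = closed_segment u v"
        using edge_of_simplex[OF E] .
      show ?thesis
      proof (cases "apex \<in> {u, v}")
        case True
        then show ?thesis
          unfolding edge_bubble_def uv(4) using bubble_zero_on_F[of "{u, v}" x] uv x by simp
      next
        case False
        \<comment> \<open>An edge that avoids the apex lies in \<open>F\<close>, so its tangent is
          orthogonal to the normal.\<close>
        then have "{u, v} \<subseteq> vertices T - {apex}" using uv(1,2) by auto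
        then have "{u, v} \<subseteq> F" using hull_subset[of "vertices T - {apex}" convex] F_hull by blast
        moreover have "convex F" using facet facet_of_imp_face_of face_of_imp_convex convex_T by blast
        ultimately have "E \<subseteq> F" unfolding uv(5) using closed_segment_subset by blast
        obtain y z s where "y \<in> E" "z \<in> E" "edge_tangent E = s *\<^sub>R (z - y)"
          using edge_tangent_parallel[OF uv(5,3)] .
        then have "edge_tangent E \<bullet> n = 0" using F_normal \<open>E \<subseteq> F\<close> by auto
        then show ?thesis by simp
      qed
    qed
    have "\<rho> x \<bullet> n = a \<bullet> n + c * (x \<bullet> n) + \<alpha> F * facet_bubble T F x
      + (\<Sum>E | E edge_of T \<and> z \<in> E. \<beta> E * (edge_bubble T E x * (edge_tangent E \<bullet> n)))"
      unfolding \<rho> inner_add_left inner_sum_left inner_scaleR_left facets by (simp add: mult.assoc)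
    also have "(\<Sum>E | E edge_of T \<and> z \<in> E. \<beta> E * (edge_bubble T E x * (edge_tangent E \<bullet> n))) = 0"
      by (rule sum.neutral) (use edges in auto)
    also have "x \<bullet> n = p \<bullet> n" using F_normal[OF p x] by (simp add: inner_diff_left)
    finally show "\<rho> x \<bullet> n = a \<bullet> n + c * (p \<bullet> n) + \<alpha> F * facet_bubble T F x" by simp
  qed
qed

text \<open>Where the coordinates at the facet vertices are nonnegative, only the apex coordinate
  decides membership, and its sign is the side of the hyperplane. This replaces the simplex by a
  half-space near \<open>p\<close>.\<close>

lemma mem_T_iff_halfspace:
  assumes "p \<in> F" "\<And>y. y \<in> vertices F \<Longrightarrow> 0 \<le> bary T y x"
  shows "x \<in> T \<longleftrightarrow> (x - p) \<bullet> n \<le> 0"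
proof -
  have "x \<in> T \<longleftrightarrow> 0 \<le> bary T apex x"
    unfolding mem_simplex_iff using assms(2) apex vertices_F by auto
  then show ?thesis
    using bary_apex[OF assms(1)] bary_grad_nonzero[OF apex] by (simp add: mult_le_0_iff zero_le_mult_iff)
qed

lemma facet_bubble_bounds: "x \<in> F \<Longrightarrow> 0 \<le> facet_bubble T F x \<and> facet_bubble T F x \<le> 1"
  unfolding facet_bubble_eq using F_subset bary_nonneg bary_le_1 by (auto intro!: prod_nonneg prod_le_1)

end

section \<open>The divergence theorem localised at a facet\<close>

lemma hyperplane_integrable:
  fixes \<Psi> :: "real ^ 'n \<Rightarrow> real"
  assumes cont: "continuous_on UNIV \<Psi>" and supp: "\<And>x. x \<notin> cball q R \<Longrightarrow> \<Psi> x = 0"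
    and n: "norm n = 1"
  shows "integrable lborel (\<lambda>x. indicator {x. 0 < (x - p) \<bullet> n \<and> (x - p) \<bullet> n \<le> 1} x * \<Psi> (x - ((x - p) \<bullet> n) *\<^sub>R n))"
proof -
  have [measurable]: "\<Psi> \<in> borel_measurable borel" by (rule borel_measurable_continuous_onI[OF cont])
  obtain C where C: "0 \<le> C" "\<And>x. \<bar>\<Psi> x\<bar> \<le> C"
    using continuous_compact_support_bounded[OF cont supp] by blast
  let ?f = "\<lambda>x. indicator {x. 0 < (x - p) \<bullet> n \<and> (x - p) \<bullet> n \<le> 1} x * \<Psi> (x - ((x - p) \<bullet> n) *\<^sub>R n)"
  show ?thesis
  proof (rule integrable_bounded_support)
    show "\<bar>?f x\<bar> \<le> C" for x using C by (auto simp: indicator_def)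
    show "?f x = 0" if "x \<notin> cball q (R + 1)" for x
    proof (cases "0 < (x - p) \<bullet> n \<and> (x - p) \<bullet> n \<le> 1")
      case True
      then have "\<bar>(x - p) \<bullet> n\<bar> \<le> 1" by auto
      then have "x - ((x - p) \<bullet> n) *\<^sub>R n \<notin> cball q R"
        using that hyperplane_projection_dist[OF n] by blast
      then show ?thesis using supp by simp
    qed auto
  qed measurable
qed

text \<open>A translation by \<open>n\<close> carries the layer on one side to the layer on the
  other side, up to two hyperplanes of measure zero. It is needed because the outer normals of two
  neighbours are opposite.\<close>

lemma hyperplane_integral_minus_normal:
  fixes \<Psi> :: "real ^ 'n \<Rightarrow> real"
  assumes cont: "continuous_on UNIV \<Psi>" and n: "norm n = 1"
  shows "hyperplane_integral p (- n) \<Psi> = hyperplane_integral p n \<Psi>"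
proof -
  have [measurable]: "\<Psi> \<in> borel_measurable borel" by (rule borel_measurable_continuous_onI[OF cont])
  have nn: "n \<bullet> n = 1" using n by (simp add: norm_eq_1)
  let ?\<pi> = "\<lambda>x. x - ((x - p) \<bullet> n) *\<^sub>R n"
  have s: "(x - n - p) \<bullet> n = (x - p) \<bullet> n - 1" for x
    by (simp add: inner_diff_left nn)
  have "hyperplane_integral p (- n) \<Psi>
    = (LINT x|lborel. indicator {x. - 1 \<le> (x - p) \<bullet> n \<and> (x - p) \<bullet> n < 0} x * \<Psi> (?\<pi> x))"
    unfolding hyperplane_integral_def
    by (intro Bochner_Integration.integral_cong) (auto simp: indicator_def)
  also have "\<dots> = (LINT x|lborel. indicator {x. - 1 \<le> (x - p) \<bullet> n \<and> (x - p) \<bullet> n < 0} (x + - n) * \<Psi> (?\<pi> (x + - n)))"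
    by (rule integral_lborel_translation[symmetric]) measurable
  also have "\<dots> = (LINT x|lborel. indicator {x. 0 \<le> (x - p) \<bullet> n \<and> (x - p) \<bullet> n < 1} x * \<Psi> (?\<pi> x))"
    by (intro Bochner_Integration.integral_cong) (auto simp: indicator_def s algebra_simps nn)
  also have "\<dots> = hyperplane_integral p n \<Psi>"
    unfolding hyperplane_integral_def
  proof (rule integral_cong_AE)
    have h: "AE x in lborel. (x - p) \<bullet> n \<noteq> c" for c
    proof -
      have "negligible {x. n \<bullet> x = c + n \<bullet> p}"
        using n by (intro negligible_hyperplane) auto
      then have "AE x in lebesgue. x \<notin> {x. n \<bullet> x = c + n \<bullet> p}"
        by (intro AE_not_in) (simp add: negligible_iff_null_sets)
      then have "AE x in lborel. x \<notin> {x. n \<bullet> x = c + n \<bullet> p}" by (simp add: AE_completion_iff)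
      then show ?thesis by eventually_elim (auto simp: inner_diff_left inner_diff_right inner_commute)
    qed
    show "AE x in lborel. indicator {x. 0 \<le> (x - p) \<bullet> n \<and> (x - p) \<bullet> n < 1} x * \<Psi> (?\<pi> x)
      = indicator {x. 0 < (x - p) \<bullet> n \<and> (x - p) \<bullet> n \<le> 1} x * \<Psi> (?\<pi> x)"
      using h[of 0] h[of 1] by eventually_elim (auto simp: indicator_def)
  qed measurable
  finally show ?thesis .
qed

text \<open>The left-hand side is the integral over \<open>T\<close> of the divergence of
  \<open>\<phi> \<rho>\<close>. On the support of \<open>\<phi>\<close> the simplex is a half-space,
  so the half-space theorem applies to each component.\<close>

lemma (in simplex_facet) divergence_theorem_near_facet:
  fixes \<rho> :: "real ^ 'n \<Rightarrow> real ^ 'n"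
  assumes \<rho>: "\<And>i. Ck (Suc 0) (\<lambda>x. \<rho> x $ i)" and \<phi>: "Ck (Suc 0) \<phi>"
    and supp: "\<And>x. x \<notin> cball p r \<Longrightarrow> \<phi> x = 0" and p: "p \<in> F"
    and near: "\<And>x y. x \<in> cball p r \<Longrightarrow> y \<in> vertices F \<Longrightarrow> 0 \<le> bary T y x"
  shows "l2_inner T (divergence \<rho>) \<phi> + l2_inner T \<rho> (grad \<phi>) = hyperplane_integral p n (\<lambda>x. \<phi> x * (\<rho> x \<bullet> n))"
proof -
  define \<Phi> where "\<Phi> x = \<phi> x *\<^sub>R \<rho> x" for x
  let ?h = "\<lambda>x. indicator {x. (x - p) \<bullet> n \<le> 0} x :: real"
  have \<Phi>: "Ck (Suc 0) (\<lambda>x. \<Phi> x $ i)" for i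
    unfolding \<Phi>_def using Ck_mult[OF \<phi> \<rho>] by (simp del: Ck.simps)
  have supp\<Phi>: "\<Phi> x $ i = 0" if "x \<notin> cball p r" for x i using supp[OF that] by (simp add: \<Phi>_def)
  have supp_grad: "grad \<phi> x = 0" if "x \<notin> cball p r" for x
    using grad_eq_0_outside[of p r \<phi>] supp that by blast
  have c: "continuous_on UNIV \<phi>" "continuous_on UNIV (grad \<phi>)" "continuous_on UNIV (divergence \<rho>)" "continuous_on UNIV \<rho>"
    using Ck_imp_continuous[OF \<phi>] Ck1_continuous_grad[OF \<phi>] divergence_continuous[OF \<rho>] Ck_vec_continuous[OF \<rho>] by auto
  have bT: "bounded T" using compact_T compact_imp_bounded by blast
  note L = L2_continuous_bounded[OF c(1) T_sets bT] L2_continuous_bounded[OF c(2) T_sets bT]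
    L2_continuous_bounded[OF c(3) T_sets bT] L2_continuous_bounded[OF c(4) T_sets bT]
  have "l2_inner T (divergence \<rho>) \<phi> + l2_inner T \<rho> (grad \<phi>)
    = (LINT x|lebesgue_on T. divergence \<rho> x * \<phi> x + \<rho> x \<bullet> grad \<phi> x)"
    unfolding l2_inner_def
    using L2_inner_integrable[OF L(3,1)] L2_inner_integrable[OF L(4,2)] by simp
  also have "\<dots> = (LINT x|lebesgue. indicator T x * divergence \<Phi> x)"
    unfolding \<Phi>_def divergence_mult[OF \<rho> \<phi>] using T_sets
    by (simp add: integral_restrict_space mult.commute)
  also have "\<dots> = (LINT x|lebesgue. ?h x * divergence \<Phi> x)"
  proof (intro Bochner_Integration.integral_cong refl)
    fix x
    show "indicator T x * divergence \<Phi> x = ?h x * divergence \<Phi> x"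
    proof (cases "x \<in> cball p r")
      case True
      then show ?thesis using mem_T_iff_halfspace[OF p near[OF True]] by (simp add: indicator_def)
    next
      case False
      then show ?thesis unfolding \<Phi>_def divergence_mult[OF \<rho> \<phi>] using supp supp_grad by simp
    qed
  qed
  also have "\<dots> = (LINT x|lborel. ?h x * divergence \<Phi> x)"
    using borel_measurable_continuous_onI[OF divergence_continuous[OF \<Phi>]]
    by (intro integral_completion) measurable
  also have "\<dots> = (LINT x|lborel. (\<Sum>i\<in>UNIV. ?h x * grad (\<lambda>y. \<Phi> y $ i) x $ i))"
    by (simp add: divergence_def sum_distrib_left)
  also have "\<dots> = (\<Sum>i\<in>UNIV. LINT x|lborel. ?h x * grad (\<lambda>y. \<Phi> y $ i) x $ i)"
  proof (rule Bochner_Integration.integral_sum)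
    fix i
    have m: "(\<lambda>x. grad (\<lambda>y. \<Phi> y $ i) x $ i) \<in> borel_measurable borel"
      using \<Phi>[of i] by (intro borel_measurable_continuous_onI) simp
    obtain L where L: "0 \<le> L" "\<And>x. norm (grad (\<lambda>y. \<Phi> y $ i) x) \<le> L"
      using Ck1_grad_bounded[OF \<Phi> supp\<Phi>] by blast
    show "integrable lborel (\<lambda>x. ?h x * grad (\<lambda>y. \<Phi> y $ i) x $ i)"
    proof (rule integrable_bounded_support)
      show "\<bar>?h x * grad (\<lambda>y. \<Phi> y $ i) x $ i\<bar> \<le> L" for x
        using L component_le_norm_cart[of "grad (\<lambda>y. \<Phi> y $ i) x" i] order_trans by (auto simp: indicator_def)
      show "?h x * grad (\<lambda>y. \<Phi> y $ i) x $ i = 0" if "x \<notin> cball p r" for x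
        using grad_eq_0_outside[of p r "\<lambda>y. \<Phi> y $ i"] supp\<Phi> that by simp
      show "(\<lambda>x. ?h x * grad (\<lambda>y. \<Phi> y $ i) x $ i) \<in> borel_measurable borel"
        using m by measurable
    qed
  qed
  also have "\<dots> = (\<Sum>i\<in>UNIV. n $ i * hyperplane_integral p n (\<lambda>y. \<Phi> y $ i))"
    using halfspace_integral_grad[where q = p and R = r, OF \<Phi> supp\<Phi> norm_n] by simp
  also have "\<dots> = (LINT x|lborel. (\<Sum>i\<in>UNIV. n $ i * (indicator {x. 0 < (x - p) \<bullet> n \<and> (x - p) \<bullet> n \<le> 1} x
      * \<Phi> (x - ((x - p) \<bullet> n) *\<^sub>R n) $ i)))"
    unfolding hyperplane_integral_def
    using hyperplane_integrable[where q = p and R = r, OF Ck_imp_continuous[OF \<Phi>] supp\<Phi> norm_n]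
    by (subst Bochner_Integration.integral_sum) auto
  also have "\<dots> = hyperplane_integral p n (\<lambda>x. \<phi> x * (\<rho> x \<bullet> n))"
    unfolding hyperplane_integral_def
    by (intro Bochner_Integration.integral_cong)
      (auto simp: \<Phi>_def inner_vec_def sum_distrib_left algebra_simps)
  finally show ?thesis .
qed

section \<open>Facets of a conforming mesh\<close>

lemma mesh_simplex: "conforming_mesh \<Omega> \<T> \<Longrightarrow> T \<in> \<T> \<Longrightarrow> full_simplex T"
  by (simp add: conforming_mesh_def full_simplex_def)

lemma mesh_face: "conforming_mesh \<Omega> \<T> \<Longrightarrow> T \<in> \<T> \<Longrightarrow> T' \<in> \<T> \<Longrightarrow> T \<inter> T' face_of T"
  by (simp add: conforming_mesh_def triangulation_def)

lemma mesh_finite: "conforming_mesh \<Omega> \<T> \<Longrightarrow> finite \<T>"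
  by (simp add: conforming_mesh_def triangulation_def)

lemma mesh_Union: "conforming_mesh \<Omega> \<T> \<Longrightarrow> \<Union>\<T> = closure \<Omega>"
  by (simp add: conforming_mesh_def)

text \<open>The intersection is a face of \<open>T\<close> meeting its interior, hence all of
  \<open>T\<close>. So \<open>T\<close> is itself a face of \<open>T'\<close>, and as it meets the
  interior of \<open>T'\<close> the two coincide.\<close>

lemma mesh_interior_unique:
  assumes mesh: "conforming_mesh \<Omega> \<T>" and T: "T \<in> \<T>" and T': "T' \<in> \<T>"
    and x: "x \<in> interior T" "x \<in> T'"
  shows "T = T'"
proof -
  interpret full_simplex T using mesh_simplex[OF mesh T] .
  have "T \<inter> T' = T"
    using face_of_disjoint_interior[OF mesh_face[OF mesh T T']] x interior_subset by blast
  then have "T \<subseteq> T'" by blast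
  moreover have "T' \<inter> T face_of T'" by (rule mesh_face[OF mesh T' T])
  ultimately have "T face_of T'" by (simp add: Int_absorb1)
  moreover have "interior T \<subseteq> T \<inter> interior T'"
    using interior_mono[OF \<open>T \<subseteq> T'\<close>] interior_subset by blast
  then have "T \<inter> interior T' \<noteq> {}" using x by blast
  ultimately show ?thesis using face_of_disjoint_interior by blast
qed

text \<open>The mesh only fills the closure of the domain. A Lipschitz domain has no slits, so
  element interiors and patches stay inside it. Below a point on or under the Lipschitz graph there
  is room free of the domain, which contradicts being interior to the closure.\<close>

lemma lipschitz_domain_interior_closure:
  fixes \<Omega> :: "(real ^ 'n) set"
  assumes "lipschitz_domain \<Omega>"
  shows "interior (closure \<Omega>) = \<Omega>"
proof
  have op: "open \<Omega>" using assms by (simp add: lipschitz_domain_def)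
  show "\<Omega> \<subseteq> interior (closure \<Omega>)" using op closure_subset by (rule interior_maximal[rotated])
  show "interior (closure \<Omega>) \<subseteq> \<Omega>"
  proof
    fix x assume x: "x \<in> interior (closure \<Omega>)"
    show "x \<in> \<Omega>"
    proof (rule ccontr)
      assume nx: "x \<notin> \<Omega>"
      then have "x \<in> frontier \<Omega>"
        using x op interior_subset by (auto simp: frontier_def interior_open)
      then obtain r e L g where r: "r > 0" and e: "norm e = 1" and g: "L-lipschitz_on {y. y \<bullet> e = 0} g"
        and eq: "\<Omega> \<inter> ball x r = {y \<in> ball x r. g (y - (y \<bullet> e) *\<^sub>R e) < y \<bullet> e}"
        using assms unfolding lipschitz_domain_def by blast
      let ?\<pi> = "\<lambda>y. y - (y \<bullet> e) *\<^sub>R e"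
      have ee: "e \<bullet> e = 1" using e by (simp add: norm_eq_1)
      have L: "0 \<le> L" using g lipschitz_on_nonneg by blast
      have gx: "x \<bullet> e \<le> g (?\<pi> x)" using eq nx r by force
      obtain d where d: "d > 0" "ball x d \<subseteq> closure \<Omega>"
        using x by (meson mem_interior)
      \<comment> \<open>A downward step short enough for \<open>y\<close> to stay in both balls,
        with room left for a point \<open>z\<close> near \<open>y\<close>.\<close>
      define t where "t = min d r / 2"
      have t: "0 < t" "t < d" "2 * t \<le> r" using d r by (auto simp: t_def)
      define y where "y = x - t *\<^sub>R e"
      have ye: "y \<bullet> e = x \<bullet> e - t" by (simp add: y_def inner_diff_left ee)
      have py: "?\<pi> y = ?\<pi> x" by (simp add: y_def inner_diff_left ee algebra_simps)
      have dxy: "dist x y = t" using t e by (simp add: y_def dist_norm)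
      then have "y \<in> closure \<Omega>" using d t by auto
      \<comment> \<open>Between \<open>y\<close> and \<open>z\<close> the graph changes by at most
        \<open>2 * L * \<eta>\<close> and the height by less than \<open>\<eta>\<close>; together
        this must not exceed the depth \<open>t\<close>.\<close>
      define \<eta> where "\<eta> = min t (t / (1 + 2 * L))"
      have \<eta>: "0 < \<eta>" "\<eta> \<le> t" "\<eta> * (1 + 2 * L) \<le> t"
        using t L by (auto simp: \<eta>_def min_def field_simps add_pos_nonneg)
      obtain z where z: "z \<in> \<Omega>" "dist z y < \<eta>"
        using \<open>y \<in> closure \<Omega>\<close> \<eta>(1) unfolding closure_approachable by blast
      have "dist x z \<le> dist x y + dist z y" by (metis dist_commute dist_triangle)
      then have "z \<in> ball x r" using z(2) dxy \<eta> t by auto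
      then have gz: "g (?\<pi> z) < z \<bullet> e" using eq z(1) by blast
      have in_e: "\<bar>(z - y) \<bullet> e\<bar> \<le> norm (z - y)" using Cauchy_Schwarz_ineq2[of "z - y" e] e by simp
      have "?\<pi> z - ?\<pi> y = (z - y) - ((z - y) \<bullet> e) *\<^sub>R e" by (simp add: inner_diff_left algebra_simps)
      then have "norm (?\<pi> z - ?\<pi> y) \<le> norm (z - y) + norm (((z - y) \<bullet> e) *\<^sub>R e)"
        by (metis norm_triangle_ineq4)
      also have "\<dots> \<le> 2 * norm (z - y)" using in_e e by simp
      finally have "dist (?\<pi> z) (?\<pi> y) \<le> 2 * dist z y" by (simp add: dist_norm)
      moreover have "dist (g (?\<pi> z)) (g (?\<pi> y)) \<le> L * dist (?\<pi> z) (?\<pi> y)"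
        by (rule lipschitz_onD[OF g]) (simp_all add: inner_diff_left ee)
      ultimately have "dist (g (?\<pi> z)) (g (?\<pi> y)) \<le> L * (2 * dist z y)"
        using L mult_left_mono order_trans by blast
      also have "\<dots> \<le> L * (2 * \<eta>)" using z(2) L by (intro mult_left_mono) auto
      finally have "g (?\<pi> y) - g (?\<pi> z) \<le> 2 * L * \<eta>" by (simp add: dist_real_def abs_le_iff)
      moreover have "z \<bullet> e - y \<bullet> e < \<eta>" using in_e z(2) by (simp add: inner_diff_left dist_norm)
      ultimately have "t < \<eta> + 2 * L * \<eta>" using gx gz py ye by simp
      then show False using \<eta>(3) by (simp add: algebra_simps)
    qed
  qed
qed

lemma simplex_facetI: "conforming_mesh \<Omega> \<T> \<Longrightarrow> T \<in> \<T> \<Longrightarrow> F facet_of T \<Longrightarrow> simplex_facet T F"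
  by (simp add: simplex_facet_def simplex_facet_axioms_def mesh_simplex)

text \<open>At a point \<open>q\<close> of the relative interior of \<open>F\<close> inside the
  domain, the outer side of \<open>T\<close> has to be covered by further elements, and one of them
  contains \<open>q\<close> because their union is closed. Conformity then forces the intersection
  to be all of \<open>F\<close>.\<close>

lemma mesh_neighbour:
  assumes mesh: "conforming_mesh \<Omega> \<T>" and op: "open \<Omega>"
    and T: "T \<in> \<T>" and F: "F facet_of T" and nsub: "\<not> F \<subseteq> frontier \<Omega>"
  obtains T' where "T' \<in> \<T>" "T' \<noteq> T" "F facet_of T'"
proof -
  interpret simplex_facet T F by (rule simplex_facetI[OF mesh T F])
  have sub: "\<And>K. K \<in> \<T> \<Longrightarrow> K \<subseteq> closure \<Omega>" using mesh_Union[OF mesh] by blast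
  obtain y where y: "y \<in> F" "y \<notin> frontier \<Omega>" using nsub by blast
  then have "y \<in> \<Omega>" using sub[OF T] F_subset op by (auto simp: frontier_def interior_open)
  then obtain d where d: "d > 0" "ball y d \<subseteq> \<Omega>" using op openE by blast
  obtain p where p: "p \<in> F" "\<And>v. v \<in> vertices F \<Longrightarrow> 0 < bary T v p" using ex_facet_center by blast
  \<comment> \<open>A step from \<open>y\<close> towards the centre \<open>p\<close> makes the facet
    coordinates positive; this length keeps \<open>q\<close> in the ball inside the domain. The
    added 1 avoids division by zero for \<open>p = y\<close>.\<close>
  define t where "t = min 1 (d / (2 * (norm (p - y) + 1)))"
  have t: "0 < t" "t \<le> 1" using d by (auto simp: t_def add_nonneg_pos)
  define q where "q = (1 - t) *\<^sub>R y + t *\<^sub>R p"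
  have "norm (t *\<^sub>R (p - y)) < d"
  proof -
    have "t * norm (p - y) \<le> d / (2 * (norm (p - y) + 1)) * norm (p - y)"
      by (intro mult_right_mono) (auto simp: t_def)
    also have "\<dots> = d * (norm (p - y) / (2 * (norm (p - y) + 1)))" by simp
    also have "\<dots> < d * 1"
    proof (rule mult_strict_left_mono)
      have "N / (2 * (N + 1)) < 1" if "0 \<le> N" for N :: real using that by simp
      then show "norm (p - y) / (2 * (norm (p - y) + 1)) < 1" using norm_ge_zero by blast
    qed (rule d(1))
    finally show ?thesis using t by simp
  qed
  moreover have "y - q = - (t *\<^sub>R (p - y))" by (simp add: q_def algebra_simps)
  ultimately have q\<Omega>: "q \<in> \<Omega>" using d(2) by (auto simp: dist_norm)
  have "convex F" using facet facet_of_imp_face_of face_of_imp_convex convex_T by blast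
  then have qF: "q \<in> F" unfolding q_def using y p t by (intro convexD) auto
  have bq: "0 < bary T v q" if "v \<in> vertices F" for v
  proof -
    have "bary T v q = (1 - t) * bary T v y + t * bary T v p"
      unfolding q_def bary_eq[of v "_ + _"] bary_eq[of v y] bary_eq[of v p]
      by (simp add: inner_add_right algebra_simps)
    moreover have "0 \<le> bary T v y" using y F_subset bary_nonneg by blast
    ultimately show ?thesis using p(2)[OF that] t by (simp add: add_nonneg_pos)
  qed
  have cl: "closed (\<Union>(\<T> - {T}))"
    using mesh_finite[OF mesh] mesh_simplex[OF mesh] full_simplex.compact_T
    by (intro closed_Union) (auto intro: compact_imp_closed)
  have "q \<in> \<Union>(\<T> - {T})"
  proof (rule ccontr)
    assume "q \<notin> \<Union>(\<T> - {T})"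
    then have "q \<in> \<Omega> \<inter> - \<Union>(\<T> - {T})" using q\<Omega> by blast
    moreover have "open (\<Omega> \<inter> - \<Union>(\<T> - {T}))" using op cl by (intro open_Int) auto
    ultimately obtain s where s: "s > 0" "ball q s \<subseteq> \<Omega> \<inter> - \<Union>(\<T> - {T})"
      by (meson openE)
    \<comment> \<open>A point just beyond \<open>F\<close>: it lies in the domain and in no other
      element, so \<open>T\<close> would have to contain it, but its apex coordinate is
      negative.\<close>
    let ?x = "q + (s / 2) *\<^sub>R n"
    have "?x \<in> ball q s" using s(1) by (simp add: dist_norm)
    then have "?x \<in> \<Omega> \<inter> - \<Union>(\<T> - {T})" using s(2) by blast
    moreover have "\<Omega> \<subseteq> \<Union>\<T>" using mesh_Union[OF mesh] closure_subset by blast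
    ultimately have "?x \<in> T" by blast
    then have "0 \<le> bary T apex ?x" by (rule bary_nonneg)
    moreover have "bary T apex ?x = - norm (bary_grad apex) * (s / 2)"
      using bary_apex[OF qF, of ?x] norm_n[unfolded norm_eq_1] by simp
    ultimately show False using s(1) bary_grad_nonzero[OF apex] by (simp add: mult_le_0_iff)
  qed
  then obtain T' where T': "T' \<in> \<T>" "T' \<noteq> T" "q \<in> T'" by blast
  have "T \<inter> T' face_of convex hull (vertices T)" using mesh_face[OF mesh T T'(1)] hull_vertices by simp
  then obtain c where c: "c \<subseteq> vertices T" "T \<inter> T' = convex hull c"
    using face_of_convex_hull_affine_independent[OF independent_vertices] by blast
  have "q \<in> convex hull c" using c(2) T'(3) qF F_subset by blast
  \<comment> \<open>The coordinates of \<open>q\<close> at the facet vertices are positive, so any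
    face of \<open>T\<close> through \<open>q\<close> contains all of these vertices.\<close>
  then have "vertices F \<subseteq> c"
    using bq vertices_F unfolding mem_hull_iff[OF c(1)] by force
  moreover have "c \<noteq> vertices T"
  proof
    assume "c = vertices T"
    then have "T \<inter> T' = T" using c hull_vertices by simp
    then show False
      using mesh_interior_unique[OF mesh T T'(1)] interior_nonempty interior_subset T'(2) by blast
  qed
  ultimately have "c = vertices T - {apex}" using c(1) vertices_F by blast
  then have TF: "T \<inter> T' = F" using c F_hull by simp
  have "aff_dim F = aff_dim T - 1" "F \<noteq> {}" using facet by (auto simp: facet_of_def)
  moreover have "aff_dim T = aff_dim T'"
    using aff_dim_simplex[OF simplex] aff_dim_simplex[OF full_simplex.simplex[OF mesh_simplex[OF mesh T'(1)]]] by simp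
  moreover have "F face_of T'" using mesh_face[OF mesh T'(1) T] TF by (simp add: Int_commute)
  ultimately have "F facet_of T'" by (simp add: facet_of_def)
  then show ?thesis using that T' by blast
qed

text \<open>Both normals are orthogonal to \<open>F\<close>, hence parallel. If they were equal, a
  point slightly inside \<open>T\<close> next to a relative interior point of \<open>F\<close> would
  also lie in \<open>T'\<close>.\<close>

lemma opposite_normals:
  assumes "simplex_facet T F" "simplex_facet T' F" "interior T \<inter> T' = {}"
  shows "outer_normal T' F = - outer_normal T F"
proof -
  interpret T: simplex_facet T F by fact
  interpret T': simplex_facet T' F by fact
  obtain p where p: "p \<in> F" "\<And>v. v \<in> vertices F \<Longrightarrow> 0 < bary T v p" using T.ex_facet_center by blast
  have p': "0 < bary T' v p" if "v \<in> vertices F" for v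
  proof -
    have v: "v \<in> vertices F" by fact
    let ?u = "\<lambda>y. bary T y p"
    have "(\<Sum>y\<in>vertices F. ?u y) = 1"
      using T.sum_vertices[of ?u] T.bary_sum[of p] p(1) T.mem_F_iff by simp
    moreover have "(\<Sum>y\<in>vertices F. ?u y *\<^sub>R y) = p"
      using T.sum_vertices[of "\<lambda>y. ?u y *\<^sub>R y"] T.bary_combination[of p] p(1) T.mem_F_iff by simp
    ultimately show ?thesis
      using T'.facet_point(2)[of ?u v] p(2) v by (simp add: less_imp_le)
  qed
  define w where "w = T'.n - (T'.n \<bullet> T.n) *\<^sub>R T.n"
  have wn: "w \<bullet> T.n = 0" using T.norm_n[unfolded norm_eq_1] by (simp add: w_def inner_diff_left)
  obtain t where t: "0 < t" "\<And>s y. \<bar>s\<bar> \<le> t \<Longrightarrow> y \<in> vertices F \<Longrightarrow> 0 < bary T y (p + s *\<^sub>R w)"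
    using T.bary_perturb[OF p(2)] by blast
  have b0: "bary T T.apex (p + t *\<^sub>R w) = 0" using T.bary_apex[OF p(1), of "p + t *\<^sub>R w"] wn by simp
  then have "0 \<le> bary T y (p + t *\<^sub>R w)" if "y \<in> vertices T" for y
    using t(2)[of t y] t(1) that T.vertices_F by (cases "y = T.apex") auto
  then have "p + t *\<^sub>R w \<in> F" using b0 unfolding T.mem_F_iff T.mem_simplex_iff by blast
  then have "(t *\<^sub>R w) \<bullet> T'.n = 0" using T'.F_normal[OF p(1)] by fastforce
  then have "w \<bullet> T'.n = 0" using t(1) by simp
  then have "w \<bullet> w = 0"
    using wn by (subst (2) w_def) (simp add: inner_diff_right)
  then have eq: "T'.n = (T'.n \<bullet> T.n) *\<^sub>R T.n" by (simp add: w_def)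
  then have "\<bar>T'.n \<bullet> T.n\<bar> = 1" using T.norm_n T'.norm_n by (metis mult.right_neutral norm_scaleR)
  moreover have "T'.n \<bullet> T.n \<noteq> 1"
  proof
    assume "T'.n \<bullet> T.n = 1"
    then have nn: "T'.n = T.n" using eq by (metis scaleR_one)
    obtain t where t: "0 < t" "\<And>s y. \<bar>s\<bar> \<le> t \<Longrightarrow> y \<in> vertices F \<Longrightarrow> 0 < bary T y (p + s *\<^sub>R T.n)"
      using T.bary_perturb[OF p(2)] by blast
    obtain t' where t': "0 < t'" "\<And>s y. \<bar>s\<bar> \<le> t' \<Longrightarrow> y \<in> vertices F \<Longrightarrow> 0 < bary T' y (p + s *\<^sub>R T.n)"
      using T'.bary_perturb[OF p'] by blast
    define s where "s = - min t t'"
    have s: "s < 0" "\<bar>s\<bar> \<le> t" "\<bar>s\<bar> \<le> t'" using t(1) t'(1) by (auto simp: s_def)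
    let ?x = "p + s *\<^sub>R T.n"
    have "0 < bary T T.apex ?x"
      using T.bary_apex[OF p(1), of ?x] T.norm_n[unfolded norm_eq_1] s(1) T.bary_grad_nonzero[OF T.apex]
      by (simp add: mult_less_0_iff)
    then have "?x \<in> interior T"
      using t(2)[OF s(2)] T.vertices_F by (intro T.mem_interior_bary) (metis Diff_iff singletonD)
    moreover have "?x \<in> T'"
      using T'.mem_T_iff_halfspace[OF p(1), of ?x] t'(2)[OF s(3)] s(1) T.norm_n[unfolded norm_eq_1] nn
      by (simp add: less_imp_le)
    ultimately show False using assms(3) by blast
  qed
  ultimately have "T'.n \<bullet> T.n = - 1" by linarith
  then show ?thesis using eq by (metis scaleR_minus1_left)
qed

lemma bary_on_common_facet:
  assumes "simplex_facet T F" "simplex_facet T' F" "x \<in> F" "v \<in> vertices F"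
  shows "bary T' v x = bary T v x"
proof -
  interpret T: simplex_facet T F by fact
  interpret T': simplex_facet T' F by fact
  let ?u = "\<lambda>y. bary T y x"
  have "(\<Sum>y\<in>vertices F. ?u y) = 1"
    using T.sum_vertices[of ?u] T.bary_sum[of x] assms(3) T.mem_F_iff by simp
  moreover have "(\<Sum>y\<in>vertices F. ?u y *\<^sub>R y) = x"
    using T.sum_vertices[of "\<lambda>y. ?u y *\<^sub>R y"] T.bary_combination[of x] assms(3) T.mem_F_iff by simp
  ultimately show ?thesis
    using T'.facet_point(2)[of ?u v] assms(3,4) T.bary_nonneg T.F_subset by force
qed

lemma facet_bubble_common:
  assumes "simplex_facet T F" "simplex_facet T' F" "x \<in> F"
  shows "facet_bubble T' F x = facet_bubble T F x"
  using bary_on_common_facet[OF assms]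
  by (simp add: simplex_facet.facet_bubble_eq[OF assms(1)] simplex_facet.facet_bubble_eq[OF assms(2)])

text \<open>A third element at \<open>F\<close> would have a normal opposite to two mutually
  opposite unit vectors. The normal jump is therefore a sum of exactly two terms.\<close>

lemma mesh_facet_pair:
  assumes mesh: "conforming_mesh \<Omega> \<T>" and T: "T \<in> \<T>" "F facet_of T" and T': "T' \<in> \<T>" "F facet_of T'" and ne: "T' \<noteq> T"
  shows "outer_normal T' F = - outer_normal T F" "{K \<in> \<T>. F facet_of K} = {T, T'}"
proof -
  have disj: "interior K \<inter> K' = {}" if "K \<in> \<T>" "K' \<in> \<T>" "K \<noteq> K'" for K K'
    using mesh_interior_unique[OF mesh that(1,2)] that(3) by blast
  note sf = simplex_facetI[OF mesh]
  have opp: "outer_normal K' F = - outer_normal K F"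
    if "K \<in> \<T>" "K' \<in> \<T>" "K \<noteq> K'" "F facet_of K" "F facet_of K'" for K K'
    using opposite_normals[OF sf[OF that(1,4)] sf[OF that(2,5)] disj[OF that(1-3)]] .
  show a: "outer_normal T' F = - outer_normal T F" using opp T T' ne by blast
  have "K = T \<or> K = T'" if K: "K \<in> \<T>" "F facet_of K" for K
  proof (rule ccontr)
    assume "\<not> (K = T \<or> K = T')"
    then have "outer_normal K F = - outer_normal T F" "outer_normal K F = - outer_normal T' F"
      using opp T T' K by blast+
    with a have "outer_normal T F = - outer_normal T F" by (metis minus_minus)
    then have "outer_normal T F = 0" unfolding vec_eq_iff by simp
    then show False using simplex_facet.norm_n[OF sf[OF T]] by simp
  qed
  then show "{K \<in> \<T>. F facet_of K} = {T, T'}" using T T' by blast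
qed

lemma finite_card_facets:
  fixes T :: "(real ^ 'n) set"
  assumes "simplex_facet T F"
  shows "finite {G. G facet_of T}" "card {G. G facet_of T} \<le> Suc CARD('n)"
proof -
  interpret simplex_facet T F by fact
  have "{G. G facet_of T} = (\<lambda>z. convex hull (vertices T - {z})) ` vertices T"
    by (auto simp: facet_iff)
  note eq = this
  show "finite {G. G facet_of T}" unfolding eq using finite_vertices by simp
  show "card {G. G facet_of T} \<le> Suc CARD('n)"
    unfolding eq using card_image_le[OF finite_vertices] card_vertices by simp
qed

text \<open>A radial cut-off of radius \<open>r\<close> times a cut-off of width
  \<open>\<delta>\<close> in the normal direction. On the hyperplane itself the second factor is the
  constant \<open>exp_bump 0 1\<close>, so the trace does not depend on \<open>\<delta>\<close>.
  Squares keep both arguments smooth at \<open>p\<close>.\<close>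

definition layer_bump :: "real ^ 'n \<Rightarrow> real ^ 'n \<Rightarrow> real \<Rightarrow> real \<Rightarrow> real ^ 'n \<Rightarrow> real" where
  "layer_bump p n r \<delta> x = exp_bump 0 (1 - ((x - p) \<bullet> (x - p)) / r\<^sup>2) * exp_bump 0 (1 - ((x - p) \<bullet> n)\<^sup>2 / \<delta>\<^sup>2)"

lemma layer_bump_Ck: "Ck k (layer_bump p n r \<delta>)"
proof -
  have c: "Ck k (\<lambda>x. (x - p) \<bullet> v)" for v
  proof -
    have "(\<lambda>x. - (p \<bullet> v) + v \<bullet> x) = (\<lambda>x. (x - p) \<bullet> v)"
      by (auto simp: inner_diff_left inner_diff_right inner_commute)
    then show ?thesis using Ck_affine[of k "- (p \<bullet> v)" v] by (simp only:)
  qed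
  have "(x - p) \<bullet> (x - p) = (\<Sum>i\<in>UNIV. ((x - p) \<bullet> axis i 1) * ((x - p) \<bullet> axis i 1))" for x
    unfolding inner_axis real_inner_1_right by (simp add: inner_vec_def)
  then have q: "Ck k (\<lambda>x. (x - p) \<bullet> (x - p))"
    using Ck_sum[of UNIV k "\<lambda>i x. ((x - p) \<bullet> axis i 1) * ((x - p) \<bullet> axis i 1)"] Ck_mult[OF c c] by (simp del: Ck.simps)
  have a: "Ck k (\<lambda>x. 1 + (- 1 / r\<^sup>2) * ((x - p) \<bullet> (x - p)))" by (intro Ck_add Ck_const Ck_mult[OF Ck_const q])
  have b: "Ck k (\<lambda>x. 1 + (- 1 / \<delta>\<^sup>2) * (((x - p) \<bullet> n) * ((x - p) \<bullet> n)))"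
    by (intro Ck_add Ck_const Ck_mult[OF Ck_const] Ck_mult[OF c c])
  show ?thesis
    unfolding layer_bump_def[abs_def]
    using Ck_mult[OF Ck_exp_bump[OF a] Ck_exp_bump[OF b]] by (simp add: power2_eq_square del: Ck.simps)
qed

lemma layer_bump_bounds: "0 \<le> layer_bump p n r \<delta> x" "layer_bump p n r \<delta> x \<le> 1"
  unfolding layer_bump_def by (auto intro!: mult_le_one exp_bump_0_le_1)

lemma layer_bump_outside:
  assumes "0 < r" "0 < \<delta>" "x \<notin> cball p r \<or> \<delta> \<le> \<bar>(x - p) \<bullet> n\<bar>"
  shows "layer_bump p n r \<delta> x = 0"
proof (cases "x \<in> cball p r")
  case False
  then have "r\<^sup>2 \<le> (norm (x - p))\<^sup>2" using assms(1) by (intro power_mono) (auto simp: dist_norm norm_minus_commute)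
  then have "1 - ((x - p) \<bullet> (x - p)) / r\<^sup>2 \<le> 0" using assms(1) by (simp add: power2_norm_eq_inner)
  then show ?thesis by (simp add: layer_bump_def)
next
  case True
  then have "\<delta>\<^sup>2 \<le> ((x - p) \<bullet> n)\<^sup>2" using assms by (simp add: abs_le_square_iff[symmetric])
  then have "1 - ((x - p) \<bullet> n)\<^sup>2 / \<delta>\<^sup>2 \<le> 0" using assms(2) by simp
  then show ?thesis by (simp add: layer_bump_def)
qed

text \<open>At half the radius the argument of the radial factor is at least
  \<open>1 - (1/2)^2 = 3/4\<close>.\<close>

lemma layer_bump_ge:
  assumes "0 < r" "norm (x - p) \<le> r / 2" "(x - p) \<bullet> n = 0"
  shows "exp_bump 0 (3/4) * exp_bump 0 1 \<le> layer_bump p n r \<delta> x"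
proof -
  have "(norm (x - p))\<^sup>2 \<le> (r / 2)\<^sup>2" using assms by (intro power_mono) auto
  then have "(x - p) \<bullet> (x - p) \<le> r\<^sup>2 / 4" by (simp add: power2_norm_eq_inner power_divide)
  then have "3 / 4 \<le> 1 - ((x - p) \<bullet> (x - p)) / r\<^sup>2"
    using assms(1) by (simp add: field_simps)
  then show ?thesis
    unfolding layer_bump_def using assms(3) by (auto intro!: mult_mono exp_bump_0_mono)
qed

text \<open>The radial factor contributes at most \<open>4 / r\<close> and the normal factor at most
  \<open>4 / \<delta>\<close>: a bound 2 for \<open>exp_bump 2\<close>, times 2 from differentiating
  a square. Since \<open>\<delta> \<le> r\<close>, the thin direction dominates.\<close>

lemma layer_bump_grad:
  assumes r: "0 < \<delta>" "\<delta> \<le> r" and n: "norm n = 1"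
  shows "norm (grad (layer_bump p n r \<delta>) x) \<le> 8 / \<delta>"
    "x \<notin> cball p r \<or> \<delta> \<le> \<bar>(x - p) \<bullet> n\<bar> \<Longrightarrow> grad (layer_bump p n r \<delta>) x = 0"
proof -
  let ?f = "exp_bump 0"
  define u where "u = 1 - ((x - p) \<bullet> (x - p)) / r\<^sup>2"
  define v where "v = 1 - ((x - p) \<bullet> n)\<^sup>2 / \<delta>\<^sup>2"
  define G where "G = (?f v * exp_bump 2 u * (- 2 / r\<^sup>2)) *\<^sub>R (x - p) + (?f u * exp_bump 2 v * (- 2 * ((x - p) \<bullet> n) / \<delta>\<^sup>2)) *\<^sub>R n"
  \<comment> \<open>For index 0 the first term of \<open>exp_bump_deriv\<close> drops out.\<close>
  have f': "(?f has_derivative (\<lambda>h. exp_bump 2 t * h)) (at t)" for t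
    using exp_bump_deriv[of 0 t] by (simp add: has_field_derivative_def numeral_2_eq_2)
  have du: "((\<lambda>x. 1 - ((x - p) \<bullet> (x - p)) / r\<^sup>2) has_derivative (\<lambda>h. - (2 * ((x - p) \<bullet> h)) / r\<^sup>2)) (at x)"
    unfolding divide_inverse by (auto intro!: derivative_eq_intros simp: inner_commute)
  have dv: "((\<lambda>x. 1 - ((x - p) \<bullet> n)\<^sup>2 / \<delta>\<^sup>2) has_derivative (\<lambda>h. - (2 * ((x - p) \<bullet> n) * (h \<bullet> n)) / \<delta>\<^sup>2)) (at x)"
    unfolding divide_inverse by (auto intro!: derivative_eq_intros)
  have "(layer_bump p n r \<delta> has_derivative (\<lambda>h. ?f u * (exp_bump 2 v * (- (2 * ((x - p) \<bullet> n) * (h \<bullet> n)) / \<delta>\<^sup>2))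
     + (exp_bump 2 u * (- (2 * ((x - p) \<bullet> h)) / r\<^sup>2)) * ?f v)) (at x)"
    unfolding layer_bump_def[abs_def]
    using has_derivative_mult[OF has_derivative_compose[OF du f'] has_derivative_compose[OF dv f']]
    by (simp add: u_def v_def)
  note D = grad_eqI[OF this]
  have ring: "a * (b * (- (2 * s * c) / d)) + (e * (- (2 * z) / k)) * g = g * e * (- 2 / k) * z + a * b * (- 2 * s / d) * c"
    for a b c d e g k s z :: real by (simp add: mult.assoc mult.commute mult.left_commute)
  have grad: "grad (layer_bump p n r \<delta>) x = G"
    unfolding vec_eq_iff D G_def ring vector_add_component vector_scaleR_component
    by (simp only: inner_axis inner_axis' real_inner_1_right real_inner_1_left inner_real_def mult_1_left mult_1_right real_scaleR_def simp_thms)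
  have out: "exp_bump 2 u = 0 \<and> ?f u = 0" if "x \<notin> cball p r"
  proof -
    have "r\<^sup>2 \<le> (norm (x - p))\<^sup>2" using that r by (intro power_mono) (auto simp: dist_norm norm_minus_commute)
    then have "u \<le> 0" using r by (simp add: power2_norm_eq_inner u_def)
    then show ?thesis by simp
  qed
  have out': "exp_bump 2 v = 0 \<and> ?f v = 0" if "\<delta> \<le> \<bar>(x - p) \<bullet> n\<bar>"
  proof -
    have "\<delta>\<^sup>2 \<le> ((x - p) \<bullet> n)\<^sup>2" using r that by (simp add: abs_le_square_iff[symmetric])
    then have "v \<le> 0" using r by (simp add: v_def)
    then show ?thesis by simp
  qed
  show zero: "grad (layer_bump p n r \<delta>) x = 0" if "x \<notin> cball p r \<or> \<delta> \<le> \<bar>(x - p) \<bullet> n\<bar>"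
    using that out out' unfolding grad G_def by auto
  show "norm (grad (layer_bump p n r \<delta>) x) \<le> 8 / \<delta>"
  proof (cases "x \<notin> cball p r \<or> \<delta> \<le> \<bar>(x - p) \<bullet> n\<bar>")
    case True
    then show ?thesis using zero r by simp
  next
    case False
    then have x: "norm (x - p) \<le> r" "\<bar>(x - p) \<bullet> n\<bar> \<le> \<delta>" by (auto simp: dist_norm norm_minus_commute)
    have prod: "\<bar>?f s * exp_bump 2 t\<bar> \<le> 2" for s t
      using mult_mono[OF exp_bump_0_le_1[of s] exp_bump_2_le_2[of t]] by (simp add: abs_mult)
    have "norm ((?f v * exp_bump 2 u * (- 2 / r\<^sup>2)) *\<^sub>R (x - p)) = \<bar>?f v * exp_bump 2 u\<bar> * (2 / r\<^sup>2 * norm (x - p))"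
      by (simp add: abs_mult)
    also have "\<dots> \<le> 2 * (2 / r\<^sup>2 * r)"
      using x r by (intro mult_mono prod) auto
    also have "\<dots> = 4 / r" using r by (simp add: power2_eq_square)
    also have "\<dots> \<le> 4 / \<delta>" using r by (simp add: frac_le)
    finally have 1: "norm ((?f v * exp_bump 2 u * (- 2 / r\<^sup>2)) *\<^sub>R (x - p)) \<le> 4 / \<delta>" .
    have "norm ((?f u * exp_bump 2 v * (- 2 * ((x - p) \<bullet> n) / \<delta>\<^sup>2)) *\<^sub>R n) = \<bar>?f u * exp_bump 2 v\<bar> * (2 / \<delta>\<^sup>2 * \<bar>(x - p) \<bullet> n\<bar>)"
      using n by (simp add: abs_mult)
    also have "\<dots> \<le> 2 * (2 / \<delta>\<^sup>2 * \<delta>)"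
      using x r by (intro mult_mono prod) auto
    also have "\<dots> = 4 / \<delta>" using r by (simp add: power2_eq_square)
    finally have "norm G \<le> 4 / \<delta> + 4 / \<delta>"
      unfolding G_def using 1 norm_triangle_mono by blast
    then show ?thesis unfolding grad by simp
  qed
qed

text \<open>The support is a slab of volume of order \<open>r ^ (d - 1) * \<delta>\<close>. The case
  \<open>B = 1\<close> serves the bump and \<open>B = 8 / \<delta>\<close> its gradient.\<close>

lemma l2_norm_layer_le:
  fixes f :: "real ^ 'n \<Rightarrow> 'b::euclidean_space"
  assumes f: "continuous_on UNIV f" and d: "0 < \<delta>" "\<delta> \<le> r" and n: "norm n = 1"
    and bound: "\<And>x. norm (f x) \<le> B"
    and out: "\<And>x. x \<notin> cball p r \<or> \<delta> \<le> \<bar>(x - p) \<bullet> n\<bar> \<Longrightarrow> f x = 0" and S: "S \<in> sets lebesgue"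
  shows "(l2_norm S f)\<^sup>2 \<le> B\<^sup>2 * (2 * 3 ^ CARD('n) * unit_ball_vol CARD('n) * r ^ (CARD('n) - 1) * \<delta>)"
proof -
  let ?A = "{x \<in> cball p r. \<bar>(x - p) \<bullet> n\<bar> < \<delta>}"
  have "open {x. \<bar>(x - p) \<bullet> n\<bar> < \<delta>}" by (intro open_Collect_less continuous_intros)
  then have "cball p r \<inter> {x. \<bar>(x - p) \<bullet> n\<bar> < \<delta>} \<in> lmeasurable"
    by (intro fmeasurable_Int_fmeasurable) auto
  moreover have "cball p r \<inter> {x. \<bar>(x - p) \<bullet> n\<bar> < \<delta>} = ?A" by auto
  ultimately have A: "?A \<in> lmeasurable" by (simp only:)
  have B: "0 \<le> B" using bound[of p] norm_ge_zero order_trans by blast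
  have "(l2_norm S f)\<^sup>2 = (LINT x|lebesgue. indicator S x * (norm (f x))\<^sup>2)"
    by (simp add: l2_norm_sq integral_restrict_space S)
  also have "\<dots> \<le> (LINT x|lebesgue. B\<^sup>2 * indicator ?A x)"
  proof (rule integral_mono')
    show "integrable lebesgue (\<lambda>x. B\<^sup>2 * indicator ?A x)"
      using A by (intro integrable_mult_right integrable_real_indicator) (auto simp: fmeasurable_def)
    show "indicator S x * (norm (f x))\<^sup>2 \<le> B\<^sup>2 * indicator ?A x" for x
    proof (cases "x \<in> ?A")
      case True
      then show ?thesis using bound[of x] by (auto simp: indicator_def intro!: power_mono)
    next
      case False
      then show ?thesis using out[of x] by auto
    qed
  qed auto
  also have "\<dots> = B\<^sup>2 * measure lebesgue ?A" using A by (simp add: fmeasurable_def)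
  also have "\<dots> \<le> B\<^sup>2 * (2 * 3 ^ CARD('n) * unit_ball_vol CARD('n) * r ^ (CARD('n) - 1) * \<delta>)"
    by (intro mult_left_mono slab_measure_le n d) auto
  finally show ?thesis .
qed

section \<open>Projections, patch norms and surface integrals\<close>

lemma l2_norm_add_sq_le:
  assumes "f \<in> L2 S" "g \<in> L2 S"
  shows "(l2_norm S (\<lambda>x. f x + g x))\<^sup>2 \<le> 2 * (l2_norm S f)\<^sup>2 + 2 * (l2_norm S g)\<^sup>2"
proof -
  have i: "integrable (lebesgue_on S) (\<lambda>x. (norm (h x))\<^sup>2)" if "h \<in> L2 S" for h :: "real ^ 'a \<Rightarrow> 'b"
    using that by (simp add: L2_def)
  have "(LINT x|lebesgue_on S. (norm (f x + g x))\<^sup>2) \<le> (LINT x|lebesgue_on S. 2 * (norm (f x))\<^sup>2 + 2 * (norm (g x))\<^sup>2)"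
    using i[OF L2_add[OF assms]] i[OF assms(1)] i[OF assms(2)] norm_add_squared_le
    by (intro integral_mono) auto
  then show ?thesis using i[OF assms(1)] i[OF assms(2)] by (simp add: l2_norm_sq)
qed

text \<open>The definite description in \<open>proj0\<close> picks the mean value: testing against
  all constants shows that it is the only solution.\<close>

lemma proj0_orthogonal:
  fixes f :: "real ^ 'n \<Rightarrow> 'b::euclidean_space"
  assumes T: "T \<in> lmeasurable" "0 < measure lebesgue T" and f: "f \<in> L2 T"
  shows "l2_inner T (\<lambda>x. f x - proj0 T f) (\<lambda>_. q) = 0"
proof -
  have c: "(\<lambda>_. c) \<in> L2 T" for c :: 'b by (rule L2_const[OF T(1)])
  have c1: "(\<lambda>_. 1::real) \<in> L2 T" by (rule L2_const[OF T(1)])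
  have int: "integrable (lebesgue_on T) f"
  proof (rule Bochner_Integration.integrable_bound)
    show "integrable (lebesgue_on T) (\<lambda>x. 1 + (norm (f x))\<^sup>2)"
      using f L2_inner_integrable[OF c1 c1] by (simp add: L2_def)
    show "f \<in> borel_measurable (lebesgue_on T)" using f by (simp add: L2_def)
    have "t \<le> 1 + t\<^sup>2" for t :: real
      using sum_squares_bound[of t 1, unfolded power_one mult_1_right] zero_le_power2[of t] by linarith
    then show "AE x in lebesgue_on T. norm (f x) \<le> norm (1 + (norm (f x))\<^sup>2)"
      by (intro AE_I2) (simp add: add_nonneg_nonneg abs_of_nonneg)
  qed
  have intc: "integrable (lebesgue_on T) (\<lambda>_. c)" for c :: 'b
    using T(1) by (auto simp: fmeasurable_def intro!: finite_measure.integrable_const finite_measureI simp: emeasure_restrict_space)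
  have m: "measure (lebesgue_on T) (space (lebesgue_on T)) = measure lebesgue T"
    using T(1) by (simp add: measure_restrict_space fmeasurable_def)
  have val: "l2_inner T (\<lambda>x. f x - c) (\<lambda>_. q) = ((LINT x|lebesgue_on T. f x) - measure lebesgue T *\<^sub>R c) \<bullet> q" for c q
  proof -
    have "l2_inner T (\<lambda>x. f x - c) (\<lambda>_. q) = (LINT x|lebesgue_on T. f x - c) \<bullet> q"
      unfolding l2_inner_def using int intc by (intro integral_inner_left) auto
    also have "(LINT x|lebesgue_on T. f x - c) = (LINT x|lebesgue_on T. f x) - measure lebesgue T *\<^sub>R c"
      using int intc[of c] m by simp
    finally show ?thesis .
  qed
  define I where "I = (LINT x|lebesgue_on T. f x)"
  let ?c = "(1 / measure lebesgue T) *\<^sub>R I"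
  have "proj0 T f = ?c"
    unfolding proj0_def val I_def[symmetric]
  proof (rule the_equality)
    show "\<forall>q. (I - measure lebesgue T *\<^sub>R ?c) \<bullet> q = 0" using T(2) by simp
    fix c assume "\<forall>q. (I - measure lebesgue T *\<^sub>R c) \<bullet> q = 0"
    then have "I - measure lebesgue T *\<^sub>R c = 0" using inner_eq_zero_iff by blast
    then have "I = measure lebesgue T *\<^sub>R c" by simp
    then show "c = ?c" using T(2) by simp
  qed
  then show ?thesis using T(2) by (simp add: val I_def)
qed

text \<open>Pythagoras: the deviation from the mean is orthogonal to the constant
  \<open>P - c\<close>.\<close>

lemma proj0_best_approximation:
  fixes f :: "real ^ 'n \<Rightarrow> 'b::euclidean_space"
  assumes T: "T \<in> lmeasurable" "0 < measure lebesgue T" and f: "f \<in> L2 T"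
  shows "(l2_norm T (\<lambda>x. f x - proj0 T f))\<^sup>2 \<le> (l2_norm T (\<lambda>x. f x - c))\<^sup>2"
proof -
  define P where "P = proj0 T f"
  define k where "k = P - c"
  have L: "(\<lambda>x. f x - P) \<in> L2 T" "(\<lambda>_. k) \<in> L2 T"
    using L2_diff[OF f L2_const[OF T(1)]] L2_const[OF T(1)] by auto
  have "(norm (f x - c))\<^sup>2 = (norm (f x - P))\<^sup>2 + 2 * ((f x - P) \<bullet> k) + k \<bullet> k" for x
    unfolding power2_norm_eq_inner k_def by (simp add: inner_diff_left inner_diff_right inner_commute)
  then have "(l2_norm T (\<lambda>x. f x - c))\<^sup>2
    = (LINT x|lebesgue_on T. (norm (f x - P))\<^sup>2 + 2 * ((f x - P) \<bullet> k) + k \<bullet> k)"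
    by (simp add: l2_norm_sq)
  also have "\<dots> = (l2_norm T (\<lambda>x. f x - P))\<^sup>2 + 2 * l2_inner T (\<lambda>x. f x - P) (\<lambda>_. k) + (LINT x|lebesgue_on T. k \<bullet> k)"
    using L2_inner_integrable[OF L(1,1)] L2_inner_integrable[OF L] L2_inner_integrable[OF L(2,2)]
    by (simp add: l2_norm_sq l2_inner_def power2_norm_eq_inner)
  also have "l2_inner T (\<lambda>x. f x - P) (\<lambda>_. k) = 0"
    unfolding P_def by (rule proj0_orthogonal[OF T f])
  finally show ?thesis by (simp add: P_def)
qed

section \<open>Piecewise divergences and norms on patches\<close>

lemma L2_Un:
  assumes "f \<in> L2 A" "f \<in> L2 B" "A \<in> sets lebesgue" "B \<in> sets lebesgue"
  shows "f \<in> L2 (A \<union> B)"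
proof -
  have B: "f \<in> L2 (B - A)" by (rule L2_subset[OF assms(2)]) (use assms in auto)
  have "indicator (A \<union> B) x *\<^sub>R f x = indicator A x *\<^sub>R f x + indicator (B - A) x *\<^sub>R f x"
    "indicator (A \<union> B) x * (norm (f x))\<^sup>2 = indicator A x * (norm (f x))\<^sup>2 + indicator (B - A) x * (norm (f x))\<^sup>2" for x
    by (auto simp: indicator_def)
  then show ?thesis using assms B by (auto simp: L2_iff)
qed

lemma L2_UN:
  assumes "finite I" "\<And>i. i \<in> I \<Longrightarrow> A i \<in> sets lebesgue" "\<And>i. i \<in> I \<Longrightarrow> f \<in> L2 (A i)"
  shows "f \<in> L2 (\<Union>i\<in>I. A i)"
  using assms
proof (induction I rule: finite_induct)
  case empty
  then show ?case by (simp add: L2_iff)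
next
  case (insert i I)
  then show ?case by (auto intro!: L2_Un sets.finite_UN)
qed

lemma pw_div_eq:
  assumes mesh: "conforming_mesh \<Omega> \<T>" and T: "T \<in> \<T>" and x: "x \<in> interior T"
  shows "pw_div \<T> \<tau> x = weak_div T \<tau> x"
proof -
  have "K = T" if "K \<in> \<T>" "x \<in> interior K" for K
    using mesh_interior_unique[OF mesh T that(1) x] that(2) interior_subset by blast
  then have "{K \<in> \<T>. x \<in> interior K} = {T}" using T x by blast
  then show ?thesis by (simp add: pw_div_def)
qed

lemma Hdiv_mesh_diff:
  assumes "conforming_mesh \<Omega> \<T>" "\<Omega> \<in> sets lebesgue" "\<sigma> \<in> Hdiv_mesh \<Omega> \<T>" "\<tau> \<in> Hdiv_mesh \<Omega> \<T>"
  shows "(\<lambda>x. \<sigma> x - \<tau> x) \<in> Hdiv_mesh \<Omega> \<T>"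
  using assms full_simplex.T_sets[OF mesh_simplex[OF assms(1)]]
  by (auto simp: Hdiv_mesh_def intro!: L2_diff Hdiv_diff)

text \<open>On each element interior \<open>pw_div\<close> is the local weak divergence. What
  remains of \<open>U\<close> lies on the boundaries of finitely many elements and is
  negligible.\<close>

lemma pw_div_L2:
  assumes mesh: "conforming_mesh \<Omega> \<T>" and \<tau>: "\<tau> \<in> Hdiv_mesh \<Omega> \<T>"
    and U: "open U" "U \<subseteq> \<Union>\<T>"
  shows "pw_div \<T> \<tau> \<in> L2 U"
proof -
  note s = mesh_simplex[OF mesh]
  have int: "pw_div \<T> \<tau> \<in> L2 (interior K)" if K: "K \<in> \<T>" for K
  proof -
    have "\<tau> \<in> Hdiv K" using \<tau> K by (simp add: Hdiv_mesh_def)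
    then have "weak_div K \<tau> \<in> L2 (interior K)"
      by (rule L2_subset[OF weak_div_works(1) full_simplex.T_sets[OF s[OF K]] _ interior_subset]) simp
    then show ?thesis
      by (rule L2_cong_AE) (use pw_div_eq[OF mesh K] in auto)
  qed
  have fin: "finite \<T>" by (rule mesh_finite[OF mesh])
  have "pw_div \<T> \<tau> \<in> L2 (\<Union>K\<in>\<T>. interior K)" by (intro L2_UN fin int) auto
  moreover have op: "open (\<Union>K\<in>\<T>. interior K)" by auto
  then have sets: "(\<Union>K\<in>\<T>. interior K) \<in> sets lebesgue" "U \<inter> (\<Union>K\<in>\<T>. interior K) \<in> sets lebesgue"
    using U(1) by (auto intro!: sets_completionI_sets borel_open open_Int simp del: Int_UN_distrib)
  ultimately have "pw_div \<T> \<tau> \<in> L2 (U \<inter> (\<Union>K\<in>\<T>. interior K))"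
    by (rule L2_subset) simp
  then show ?thesis
  proof (rule L2_null_extend)
    show "U \<inter> (\<Union>K\<in>\<T>. interior K) \<in> sets lebesgue" by (rule sets(2))
    show "U \<in> sets lebesgue" using U(1) by auto
    have "negligible (\<Union>K\<in>\<T>. K - interior K)"
      using fin full_simplex.negligible_boundary[OF s] by (intro negligible_Union) auto
    then show "negligible (U - U \<inter> (\<Union>K\<in>\<T>. interior K))"
      by (rule negligible_subset) (use U(2) in auto)
  qed auto
qed

text \<open>The closed element need not lie in the open set \<open>U\<close>, so the comparison goes
  through its interior, which differs from it by a null set.\<close>

lemma local_norms_le:
  assumes mesh: "conforming_mesh \<Omega> \<T>" and \<tau>: "\<tau> \<in> Hdiv_mesh \<Omega> \<T>" and op: "open \<Omega>"
    and U: "open U" "U \<subseteq> \<Union>\<T>" "U \<subseteq> \<Omega>" and K: "K \<in> \<T>" "interior K \<subseteq> U"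
  shows "l2_norm K \<tau> \<le> l2_norm U \<tau>" "l2_norm K (weak_div K \<tau>) \<le> l2_norm U (pw_div \<T> \<tau>)"
proof -
  interpret full_simplex K by (rule mesh_simplex[OF mesh K(1)])
  have I: "interior K \<in> sets lebesgue" "interior K \<subseteq> K" "U \<in> sets lebesgue" using interior_subset U(1) by auto
  have H: "\<tau> \<in> Hdiv K" and L: "\<tau> \<in> L2 \<Omega>" using \<tau> K by (auto simp: Hdiv_mesh_def)
  then have "\<tau> \<in> L2 K" by (simp add: Hdiv_def)
  have eq: "l2_norm K f = l2_norm (interior K) f" if "f \<in> L2 K" for f :: "real ^ 'a \<Rightarrow> 'b::euclidean_space"
    unfolding l2_norm_def using l2_inner_null_extend[OF that that I(1) T_sets I(2) negligible_boundary] by simp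
  have "l2_norm K \<tau> = l2_norm (interior K) \<tau>" by (rule eq[OF \<open>\<tau> \<in> L2 K\<close>])
  also have "\<dots> \<le> l2_norm U \<tau>"
    using L2_subset[OF L _ I(3) U(3)] op by (intro l2_norm_subset I K) auto
  finally show "l2_norm K \<tau> \<le> l2_norm U \<tau>" .
  have wd: "weak_div K \<tau> \<in> L2 K" by (rule weak_div_works(1)[OF H])
  have wi: "weak_div K \<tau> \<in> L2 (interior K)" by (rule L2_subset[OF wd T_sets I(1,2)])
  note pU = pw_div_L2[OF mesh \<tau> U(1,2)]
  have "l2_norm K (weak_div K \<tau>) = l2_norm (interior K) (weak_div K \<tau>)" by (rule eq[OF wd])
  also have "\<dots> = l2_norm (interior K) (pw_div \<T> \<tau>)"
    by (rule l2_norm_cong_AE[OF wi L2_subset[OF pU I(3,1) K(2)] I(1)]) (use pw_div_eq[OF mesh K(1)] in auto)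
  also have "\<dots> \<le> l2_norm U (pw_div \<T> \<tau>)" by (rule l2_norm_subset[OF pU I(3,1) K(2)])
  finally show "l2_norm K (weak_div K \<tau>) \<le> l2_norm U (pw_div \<T> \<tau>)" .
qed

section \<open>Control of the normal trace by one point value\<close>

context simplex_facet
begin

text \<open>Two points at which the bubble takes values in the ratio 4:3 control both coefficients of
  \<open>a + b \<eta>\<close>.\<close>

lemma ex_control_point:
  assumes d: "2 \<le> CARD('n)"
  obtains p where "p \<in> F" "\<And>v. v \<in> vertices F \<Longrightarrow> 1 / (2 * real CARD('n)) \<le> bary T v p"
    "\<bar>b\<bar> \<le> 8 * real CARD('n) ^ CARD('n) * \<bar>a + b * facet_bubble T F p\<bar>"
proof -
  let ?d = "real CARD('n)"
  define \<theta> where "\<theta> = (1 / ?d) ^ CARD('n)"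
  have d0: "0 < ?d" by simp
  have \<theta>: "0 < \<theta>" by (simp add: \<theta>_def)
  define p1 where "p1 = (\<Sum>y\<in>vertices F. (1 / ?d) *\<^sub>R y)"
  have s1: "(\<Sum>y\<in>vertices F. 1 / ?d) = 1" using card_vertices_F by simp
  have p1: "p1 \<in> F" "\<And>v. v \<in> vertices F \<Longrightarrow> bary T v p1 = 1 / ?d"
    using facet_point[of "\<lambda>_. 1 / ?d"] s1 unfolding p1_def by auto
  have b1: "facet_bubble T F p1 = \<theta>"
    unfolding facet_bubble_eq \<theta>_def using p1(2) card_vertices_F by simp
  obtain v1 v2 where v: "v1 \<in> vertices F" "v2 \<in> vertices F" "v1 \<noteq> v2"
    using card_vertices_F d finite_vertices_F
    by (metis card_le_Suc0_iff_eq not_less_eq_eq numeral_2_eq_2)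
  \<comment> \<open>Weight is moved between two vertices of the facet: the sum of weights is kept,
    while the product gets the factor \<open>1/2 * 3/2 = 3/4\<close>.\<close>
  define u where "u y = (if y = v1 then 1 / (2 * ?d) else if y = v2 then 3 / (2 * ?d) else 1 / ?d)" for y
  define R where "R = vertices F - {v1} - {v2}"
  have fR: "finite R" and nR: "v1 \<notin> insert v2 R" "v2 \<notin> R" and VR: "vertices F = insert v1 (insert v2 R)"
    using finite_vertices_F v by (auto simp: R_def)
  have cR: "card R + 2 = CARD('n)" using card_vertices_F fR nR by (simp add: VR)
  have uR: "u y = 1 / ?d" if "y \<in> R" for y using that nR by (auto simp: u_def)
  have u0: "1 / (2 * ?d) \<le> u y" "0 \<le> u y" for y using d0 by (auto simp: u_def divide_simps)
  have s2: "sum u (vertices F) = 1"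
  proof -
    have "sum u (vertices F) = u v1 + (u v2 + sum u R)" unfolding VR using fR nR by simp
    also have "sum u R = real (card R) / ?d" using uR by simp
    also have "u v1 + (u v2 + real (card R) / ?d) = (real (card R) + 2) / ?d"
      using v(3) by (simp add: u_def add_divide_distrib)
    also have "\<dots> = 1" using cR by (metis d0 divide_self less_irrefl of_nat_add of_nat_numeral)
    finally show ?thesis .
  qed
  define p2 where "p2 = (\<Sum>y\<in>vertices F. u y *\<^sub>R y)"
  have p2: "p2 \<in> F" "\<And>v. v \<in> vertices F \<Longrightarrow> bary T v p2 = u v"
    using facet_point[of u] s2 u0 unfolding p2_def by auto
  have b2: "facet_bubble T F p2 = 3 / 4 * \<theta>"
  proof -
    have "facet_bubble T F p2 = prod u (vertices F)" unfolding facet_bubble_eq using p2(2) by simp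
    also have "\<dots> = u v1 * (u v2 * prod u R)" unfolding VR using fR nR by simp
    also have "prod u R = (1 / ?d) ^ card R" using uR by simp
    also have "u v1 * (u v2 * (1 / ?d) ^ card R) = 3 / 4 * (1 / ?d) ^ (card R + 2)"
      using v(3) by (simp add: u_def power_add power2_eq_square)
    finally show ?thesis unfolding cR \<theta>_def .
  qed
  have inv: "?d ^ CARD('n) = 1 / \<theta>" by (simp add: \<theta>_def power_one_over)
  define M where "M = max \<bar>a + b * \<theta>\<bar> \<bar>a + b * (3 / 4 * \<theta>)\<bar>"
  \<comment> \<open>The two bubble values differ by \<open>\<theta> / 4\<close>, so the difference
    of the two traces recovers \<open>b\<close>. Hence \<open>\<bar>b\<bar> * \<theta>\<close> is at
    most 8 times the larger of the two absolute values, and that point is taken.\<close>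
  have "b * \<theta> = 4 * ((a + b * \<theta>) - (a + b * (3 / 4 * \<theta>)))" by simp
  then have "\<bar>b * \<theta>\<bar> = 4 * \<bar>(a + b * \<theta>) - (a + b * (3 / 4 * \<theta>))\<bar>" by (metis abs_mult abs_numeral)
  also have "\<dots> \<le> 4 * (\<bar>a + b * \<theta>\<bar> + \<bar>a + b * (3 / 4 * \<theta>)\<bar>)"
    by (intro mult_left_mono abs_triangle_ineq4) simp
  also have "\<dots> \<le> 4 * (M + M)" by (intro mult_left_mono add_mono) (simp_all add: M_def)
  also have "\<dots> = 8 * M" by simp
  finally have "\<bar>b\<bar> \<le> 8 * ?d ^ CARD('n) * M" using \<theta> by (simp add: inv abs_mult field_simps)
  then consider "\<bar>b\<bar> \<le> 8 * ?d ^ CARD('n) * \<bar>a + b * facet_bubble T F p1\<bar>"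
    | "\<bar>b\<bar> \<le> 8 * ?d ^ CARD('n) * \<bar>a + b * facet_bubble T F p2\<bar>"
    unfolding M_def b1 b2 by (auto simp: max_def split: if_splits)
  then show ?thesis
  proof cases
    case 1
    have "1 / (2 * ?d) \<le> 1 / ?d" using d0 by (simp add: divide_simps)
    then show ?thesis using that[OF p1(1) _ 1] p1(2) by simp
  next
    case 2
    then show ?thesis using that[OF p2(1) _ 2] p2(2) u0 by simp
  qed
qed

text \<open>A product of \<open>CARD('n)\<close> factors of absolute value at most 1, each of which
  changes by at most \<open>G * norm (x - p)\<close>.\<close>

lemma facet_bubble_Lipschitz:
  assumes G: "\<And>v. v \<in> vertices T \<Longrightarrow> norm (bary_grad v) \<le> G" and x: "x \<in> F" "p \<in> F"
  shows "\<bar>facet_bubble T F x - facet_bubble T F p\<bar> \<le> real CARD('n) * (G * norm (x - p))"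
proof -
  have b: "norm (bary T v y) \<le> 1" if "y \<in> F" for v y
    using that F_subset bary_nonneg[of y v] bary_le_1[of y v] by auto
  have "norm ((\<Prod>v\<in>vertices F. bary T v x) - (\<Prod>v\<in>vertices F. bary T v p))
      \<le> (\<Sum>v\<in>vertices F. norm (bary T v x - bary T v p))"
    by (rule norm_prod_diff) (use b x in auto)
  also have "\<dots> \<le> (\<Sum>v\<in>vertices F. G * norm (x - p))"
  proof (rule sum_mono)
    fix v assume "v \<in> vertices F"
    then have "norm (bary_grad v) \<le> G" using G vertices_F by blast
    then show "norm (bary T v x - bary T v p) \<le> G * norm (x - p)"
      unfolding bary_diff real_norm_def
      using Cauchy_Schwarz_ineq2[of "bary_grad v" "x - p"] mult_right_mono[OF _ norm_ge_zero[of "x - p"]] order_trans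
      by blast
  qed
  also have "\<dots> = real CARD('n) * (G * norm (x - p))" using card_vertices_F by simp
  finally show ?thesis by (simp add: facet_bubble_eq)
qed

end

text \<open>The factor \<open>s\<close> is the sign of the jump at \<open>p\<close>. The integrand
  is nonnegative throughout, and over the disc of half the radius the bump is at least a fixed
  constant and \<open>s * J\<close> at least \<open>m\<close>.\<close>

lemma hyperplane_integral_ge:
  fixes J :: "real ^ 'n \<Rightarrow> real"
  assumes J: "continuous_on UNIV J" and n: "norm n = 1" and r: "0 < r" "r \<le> 1" "0 < \<delta>"
    and m: "0 \<le> m" "\<And>x. x \<in> cball p r \<Longrightarrow> (x - p) \<bullet> n = 0 \<Longrightarrow> m \<le> s * J x"
  shows "exp_bump 0 (3/4) * exp_bump 0 1 * m * (unit_ball_vol CARD('n) / 4 ^ CARD('n) * (r / 2) ^ (CARD('n) - 1))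
    \<le> s * hyperplane_integral p n (\<lambda>x. layer_bump p n r \<delta> x * J x)"
proof -
  let ?\<pi> = "\<lambda>x. x - ((x - p) \<bullet> n) *\<^sub>R n"
  let ?l = "\<lambda>x. indicator {x. 0 < (x - p) \<bullet> n \<and> (x - p) \<bullet> n \<le> 1} x :: real"
  let ?B = "{x. 0 < (x - p) \<bullet> n \<and> (x - p) \<bullet> n \<le> 1 \<and> norm (x - ((x - p) \<bullet> n) *\<^sub>R n - p) \<le> r / 2}"
  let ?c = "exp_bump 0 (3/4) * exp_bump 0 1"
  define \<phi> where "\<phi> = layer_bump p n r \<delta>"
  have nn: "n \<bullet> n = 1" using n by (simp add: norm_eq_1)
  have \<pi>0: "(?\<pi> x - p) \<bullet> n = 0" for x by (simp add: inner_diff_left nn)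
  have cont: "continuous_on UNIV (\<lambda>x. \<phi> x * J x)"
    unfolding \<phi>_def by (intro continuous_on_mult Ck_imp_continuous[OF layer_bump_Ck] J)
  have supp: "\<phi> x * J x = 0" if "x \<notin> cball p r" for x
    using layer_bump_outside[of r \<delta> x p n] r that by (simp add: \<phi>_def)
  have int: "integrable lborel (\<lambda>x. ?l x * (\<phi> (?\<pi> x) * J (?\<pi> x)))"
    by (rule hyperplane_integrable[where q = p and R = r, OF cont supp n])
  have Bs[measurable]: "?B \<in> sets borel" by measurable
  have "?B \<subseteq> cball p (r / 2 + 1)"
  proof
    fix x assume "x \<in> ?B"
    then show "x \<in> cball p (r / 2 + 1)"
      using hyperplane_projection_dist[OF n, of x p p "r / 2" 1] by (auto simp: dist_norm norm_minus_commute)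
  qed
  then have "bounded ?B" using bounded_cball bounded_subset by blast
  then have Bf: "emeasure lborel ?B < \<infinity>" by (rule emeasure_bounded_finite)
  have "?c * m * measure lebesgue ?B = (LINT x|lborel. ?c * m * indicator ?B x)" using Bs by simp
  also have "\<dots> \<le> (LINT x|lborel. s * (?l x * (\<phi> (?\<pi> x) * J (?\<pi> x))))"
  proof (rule integral_mono)
    show "integrable lborel (\<lambda>x. ?c * m * indicator ?B x)"
      using Bf Bs by (intro integrable_mult_right integrable_real_indicator) auto
    show "integrable lborel (\<lambda>x. s * (?l x * (\<phi> (?\<pi> x) * J (?\<pi> x))))"
      using int by (rule integrable_mult_right)
    fix x
    have nonneg: "0 \<le> s * (\<phi> (?\<pi> x) * J (?\<pi> x))"
    proof (cases "?\<pi> x \<in> cball p r")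
      case True
      then have "0 \<le> s * J (?\<pi> x)" using m(1) m(2)[OF True \<pi>0] by linarith
      with layer_bump_bounds(1) have "0 \<le> \<phi> (?\<pi> x) * (s * J (?\<pi> x))"
        unfolding \<phi>_def by (rule mult_nonneg_nonneg)
      then show ?thesis by (simp add: mult.left_commute)
    next
      case False
      show ?thesis unfolding supp[OF False] by simp
    qed
    show "?c * m * indicator ?B x \<le> s * (?l x * (\<phi> (?\<pi> x) * J (?\<pi> x)))"
    proof (cases "x \<in> ?B")
      case True
      then have near: "norm (?\<pi> x - p) \<le> r / 2" by simp
      then have "?\<pi> x \<in> cball p r" using r by (simp add: dist_norm norm_minus_commute)
      from m(2)[OF this \<pi>0] have "m \<le> s * J (?\<pi> x)" .
      moreover have "?c \<le> \<phi> (?\<pi> x)" unfolding \<phi>_def by (rule layer_bump_ge[OF r(1) near \<pi>0])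
      ultimately have "?c * m \<le> \<phi> (?\<pi> x) * (s * J (?\<pi> x))"
        using m(1) layer_bump_bounds(1)[of p n r \<delta>] unfolding \<phi>_def by (intro mult_mono) auto
      then show ?thesis using True by (simp add: mult.left_commute)
    next
      case False
      have "0 \<le> ?l x * (s * (\<phi> (?\<pi> x) * J (?\<pi> x)))" by (rule mult_nonneg_nonneg[OF _ nonneg]) simp
      then show ?thesis using False by (simp add: mult.left_commute)
    qed
  qed
  also have "\<dots> = s * hyperplane_integral p n (\<lambda>x. \<phi> x * J x)"
    unfolding hyperplane_integral_def by simp
  finally have "?c * m * measure lebesgue ?B \<le> s * hyperplane_integral p n (\<lambda>x. \<phi> x * J x)" .
  moreover have "?c * m * (unit_ball_vol CARD('n) / 4 ^ CARD('n) * (r / 2) ^ (CARD('n) - 1)) \<le> ?c * m * measure lebesgue ?B"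
    using r m(1) by (intro mult_left_mono prism_disc_measure_ge n) auto
  ultimately show ?thesis unfolding \<phi>_def by linarith
qed

text \<open>The supremum times the volume of the prism. Describing the prism as a layer intersected
  with the preimage of \<open>A\<close> under the projection gives its measurability.\<close>

lemma flat_surface_integral_le:
  fixes A :: "(real ^ 'n) set"
  assumes n: "norm n = 1" and A: "A \<in> sets borel" and flat: "\<And>x y. x \<in> A \<Longrightarrow> y \<in> A \<Longrightarrow> (y - x) \<bullet> n = 0"
    and h: "0 < h" "h \<le> D" "\<And>x y. x \<in> A \<Longrightarrow> y \<in> A \<Longrightarrow> dist x y \<le> h"
    and B: "0 \<le> B" "\<And>x. x \<in> A \<Longrightarrow> g x \<le> B"
  shows "flat_surface_integral n A g \<le> B * ((2 + D) * 2 ^ CARD('n) * unit_ball_vol CARD('n) * h ^ (CARD('n) - 1))"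
proof (cases "A = {}")
  case True
  have "flat_surface_integral n A g = 0"
    using True by (simp add: flat_surface_integral_def integral_restrict_space)
  then show ?thesis using B(1) h by simp
next
  case False
  define p where "p = (SOME p. p \<in> A)"
  have p: "p \<in> A" unfolding p_def using False by (simp add: some_in_eq)
  have nn: "n \<bullet> n = 1" using n by (simp add: norm_eq_1)
  let ?\<pi> = "\<lambda>x. x - ((x - p) \<bullet> n) *\<^sub>R n"
  let ?S = "{y + s *\<^sub>R n | y s. y \<in> A \<and> 0 \<le> s \<and> s \<le> 1}"
  have \<pi>: "((y + s *\<^sub>R n) - p) \<bullet> n = s" "?\<pi> (y + s *\<^sub>R n) = y" if "y \<in> A" for y s
    using flat[OF p that] by (simp_all add: inner_diff_left inner_add_left nn algebra_simps)
  have S: "?S = {x. 0 \<le> (x - p) \<bullet> n} \<inter> {x. (x - p) \<bullet> n \<le> 1} \<inter> (?\<pi> -` A \<inter> UNIV)"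
  proof (intro equalityI subsetI)
    fix x assume "x \<in> ?S"
    then obtain y s where "x = y + s *\<^sub>R n" "y \<in> A" "0 \<le> s" "s \<le> 1" by blast
    then show "x \<in> {x. 0 \<le> (x - p) \<bullet> n} \<inter> {x. (x - p) \<bullet> n \<le> 1} \<inter> (?\<pi> -` A \<inter> UNIV)"
      using \<pi>[of y s] by simp
  next
    fix x assume x: "x \<in> {x. 0 \<le> (x - p) \<bullet> n} \<inter> {x. (x - p) \<bullet> n \<le> 1} \<inter> (?\<pi> -` A \<inter> UNIV)"
    have "x = ?\<pi> x + ((x - p) \<bullet> n) *\<^sub>R n" by simp
    then show "x \<in> ?S" using x by blast
  qed
  have "?\<pi> \<in> borel_measurable borel" by measurable
  then have "?\<pi> -` A \<inter> UNIV \<in> sets borel" using measurable_sets[of ?\<pi> borel borel A] A by simp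
  then have Sb: "?S \<in> sets borel" unfolding S by measurable
  then have Sl: "?S \<in> sets lebesgue" by simp
  have sub: "?S \<subseteq> {x. 0 \<le> (x - p) \<bullet> n \<and> (x - p) \<bullet> n \<le> 1 \<and> norm (?\<pi> x - p) \<le> h}"
  proof
    fix x assume "x \<in> ?S"
    then have x: "0 \<le> (x - p) \<bullet> n" "(x - p) \<bullet> n \<le> 1" "?\<pi> x \<in> A" unfolding S by auto
    have "norm (?\<pi> x - p) \<le> h" using h(3)[OF x(3) p] by (simp only: dist_norm)
    with x show "x \<in> {x. 0 \<le> (x - p) \<bullet> n \<and> (x - p) \<bullet> n \<le> 1 \<and> norm (?\<pi> x - p) \<le> h}"
      by blast
  qed
  have bdd: "?S \<subseteq> cball p (h + 1)"
  proof
    fix x assume "x \<in> ?S"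
    from subsetD[OF sub this] have x: "norm (?\<pi> x - p) \<le> h" "\<bar>(x - p) \<bullet> n\<bar> \<le> 1" by simp_all
    then have "dist (?\<pi> x) p \<le> h" by (simp only: dist_norm)
    then have "?\<pi> x \<in> cball p h" by (metis dist_commute mem_cball)
    then show "x \<in> cball p (h + 1)" using hyperplane_projection_dist[OF n _ x(2)] by blast
  qed
  then have "bounded ?S" using bounded_cball bounded_subset by blast
  then have Sm: "?S \<in> lmeasurable" using Sl by (simp add: bounded_set_imp_lmeasurable)
  have "flat_surface_integral n A g = (LINT x|lebesgue_on ?S. g (?\<pi> x))"
    by (simp add: flat_surface_integral_def Let_def p_def)
  also have "\<dots> = (LINT x|lebesgue. indicator ?S x * g (?\<pi> x))"
    using Sl by (simp add: integral_restrict_space)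
  also have "\<dots> \<le> (LINT x|lebesgue. B * indicator ?S x)"
  \<comment> \<open>This comparison has no integrability condition on the left: a non-integrable
    integrand has integral 0 by default, which is below the nonnegative right-hand side.\<close>
  proof (rule integral_mono')
    show "integrable lebesgue (\<lambda>x. B * indicator ?S x)"
      using Sm by (intro integrable_mult_right integrable_real_indicator) (auto simp: fmeasurable_def)
    show "indicator ?S x * g (?\<pi> x) \<le> B * indicator ?S x" for x
      using B(2)[of "?\<pi> x"] unfolding S by (auto simp: indicator_def)
  qed (use B(1) in auto)
  also have "\<dots> = B * measure lebesgue ?S" using Sm by (simp add: fmeasurable_def)
  also have "\<dots> \<le> B * ((2 + D) * 2 ^ CARD('n) * unit_ball_vol CARD('n) * h ^ (CARD('n) - 1))"
    by (intro mult_left_mono prism_measure_le[OF n h(1,2) Sl sub] B(1))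
  finally show ?thesis .
qed


section \<open>The trace functional tested element by element with smooth functions\<close>

definition tested :: "(real ^ 'n \<Rightarrow> real) \<Rightarrow> (real ^ 'n \<Rightarrow> real ^ 'n) \<Rightarrow> (real ^ 'n) set \<Rightarrow> real" where
  "tested \<phi> \<tau> K = l2_inner K (weak_div K \<tau>) \<phi> + l2_inner K \<tau> (grad \<phi>)"

lemma mesh_interior_subset:
  assumes "lipschitz_domain \<Omega>" "conforming_mesh \<Omega> \<T>" "K \<in> \<T>"
  shows "interior K \<subseteq> \<Omega>"
proof -
  have "K \<subseteq> closure \<Omega>" using mesh_Union[OF assms(2)] assms(3) by blast
  then show ?thesis using interior_mono lipschitz_domain_interior_closure[OF assms(1)] by blast
qed

text \<open>Replaces the chosen weak gradient by the classical one. The two agree almost everywhere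
  in the open domain, and the part of a closed element outside the domain lies in its negligible
  boundary.\<close>

lemma tr_grad_test_function:
  assumes lip: "lipschitz_domain \<Omega>" and mesh: "conforming_mesh \<Omega> \<T>"
    and \<tau>: "\<tau> \<in> Hdiv_mesh \<Omega> \<T>" and \<phi>: "\<phi> \<in> test_functions \<Omega>"
  shows "tr_grad \<Omega> \<T> \<phi> \<tau> = (\<Sum>K\<in>\<T>. tested \<phi> \<tau> K)"
proof -
  have op: "open \<Omega>" using lip by (simp add: lipschitz_domain_def)
  then have \<Omega>: "\<Omega> \<in> sets lebesgue" by auto
  have \<phi>': "\<phi> \<in> test_functions (interior \<Omega>)" using \<phi> op by (simp add: interior_open)
  have "l2_inner K \<tau> (weak_grad \<Omega> \<phi>) = l2_inner K \<tau> (grad \<phi>)" if K: "K \<in> \<T>" for K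
  proof -
    interpret full_simplex K by (rule mesh_simplex[OF mesh K])
    have sub: "interior K \<subseteq> \<Omega>" by (rule mesh_interior_subset[OF lip mesh K])
    have I: "interior K \<in> sets lebesgue" by auto
    have L: "weak_grad \<Omega> \<phi> \<in> L2 K"
      by (rule L2_null_extend[OF L2_subset[OF test_function_weak_grad(2)[OF \<phi>' \<Omega>] \<Omega> I sub] I T_sets interior_subset negligible_boundary])
    have "AE x in lebesgue. x \<notin> K - interior K"
      using AE_not_in[of "K - interior K" lebesgue] negligible_boundary by (simp add: negligible_iff_null_sets)
    then have "AE x in lebesgue. x \<in> K \<longrightarrow> weak_grad \<Omega> \<phi> x = grad \<phi> x"
      using test_function_weak_grad(3)[OF \<phi>' \<Omega>] by eventually_elim (use sub op in \<open>auto simp: interior_open\<close>)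
    moreover have "\<tau> \<in> L2 K" using \<tau> K by (auto simp: Hdiv_mesh_def Hdiv_def)
    ultimately have "l2_inner K (weak_grad \<Omega> \<phi>) \<tau> = l2_inner K (grad \<phi>) \<tau>"
      by (intro l2_inner_cong_AE L test_functions_L2(2)[OF \<phi> T_sets] T_sets)
    then show ?thesis by (simp add: l2_inner_commute)
  qed
  then show ?thesis using \<tau> by (simp add: tr_grad_def tested_def)
qed

lemma tested_diff:
  assumes K: "full_simplex K" and \<sigma>: "\<sigma> \<in> Hdiv K" and \<tau>: "\<tau> \<in> Hdiv K" and \<phi>: "\<phi> \<in> test_functions \<Omega>"
  shows "tested \<phi> (\<lambda>x. \<sigma> x - \<tau> x) K = tested \<phi> \<sigma> K - tested \<phi> \<tau> K"
proof -
  interpret full_simplex K by fact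
  note H = Hdiv_diff[OF T_sets \<sigma> \<tau>]
  have L: "\<sigma> \<in> L2 K" "\<tau> \<in> L2 K" using \<sigma> \<tau> by (auto simp: Hdiv_def)
  note t = test_functions_L2[OF \<phi> T_sets]
  note w = weak_div_works(1)[OF \<sigma>] weak_div_works(1)[OF \<tau>]
  have "AE x in lebesgue. x \<notin> K - interior K"
    using AE_not_in[of "K - interior K" lebesgue] negligible_boundary by (simp add: negligible_iff_null_sets)
  then have "AE x in lebesgue. x \<in> K \<longrightarrow> weak_div K (\<lambda>x. \<sigma> x - \<tau> x) x = weak_div K \<sigma> x - weak_div K \<tau> x"
    using H(2) by eventually_elim auto
  then have "l2_inner K (weak_div K (\<lambda>x. \<sigma> x - \<tau> x)) \<phi> = l2_inner K (\<lambda>x. weak_div K \<sigma> x - weak_div K \<tau> x) \<phi>"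
    by (intro l2_inner_cong_AE weak_div_works(1)[OF H(1)] L2_diff w t T_sets)
  then show ?thesis
    by (simp add: tested_def l2_inner_diff L t w)
qed

lemma tested_eq_0:
  assumes K: "full_simplex K" and \<tau>: "\<tau> \<in> Hdiv K" and \<phi>: "\<phi> \<in> test_functions \<Omega>"
    and zero: "\<And>x. x \<in> interior K \<Longrightarrow> \<phi> x = 0"
  shows "tested \<phi> \<tau> K = 0"
proof -
  interpret full_simplex K by fact
  have I: "interior K \<in> sets lebesgue" by auto
  have L: "\<tau> \<in> L2 K" using \<tau> by (auto simp: Hdiv_def)
  note t = test_functions_L2[OF \<phi> T_sets]
  have g: "grad \<phi> x = 0" if "x \<in> interior K" for x
    using grad_cong_open[of "interior K" x \<phi> "\<lambda>_. 0"] zero that by simp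
  have "l2_inner (interior K) (weak_div K \<tau>) \<phi> = 0" "l2_inner (interior K) \<tau> (grad \<phi>) = 0"
    unfolding l2_inner_set[OF I] using zero g by (auto simp: indicator_def intro!: integral_eq_zero_AE AE_I2)
  then show ?thesis
    unfolding tested_def
    using l2_inner_null_extend[OF weak_div_works(1)[OF \<tau>] t(1) I T_sets interior_subset negligible_boundary]
      l2_inner_null_extend[OF L t(2) I T_sets interior_subset negligible_boundary] by simp
qed

text \<open>On the element, up to a null set, the field and its chosen weak divergence may be
  replaced by the smooth extension and its classical divergence.\<close>

lemma (in simplex_facet) tested_facet:
  fixes \<rho> :: "real ^ 'n \<Rightarrow> real ^ 'n"
  assumes \<rho>: "\<And>i. Ck (Suc 0) (\<lambda>x. \<rho> x $ i)" and \<tau>: "\<tau> \<in> Hdiv T" "\<And>x. x \<in> interior T \<Longrightarrow> \<tau> x = \<rho> x"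
    and \<phi>: "\<phi> \<in> test_functions \<Omega>" and supp: "\<And>x. x \<notin> cball p r \<Longrightarrow> \<phi> x = 0" and p: "p \<in> F"
    and near: "\<And>x y. x \<in> cball p r \<Longrightarrow> y \<in> vertices F \<Longrightarrow> 0 \<le> bary T y x"
  shows "tested \<phi> \<tau> T = hyperplane_integral p n (\<lambda>x. \<phi> x * (\<rho> x \<bullet> n))"
proof -
  have bT: "bounded T" using compact_T compact_imp_bounded by blast
  have L: "\<tau> \<in> L2 T" using \<tau> by (auto simp: Hdiv_def)
  note t = test_functions_L2[OF \<phi> T_sets]
  have ae: "AE x in lebesgue. x \<notin> T - interior T"
    using AE_not_in[of "T - interior T" lebesgue] negligible_boundary by (simp add: negligible_iff_null_sets)
  have "AE x in lebesgue. x \<in> interior T \<longrightarrow> weak_div T \<tau> x = divergence \<rho> x"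
    by (rule weak_div_classical[OF \<rho> T_sets bT _ \<tau>(1)]) (rule \<tau>(2))
  then have "AE x in lebesgue. x \<in> T \<longrightarrow> weak_div T \<tau> x = divergence \<rho> x"
    using ae by eventually_elim auto
  then have 1: "l2_inner T (weak_div T \<tau>) \<phi> = l2_inner T (divergence \<rho>) \<phi>"
    by (intro l2_inner_cong_AE weak_div_works(1)[OF \<tau>(1)] t T_sets
        L2_continuous_bounded[OF divergence_continuous[OF \<rho>] T_sets bT])
  have "AE x in lebesgue. x \<in> T \<longrightarrow> \<tau> x = \<rho> x"
    using ae by eventually_elim (use \<tau>(2) in auto)
  then have 2: "l2_inner T \<tau> (grad \<phi>) = l2_inner T \<rho> (grad \<phi>)"
    by (intro l2_inner_cong_AE L t T_sets L2_continuous_bounded[OF Ck_vec_continuous[OF \<rho>] T_sets bT])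
  show ?thesis
    unfolding tested_def 1 2
    by (rule divergence_theorem_near_facet[OF \<rho> test_functions_Ck[OF \<phi>] supp p near])
qed

lemma (in full_simplex) trace_from_eq:
  fixes \<rho> :: "real ^ 'n \<Rightarrow> real ^ 'n"
  assumes "continuous_on UNIV \<rho>" "\<And>x. x \<in> interior T \<Longrightarrow> \<tau> x = \<rho> x" "x \<in> T"
  shows "trace_from T \<tau> x = \<rho> x"
proof -
  have "(\<rho> \<longlongrightarrow> \<rho> x) (at x within interior T)"
    using assms(1) by (meson UNIV_I continuous_on_def subset_UNIV tendsto_within_subset)
  then have "(\<tau> \<longlongrightarrow> \<rho> x) (at x within interior T)"
    by (rule Lim_transform_within[where d = 1]) (use assms(2) in auto)
  then show ?thesis
    unfolding trace_from_def using at_within_interior_nontrivial[OF assms(3)] by (intro tendsto_Lim)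
qed

text \<open>The supporting ball meets only \<open>T\<close> and \<open>T'\<close>, so the sum over
  all elements reduces to two. The contribution of \<open>\<sigma>\<close> cancels, which leaves
  minus the error, and the divergence theorem on both sides turns the contribution of
  \<open>\<tau>\<close> into the jump.\<close>

lemma jump_identity:
  fixes \<rho> \<rho>' :: "real ^ 'n \<Rightarrow> real ^ 'n"
  assumes lip: "lipschitz_domain \<Omega>" and mesh: "conforming_mesh \<Omega> \<T>"
    and T: "T \<in> \<T>" "F facet_of T" and T': "T' \<in> \<T>" "F facet_of T'" "T' \<noteq> T"
    and \<sigma>: "\<sigma> \<in> Hdiv_mesh \<Omega> \<T>" "tr_grad \<Omega> \<T> \<phi> \<sigma> = 0" and \<tau>: "\<tau> \<in> Hdiv_mesh \<Omega> \<T>"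
    and \<rho>: "\<And>i. Ck (Suc 0) (\<lambda>x. \<rho> x $ i)" "\<And>x. x \<in> interior T \<Longrightarrow> \<tau> x = \<rho> x"
    and \<rho>': "\<And>i. Ck (Suc 0) (\<lambda>x. \<rho>' x $ i)" "\<And>x. x \<in> interior T' \<Longrightarrow> \<tau> x = \<rho>' x"
    and \<phi>: "\<phi> \<in> test_functions \<Omega>" and supp: "\<And>x. x \<notin> cball p r \<Longrightarrow> \<phi> x = 0" and p: "p \<in> F"
    and near: "\<And>x y. x \<in> cball p r \<Longrightarrow> y \<in> vertices F \<Longrightarrow> 0 \<le> bary T y x"
    and near': "\<And>x y. x \<in> cball p r \<Longrightarrow> y \<in> vertices F \<Longrightarrow> 0 \<le> bary T' y x"
  shows "hyperplane_integral p (outer_normal T F) (\<lambda>x. \<phi> x * (\<rho> x \<bullet> outer_normal T F + \<rho>' x \<bullet> outer_normal T' F))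
    = - (tested \<phi> (\<lambda>x. \<sigma> x - \<tau> x) T + tested \<phi> (\<lambda>x. \<sigma> x - \<tau> x) T')"
proof -
  interpret A: simplex_facet T F by (rule simplex_facetI[OF mesh T])
  interpret B: simplex_facet T' F by (rule simplex_facetI[OF mesh T'(1,2)])
  have opp: "B.n = - A.n" by (rule mesh_facet_pair(1)[OF mesh T T'])
  have op: "open \<Omega>" using lip by (simp add: lipschitz_domain_def)
  then have \<Omega>: "\<Omega> \<in> sets lebesgue" by auto
  let ?e = "\<lambda>x. \<sigma> x - \<tau> x"
  have e: "?e \<in> Hdiv_mesh \<Omega> \<T>" by (rule Hdiv_mesh_diff[OF mesh \<Omega> \<sigma>(1) \<tau>])
  have H: "\<sigma> \<in> Hdiv K" "\<tau> \<in> Hdiv K" "?e \<in> Hdiv K" if "K \<in> \<T>" for K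
    using that \<sigma> \<tau> e by (auto simp: Hdiv_mesh_def)
  have s: "full_simplex K" if "K \<in> \<T>" for K by (rule mesh_simplex[OF mesh that])
  \<comment> \<open>Near \<open>p\<close> each element is one side of the common hyperplane, and the
    outer normals are opposite.\<close>
  have sub: "cball p r \<subseteq> T \<union> T'"
  proof
    fix x assume x: "x \<in> cball p r"
    show "x \<in> T \<union> T'"
      using A.mem_T_iff_halfspace[OF p near[OF x]] B.mem_T_iff_halfspace[OF p near'[OF x]] opp by auto
  qed
  have far: "\<phi> x = 0" if K: "K \<in> \<T> - {T, T'}" and x: "x \<in> interior K" for K x
  proof -
    have "x \<notin> T" "x \<notin> T'"
      using mesh_interior_unique[OF mesh _ _ x] K T(1) T'(1) by auto
    then show ?thesis using sub supp by blast
  qed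
  have split: "(\<Sum>K\<in>\<T>. tested \<phi> \<upsilon> K) = tested \<phi> \<upsilon> T + tested \<phi> \<upsilon> T'" if "\<And>K. K \<in> \<T> \<Longrightarrow> \<upsilon> \<in> Hdiv K" for \<upsilon>
  proof -
    have "(\<Sum>K\<in>\<T>. tested \<phi> \<upsilon> K) = (\<Sum>K\<in>{T, T'}. tested \<phi> \<upsilon> K)"
    proof (rule sum.mono_neutral_right[OF mesh_finite[OF mesh]])
      show "\<forall>K\<in>\<T> - {T, T'}. tested \<phi> \<upsilon> K = 0"
      proof
        fix K assume K: "K \<in> \<T> - {T, T'}"
        then have K': "K \<in> \<T>" by blast
        show "tested \<phi> \<upsilon> K = 0"
          by (rule tested_eq_0[OF s[OF K'] that[OF K'] \<phi>]) (rule far[OF K])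
      qed
    qed (use T T' in auto)
    then show ?thesis using T'(3) by simp
  qed
  have "(\<Sum>K\<in>\<T>. tested \<phi> ?e K) = (\<Sum>K\<in>\<T>. tested \<phi> \<sigma> K) - (\<Sum>K\<in>\<T>. tested \<phi> \<tau> K)"
    unfolding sum_subtractf[symmetric] by (intro sum.cong refl tested_diff[OF s H(1,2) \<phi>])
  also have "(\<Sum>K\<in>\<T>. tested \<phi> \<sigma> K) = 0" using tr_grad_test_function[OF lip mesh \<sigma>(1) \<phi>] \<sigma>(2) by simp
  finally have eq: "tested \<phi> \<tau> T + tested \<phi> \<tau> T' = - (tested \<phi> ?e T + tested \<phi> ?e T')"
    using split[OF H(3)] split[OF H(2)] by simp
  have c: "continuous_on UNIV (\<lambda>x. \<phi> x * (\<upsilon> x \<bullet> m))" if "\<And>i. Ck (Suc 0) (\<lambda>x. \<upsilon> x $ i)" for \<upsilon> :: "real ^ 'n \<Rightarrow> real ^ 'n" and m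
    by (intro continuous_on_mult continuous_on_inner test_functions_continuous[OF \<phi>] Ck_vec_continuous[OF that] continuous_on_const)
  have "tested \<phi> \<tau> T + tested \<phi> \<tau> T'
    = hyperplane_integral p A.n (\<lambda>x. \<phi> x * (\<rho> x \<bullet> A.n)) + hyperplane_integral p B.n (\<lambda>x. \<phi> x * (\<rho>' x \<bullet> B.n))"
    using A.tested_facet[OF \<rho>(1) H(2)[OF T(1)] \<rho>(2) \<phi> supp p near]
      B.tested_facet[OF \<rho>'(1) H(2)[OF T'(1)] \<rho>'(2) \<phi> supp p near'] by simp
  \<comment> \<open>Only the layer changes sides. The integrand keeps \<open>B.n\<close>, because
    the jump is the sum of the two outer normal components.\<close>
  also have "hyperplane_integral p B.n (\<lambda>x. \<phi> x * (\<rho>' x \<bullet> B.n)) = hyperplane_integral p A.n (\<lambda>x. \<phi> x * (\<rho>' x \<bullet> B.n))"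
    by (subst (1) opp) (rule hyperplane_integral_minus_normal[OF c[OF \<rho>'(1)] A.norm_n])
  also have "hyperplane_integral p A.n (\<lambda>x. \<phi> x * (\<rho> x \<bullet> A.n)) + hyperplane_integral p A.n (\<lambda>x. \<phi> x * (\<rho>' x \<bullet> B.n))
    = hyperplane_integral p A.n (\<lambda>x. \<phi> x * (\<rho> x \<bullet> A.n + \<rho>' x \<bullet> B.n))"
    unfolding hyperplane_integral_def
    using hyperplane_integrable[where q = p and R = r and p = p, OF c[OF \<rho>(1)] _ A.norm_n, of A.n]
      hyperplane_integrable[where q = p and R = r and p = p, OF c[OF \<rho>'(1)] _ A.norm_n, of B.n] supp
    by (subst Bochner_Integration.integral_add[symmetric]) (auto simp: algebra_simps)
  finally show ?thesis unfolding eq by simp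
qed

section \<open>Bound of the normal jump\<close>

text \<open>Squaring the tested inequality and inserting the bounds of the two bump norms leaves
  \<open>a\<close> with weight \<open>\<delta>\<^sup>2\<close>. The constant is
  \<open>512 = 8 * 64\<close>, with 8 from the squares and 64 from the gradient bound
  \<open>8 / \<delta>\<close>.\<close>

lemma absorb_sqrt_bounds:
  fixes k M Y \<delta> K :: real
  assumes le: "k * M * Y \<le> 2 * (a * u + b * v)"
    and pos: "0 < k" "0 \<le> M" "0 < Y" "0 < \<delta>" "0 \<le> K" "0 \<le> a" "0 \<le> b" "0 \<le> u" "0 \<le> v"
    and u: "u\<^sup>2 \<le> K * Y * \<delta>" and v: "v\<^sup>2 \<le> (8 / \<delta>)\<^sup>2 * (K * Y * \<delta>)"
  shows "M\<^sup>2 * Y * \<delta> \<le> 512 * K / k\<^sup>2 * (a\<^sup>2 * \<delta>\<^sup>2 + b\<^sup>2)"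
proof -
  have "(k * M * Y)\<^sup>2 \<le> (2 * (a * u + b * v))\<^sup>2"
    using le pos by (intro power_mono) auto
  also have "\<dots> = 4 * (a * u + b * v)\<^sup>2" by (simp only: power_mult_distrib) simp
  also have "\<dots> \<le> 4 * (2 * (a\<^sup>2 * u\<^sup>2) + 2 * (b\<^sup>2 * v\<^sup>2))"
    using norm_add_squared_le[of "a * u" "b * v"] by (simp add: power_mult_distrib)
  also have "\<dots> \<le> 4 * (2 * (a\<^sup>2 * (K * Y * \<delta>)) + 2 * (b\<^sup>2 * ((8 / \<delta>)\<^sup>2 * (K * Y * \<delta>))))"
    using u v by (intro mult_left_mono add_mono) auto
  also have "\<dots> = 8 * K * Y / \<delta> * (a\<^sup>2 * \<delta>\<^sup>2 + 64 * b\<^sup>2)"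
    using pos by (simp add: field_simps power2_eq_square)
  also have "\<dots> \<le> 8 * K * Y / \<delta> * (64 * (a\<^sup>2 * \<delta>\<^sup>2 + b\<^sup>2))"
    using pos by (intro mult_left_mono) auto
  finally have "(k * M * Y)\<^sup>2 * (\<delta> / (k\<^sup>2 * Y)) \<le> (8 * K * Y / \<delta> * (64 * (a\<^sup>2 * \<delta>\<^sup>2 + b\<^sup>2))) * (\<delta> / (k\<^sup>2 * Y))"
    using pos by (intro mult_right_mono) auto
  moreover have "(k * M * Y)\<^sup>2 * (\<delta> / (k\<^sup>2 * Y)) = M\<^sup>2 * Y * \<delta>"
    using pos by (simp add: power_mult_distrib power2_eq_square)
  moreover have "(8 * K * Y / \<delta> * (64 * (a\<^sup>2 * \<delta>\<^sup>2 + b\<^sup>2))) * (\<delta> / (k\<^sup>2 * Y)) = 512 * K / k\<^sup>2 * (a\<^sup>2 * \<delta>\<^sup>2 + b\<^sup>2)"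
    using pos by simp
  ultimately show ?thesis by simp
qed

text \<open>In dimension at least 2 the facet has two distinct vertices. Their distance is at most
  the diameter of \<open>T'\<close>, and a coordinate of \<open>T\<close> falls from one to zero
  between them, so the distance is at least \<open>diameter T / G\<close>.\<close>

lemma (in simplex_facet) diameter_le_neighbour:
  assumes d: "2 \<le> CARD('n)" and G: "\<And>v. v \<in> vertices T \<Longrightarrow> norm (bary_grad v) * diameter T \<le> G"
    and T': "full_simplex T'" "F \<subseteq> T'"
  shows "diameter T \<le> G * diameter T'"
proof -
  interpret B: full_simplex T' by fact
  obtain v w where v: "v \<in> vertices F" "w \<in> vertices F" "v \<noteq> w"
    using card_vertices_F d finite_vertices_F
    by (metis card_le_Suc0_iff_eq not_less_eq_eq numeral_2_eq_2)
  have vT: "v \<in> vertices T" "w \<in> vertices T" using v vertices_F by auto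
  have "vertices F \<subseteq> F" unfolding vertices_F by (subst F_hull) (rule hull_subset)
  then have "dist v w \<le> diameter T'" using v T'(2) by (intro B.dist_le_diameter) auto
  have "1 = bary T v v - bary T v w" using vT v(3) by (simp add: bary_vertex)
  also have "\<dots> = bary_grad v \<bullet> (v - w)" by (rule bary_diff)
  also have "\<dots> \<le> norm (bary_grad v) * norm (v - w)" by (rule norm_cauchy_schwarz)
  also have "\<dots> \<le> norm (bary_grad v) * diameter T'"
    using \<open>dist v w \<le> diameter T'\<close> by (intro mult_left_mono) (auto simp: dist_norm)
  finally have "1 * diameter T \<le> norm (bary_grad v) * diameter T' * diameter T"
    using diameter_pos by (intro mult_right_mono) auto
  also have "\<dots> = (norm (bary_grad v) * diameter T) * diameter T'" by simp
  also have "\<dots> \<le> G * diameter T'"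
    using G[OF vT(1)] B.diameter_pos by (intro mult_right_mono) auto
  finally show ?thesis by simp
qed

lemma (in full_simplex) bary_ge_near:
  assumes "c \<le> bary T v p" "norm (bary_grad v) * r \<le> c" "x \<in> cball p r"
  shows "0 \<le> bary T v x"
proof -
  have "\<bar>bary_grad v \<bullet> (x - p)\<bar> \<le> norm (bary_grad v) * norm (x - p)" by (rule Cauchy_Schwarz_ineq2)
  also have "\<dots> \<le> norm (bary_grad v) * r"
    using assms(3) by (intro mult_left_mono) (auto simp: dist_norm norm_minus_commute)
  finally have "\<bar>bary T v x - bary T v p\<bar> \<le> norm (bary_grad v) * r" unfolding bary_diff .
  then show ?thesis using assms(1,2) by linarith
qed

lemma tested_le:
  assumes mesh: "conforming_mesh \<Omega> \<T>" and \<tau>: "\<tau> \<in> Hdiv_mesh \<Omega> \<T>" and op: "open \<Omega>"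
    and U: "open U" "U \<subseteq> \<Union>\<T>" "U \<subseteq> \<Omega>" and K: "K \<in> \<T>" "interior K \<subseteq> U"
    and \<phi>: "\<phi> \<in> test_functions \<Omega>"
  shows "\<bar>tested \<phi> \<tau> K\<bar> \<le> l2_norm U (pw_div \<T> \<tau>) * l2_norm UNIV \<phi> + l2_norm U \<tau> * l2_norm UNIV (grad \<phi>)"
proof -
  interpret full_simplex K by (rule mesh_simplex[OF mesh K(1)])
  have H: "\<tau> \<in> Hdiv K" using \<tau> K by (auto simp: Hdiv_mesh_def)
  then have L: "\<tau> \<in> L2 K" by (simp add: Hdiv_def)
  note t = test_functions_L2[OF \<phi> T_sets]
  note tU = test_functions_L2[OF \<phi>, of UNIV]
  have nU: "l2_norm K \<phi> \<le> l2_norm UNIV \<phi>" "l2_norm K (grad \<phi>) \<le> l2_norm UNIV (grad \<phi>)"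
    using tU by (auto intro!: l2_norm_subset T_sets)
  note n = local_norms_le[OF mesh \<tau> op U K]
  have "\<bar>tested \<phi> \<tau> K\<bar> \<le> \<bar>l2_inner K (weak_div K \<tau>) \<phi>\<bar> + \<bar>l2_inner K \<tau> (grad \<phi>)\<bar>"
    unfolding tested_def by (rule abs_triangle_ineq)
  also have "\<dots> \<le> l2_norm K (weak_div K \<tau>) * l2_norm K \<phi> + l2_norm K \<tau> * l2_norm K (grad \<phi>)"
    by (intro add_mono l2_Cauchy_Schwarz weak_div_works(1)[OF H] L t)
  also have "\<dots> \<le> l2_norm U (pw_div \<T> \<tau>) * l2_norm UNIV \<phi> + l2_norm U \<tau> * l2_norm UNIV (grad \<phi>)"
    by (intro add_mono mult_mono n nU) auto
  finally show ?thesis .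
qed

lemma patch_props:
  assumes lip: "lipschitz_domain \<Omega>" and mesh: "conforming_mesh \<Omega> \<T>"
  shows "open (patch \<T> T)" "patch \<T> T \<subseteq> \<Union>\<T>" "patch \<T> T \<subseteq> \<Omega>"
    "\<And>K. K \<in> \<T> \<Longrightarrow> T \<inter> K \<noteq> {} \<Longrightarrow> interior K \<subseteq> patch \<T> T"
proof -
  show "open (patch \<T> T)" by (simp add: patch_def)
  show sub: "patch \<T> T \<subseteq> \<Union>\<T>" unfolding patch_def using interior_subset by blast
  have "patch \<T> T \<subseteq> interior (closure \<Omega>)"
    unfolding patch_def using mesh_Union[OF mesh] by (intro interior_mono) blast
  then show "patch \<T> T \<subseteq> \<Omega>" using lipschitz_domain_interior_closure[OF lip] by simp
  show "interior K \<subseteq> patch \<T> T" if "K \<in> \<T>" "T \<inter> K \<noteq> {}" for K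
    unfolding patch_def using that by (intro interior_mono) blast
qed

text \<open>All constants are fixed before \<open>\<epsilon>\<close>, the domain and the mesh: they
  depend on the dimension, on \<open>\<kappa>\<close> and on the bound \<open>D\<close> of the
  element diameters.\<close>

lemma facet_jump_bound:
  fixes \<kappa> D :: real
  assumes d: "2 \<le> CARD('n)" and D: "1 \<le> D"
  obtains C where "0 < C" "\<And>\<epsilon> (\<Omega> :: (real ^ 'n) set) \<T> zT \<sigma> \<tau> T F.
    0 < \<epsilon> \<Longrightarrow> lipschitz_domain \<Omega> \<Longrightarrow> conforming_mesh \<Omega> \<T> \<Longrightarrow> shape_regular \<kappa> \<T> \<Longrightarrow>
    (\<And>K. K \<in> \<T> \<Longrightarrow> diameter K \<le> D) \<Longrightarrow> \<sigma> \<in> Hdiv_mesh \<Omega> \<T> \<Longrightarrow>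
    (\<And>\<phi>. \<phi> \<in> test_functions \<Omega> \<Longrightarrow> tr_grad \<Omega> \<T> \<phi> \<sigma> = 0) \<Longrightarrow>
    \<tau> \<in> Sigma_h \<epsilon> \<Omega> \<T> zT \<Longrightarrow> T \<in> \<T> \<Longrightarrow> F facet_of T \<Longrightarrow>
    min \<epsilon> (diameter T) * flat_surface_integral (outer_normal T F) (F - frontier \<Omega>) (\<lambda>x. (normal_jump \<T> F \<tau> x)\<^sup>2)
      \<le> C * ((l2_norm (patch \<T> T) (\<lambda>x. \<sigma> x - \<tau> x))\<^sup>2
        + \<epsilon>\<^sup>2 * (l2_norm (patch \<T> T) (pw_div \<T> (\<lambda>x. \<sigma> x - \<tau> x)))\<^sup>2)"
proof -
  let ?N = "CARD('n)"
  define \<omega> where "\<omega> = unit_ball_vol (real ?N)"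
  define q where "q = real ?N ^ ?N"
  \<comment> \<open>The bound of \<open>bary_grad_le\<close> for gradient times diameter, raised to
    at least 1 so that powers of it can be enlarged.\<close>
  define \<Lambda> where "\<Lambda> = max 1 (2 * 6 ^ ?N * \<omega> * \<kappa>)"
  \<comment> \<open>The ratio of the bump radius to \<open>h\<close>. Coordinates of both neighbours
    have gradients of at most \<open>\<Lambda>\<^sup>2 / h\<close>, so over a distance
    \<open>r\<close> they change by at most \<open>1 / (16 * real ?N * q)\<close>. This keeps the
    facet coordinates nonnegative in the doubled ball and lets the jump vary by at most half of its
    value at \<open>p\<close>. The factor \<open>D\<close> gives \<open>r \<le> 1\<close>.\<close>
  define c' where "c' = 1 / (16 * real ?N * q * \<Lambda>\<^sup>2 * D)"
  \<comment> \<open>Bounds the jump on all of \<open>F\<close>: \<open>\<bar>J p\<bar>\<close> plus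
    twice \<open>\<bar>b\<bar>\<close>, where
    \<open>\<bar>b\<bar> \<le> 8 * q * \<bar>J p\<bar>\<close>.\<close>
  define C1 where "C1 = 1 + 16 * q"
  define C4 where "C4 = (2 + D) * 2 ^ ?N * \<omega>"
  define K0 where "K0 = 2 * 3 ^ ?N * \<omega>"
  \<comment> \<open>What \<open>hyperplane_integral_ge\<close> leaves after
    \<open>\<bar>J p\<bar>\<close> and the power of \<open>r\<close> are split off; the single
    \<open>1/2\<close> is the share of the jump kept on the disc, the power of \<open>1 / 2\<close>
    comes from the halved radius.\<close>
  define k where "k = exp_bump 0 (3/4) * exp_bump 0 1 * (1/2) * (\<omega> / 4 ^ ?N * (1 / 2) ^ (?N - 1))"
  have N1: "1 \<le> real ?N" using d by simp
  have q1: "1 \<le> q" unfolding q_def using N1 by (rule one_le_power)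
  have \<Lambda>1: "1 \<le> \<Lambda>" by (simp add: \<Lambda>_def)
  have \<omega>0: "0 < \<omega>" by (simp add: \<omega>_def)
  have c'0: "0 < c'" using q1 \<Lambda>1 D N1 by (simp add: c'_def)
  have k0: "0 < k" unfolding k_def using \<omega>0 exp_bump_pos[of "3/4" 0] exp_bump_pos[of 1 0] by simp
  define C where "C = C1\<^sup>2 * C4 / c' ^ ?N * (512 * K0 / k\<^sup>2)"
  have C0: "0 < C"
    unfolding C_def C4_def K0_def C1_def using q1 D \<omega>0 c'0 k0 by (intro mult_pos_pos divide_pos_pos zero_less_power) auto
  have prods: "1 \<le> \<Lambda>\<^sup>2" using \<Lambda>1 by simp
  show ?thesis
  proof (rule that[OF C0])
    fix \<epsilon> :: real and \<Omega> :: "(real ^ 'n) set" and \<T> zT \<sigma> \<tau> T F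
    assume \<epsilon>: "0 < \<epsilon>" and lip: "lipschitz_domain \<Omega>" and mesh: "conforming_mesh \<Omega> \<T>"
      and reg: "shape_regular \<kappa> \<T>" and dia: "\<And>K. K \<in> \<T> \<Longrightarrow> diameter K \<le> D"
      and \<sigma>: "\<sigma> \<in> Hdiv_mesh \<Omega> \<T>" and tr: "\<And>\<phi>. \<phi> \<in> test_functions \<Omega> \<Longrightarrow> tr_grad \<Omega> \<T> \<phi> \<sigma> = 0"
      and \<tau>: "\<tau> \<in> Sigma_h \<epsilon> \<Omega> \<T> zT" and T: "T \<in> \<T>" and F: "F facet_of T"
    interpret A: simplex_facet T F by (rule simplex_facetI[OF mesh T F])
    have op: "open \<Omega>" using lip by (simp add: lipschitz_domain_def)
    have \<Omega>s: "\<Omega> \<in> sets lebesgue" using op by auto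
    define h where "h = diameter T"
    have h: "0 < h" "h \<le> D" using A.diameter_pos dia[OF T] by (simp_all add: h_def)
    let ?e = "\<lambda>x. \<sigma> x - \<tau> x"
    define U where "U = patch \<T> T"
    define E where "E = l2_norm U ?e"
    define V where "V = l2_norm U (pw_div \<T> ?e)"
    have \<tau>H: "\<tau> \<in> Hdiv_mesh \<Omega> \<T>" using \<tau> by (simp add: Sigma_h_def)
    have eH: "?e \<in> Hdiv_mesh \<Omega> \<T>" by (rule Hdiv_mesh_diff[OF mesh \<Omega>s \<sigma> \<tau>H])
    let ?J = "normal_jump \<T> F \<tau>"
    let ?I = "flat_surface_integral A.n (F - frontier \<Omega>) (\<lambda>x. (?J x)\<^sup>2)"
    have X0: "0 \<le> C * (E\<^sup>2 + \<epsilon>\<^sup>2 * V\<^sup>2)" using C0 by simp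
    have Fc: "compact F" using A.F_hull A.finite_vertices by (metis finite_Diff finite_imp_compact_convex_hull)
    have flat: "?I \<le> B * (C4 * h ^ (?N - 1))" if B: "0 \<le> B" "\<And>x. x \<in> F - frontier \<Omega> \<Longrightarrow> (?J x)\<^sup>2 \<le> B" for B
      unfolding C4_def \<omega>_def
    proof (rule flat_surface_integral_le[OF A.norm_n _ _ h])
      show "F - frontier \<Omega> \<in> sets borel" using Fc by (intro sets.Diff) (auto intro: borel_closed compact_imp_closed)
      show "(y - x) \<bullet> A.n = 0" if "x \<in> F - frontier \<Omega>" "y \<in> F - frontier \<Omega>" for x y
        using that A.F_normal by blast
      show "dist x y \<le> h" if "x \<in> F - frontier \<Omega>" "y \<in> F - frontier \<Omega>" for x y
        unfolding h_def using that A.F_subset by (intro A.dist_le_diameter) auto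
    qed (use B in auto)
    have "min \<epsilon> h * ?I \<le> C * (E\<^sup>2 + \<epsilon>\<^sup>2 * V\<^sup>2)"
    proof (cases "F \<subseteq> frontier \<Omega>")
      case True
      \<comment> \<open>On a boundary facet the domain of integration is empty.\<close>
      have "?I \<le> 0" using flat[of 0] True by auto
      then have "min \<epsilon> h * ?I \<le> 0" using \<epsilon> h by (simp add: mult_nonneg_nonpos)
      then show ?thesis using X0 by simp
    next
      case False
      obtain T' where T': "T' \<in> \<T>" "T' \<noteq> T" "F facet_of T'" using mesh_neighbour[OF mesh op T F False] .
      interpret B: simplex_facet T' F by (rule simplex_facetI[OF mesh T'(1,3)])
      note pair = mesh_facet_pair[OF mesh T F T'(1,3,2)]
      have reg': "norm (full_simplex.bary_grad K v) * diameter K \<le> \<Lambda>" if K: "K \<in> \<T>" and v: "v \<in> vertices K" for K v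
      proof -
        have "diameter K ^ ?N / measure lebesgue K \<le> \<kappa>" using reg K by (simp add: shape_regular_def)
        from full_simplex.bary_grad_le[OF mesh_simplex[OF mesh K] this v] show ?thesis
          unfolding \<Lambda>_def \<omega>_def by linarith
      qed
      have gA: "norm (A.bary_grad v) \<le> \<Lambda> / h" if "v \<in> vertices T" for v
        using reg'[OF T that] h by (simp add: h_def field_simps)
      have hh: "h \<le> \<Lambda> * diameter T'"
        unfolding h_def by (rule A.diameter_le_neighbour[OF d reg'[OF T] B.full_simplex_axioms B.F_subset])
      \<comment> \<open>The gradients on the neighbour scale with its own diameter; rewriting them
        in terms of \<open>h\<close> costs the second factor \<open>\<Lambda>\<close>.\<close>
      have gB: "norm (B.bary_grad v) \<le> \<Lambda>\<^sup>2 / h" if "v \<in> vertices T'" for v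
      proof -
        have "norm (B.bary_grad v) * h \<le> norm (B.bary_grad v) * (\<Lambda> * diameter T')"
          using hh by (intro mult_left_mono) auto
        also have "\<dots> = \<Lambda> * (norm (B.bary_grad v) * diameter T')" by simp
        also have "\<dots> \<le> \<Lambda> * \<Lambda>" using reg'[OF T'(1) that] \<Lambda>1 by (intro mult_left_mono) auto
        finally show ?thesis using h by (simp add: field_simps power2_eq_square)
      qed
      obtain \<rho> where \<rho>: "\<rho> \<in> Sigma_h_local \<epsilon> T (zT T)" "\<And>x. x \<in> interior T \<Longrightarrow> \<tau> x = \<rho> x"
        using \<tau> T by (auto simp: Sigma_h_def)
      obtain \<rho>' where \<rho>': "\<rho>' \<in> Sigma_h_local \<epsilon> T' (zT T')" "\<And>x. x \<in> interior T' \<Longrightarrow> \<tau> x = \<rho>' x"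
        using \<tau> T'(1) by (auto simp: Sigma_h_def)
      note Ck\<rho> = A.Sigma_h_local_Ck[OF \<rho>(1)] and Ck\<rho>' = B.Sigma_h_local_Ck[OF \<rho>'(1)]
      note c\<rho> = Ck_vec_continuous[OF Ck\<rho>] and c\<rho>' = Ck_vec_continuous[OF Ck\<rho>']
      obtain a1 b1 where ab1: "\<And>x. x \<in> F \<Longrightarrow> \<rho> x \<bullet> A.n = a1 + b1 * facet_bubble T F x"
        using A.Sigma_h_local_normal_trace[OF \<rho>(1)] by blast
      obtain a2 b2 where ab2: "\<And>x. x \<in> F \<Longrightarrow> \<rho>' x \<bullet> B.n = a2 + b2 * facet_bubble T' F x"
        using B.Sigma_h_local_normal_trace[OF \<rho>'(1)] by blast
      define a b where "a = a1 + a2" and "b = b1 + b2"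
      define J where "J x = \<rho> x \<bullet> A.n + \<rho>' x \<bullet> B.n" for x
      have J_ab: "J x = a + b * facet_bubble T F x" if "x \<in> F" for x
        using ab1[OF that] ab2[OF that] facet_bubble_common[OF A.simplex_facet_axioms B.simplex_facet_axioms that]
        by (simp add: J_def a_def b_def algebra_simps)
      have J_jump: "?J x = J x" if "x \<in> F" for x
      proof -
        have xT: "x \<in> T" "x \<in> T'" using that A.F_subset B.F_subset by auto
        have "trace_from T \<tau> x = \<rho> x" "trace_from T' \<tau> x = \<rho>' x"
          using A.trace_from_eq[OF c\<rho> \<rho>(2) xT(1)] B.trace_from_eq[OF c\<rho>' \<rho>'(2) xT(2)] by auto
        then show ?thesis using T'(2) by (simp add: normal_jump_def pair(2) J_def)
      qed
      have Jc: "continuous_on UNIV J"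
        unfolding J_def[abs_def] by (intro continuous_intros c\<rho> c\<rho>')
      obtain p where p: "p \<in> F" "\<And>v. v \<in> vertices F \<Longrightarrow> 1 / (2 * real ?N) \<le> bary T v p"
        and b_le: "\<bar>b\<bar> \<le> 8 * q * \<bar>J p\<bar>"
        using A.ex_control_point[OF d, of b a] J_ab unfolding q_def by metis
      define M where "M = \<bar>J p\<bar>"
      have M0: "0 \<le> M" by (simp add: M_def)
      have b_M: "\<bar>b\<bar> \<le> 8 * q * M" using b_le by (simp add: M_def)
      have J_sup: "\<bar>J x\<bar> \<le> C1 * M" if x: "x \<in> F" for x
      proof -
        have eta: "\<bar>b * facet_bubble T F y\<bar> \<le> \<bar>b\<bar>" if "y \<in> F" for y
          using A.facet_bubble_bounds[OF that] by (simp add: abs_mult mult_left_le)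
        have "\<bar>J x\<bar> \<le> \<bar>J p\<bar> + \<bar>b * facet_bubble T F x\<bar> + \<bar>b * facet_bubble T F p\<bar>"
          unfolding J_ab[OF x] J_ab[OF p(1)] by linarith
        also have "\<dots> \<le> M + \<bar>b\<bar> + \<bar>b\<bar>" using eta[OF x] eta[OF p(1)] by (simp add: M_def)
        also have "\<dots> \<le> C1 * M" using b_M by (simp add: C1_def algebra_simps)
        finally show ?thesis .
      qed
      define r where "r = c' * h"
      have r0: "0 < r" using c'0 h by (simp add: r_def)
      have den: "0 < 16 * real ?N * q * \<Lambda>\<^sup>2 * D" using q1 \<Lambda>1 D N1 by simp
      have r1: "r \<le> 1"
      proof -
        have "h \<le> 1 * D" using h by simp
        also have "\<dots> \<le> (16 * real ?N * q * \<Lambda>\<^sup>2) * D"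
        proof (rule mult_right_mono)
          have "1 \<le> real ?N * q" using mult_mono[OF N1 q1] by simp
          then have "1 \<le> real ?N * q * \<Lambda>\<^sup>2" using mult_mono[OF _ prods, of 1 "real ?N * q"] by simp
          then show "1 \<le> 16 * real ?N * q * \<Lambda>\<^sup>2" by simp
        qed (use D in simp)
        finally show ?thesis unfolding r_def c'_def using den by (simp add: field_simps)
      qed
      have Gr: "\<Lambda>\<^sup>2 / h * r \<le> 1 / (16 * real ?N * q)"
      proof -
        have "\<Lambda>\<^sup>2 / h * r = 1 / (16 * real ?N * q * D)"
          unfolding r_def c'_def using h \<Lambda>1 by simp
        also have "\<dots> \<le> 1 / (16 * real ?N * q)"
          using D N1 q1 by (intro divide_left_mono) auto
        finally show ?thesis .
      qed
      have small: "2 * (1 / (16 * real ?N * q)) \<le> 1 / (2 * real ?N)"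
      proof -
        have "2 * (1 / (16 * real ?N * q)) = 1 / (8 * real ?N * q)" by simp
        also have "\<dots> \<le> 1 / (2 * real ?N)" using N1 q1 by (intro divide_left_mono) auto
        finally show ?thesis .
      qed
      have \<Lambda>le: "\<Lambda> / h \<le> \<Lambda>\<^sup>2 / h"
        using \<Lambda>1 h by (intro divide_right_mono) (auto simp: power2_eq_square)
      have nearA: "0 \<le> bary T v x" if "x \<in> cball p (2 * r)" "v \<in> vertices F" for x v
      proof (rule A.bary_ge_near[OF p(2)[OF that(2)] _ that(1)])
        have "norm (A.bary_grad v) * r \<le> \<Lambda>\<^sup>2 / h * r"
          using gA[of v] that(2) A.vertices_F \<Lambda>le r0 by (intro mult_right_mono) auto
        then show "norm (A.bary_grad v) * (2 * r) \<le> 1 / (2 * real ?N)" using Gr small by linarith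
      qed
      have nearB: "0 \<le> bary T' v x" if "x \<in> cball p (2 * r)" "v \<in> vertices F" for x v
      proof (rule B.bary_ge_near[OF _ _ that(1)])
        show "1 / (2 * real ?N) \<le> bary T' v p"
          using p(2)[OF that(2)] bary_on_common_facet[OF A.simplex_facet_axioms B.simplex_facet_axioms p(1) that(2)] by simp
        have "norm (B.bary_grad v) * r \<le> \<Lambda>\<^sup>2 / h * r"
          using gB[of v] that(2) B.vertices_F r0 by (intro mult_right_mono) auto
        then show "norm (B.bary_grad v) * (2 * r) \<le> 1 / (2 * real ?N)" using Gr small by linarith
      qed
      have cball2: "x \<in> cball p (2 * r)" if "x \<in> cball p r" for x using that r0 by simp
      define s where "s = (if 0 \<le> J p then 1 else - 1 :: real)"
      have s: "\<bar>s\<bar> = 1" "s * J p = M" by (auto simp: s_def M_def)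
      \<comment> \<open>A point of the hyperplane near \<open>p\<close> lies in \<open>F\<close>,
        where the jump has the form \<open>a + b \<eta>\<close>. The coefficient bound and the
        Lipschitz bound of the bubble give a variation of at most \<open>M / 2\<close>.\<close>
      have J_low: "M / 2 \<le> s * J x" if x: "x \<in> cball p r" "(x - p) \<bullet> A.n = 0" for x
      proof -
        have "x \<in> T" using A.mem_T_iff_halfspace[OF p(1) nearA[OF cball2[OF x(1)]]] x(2) by simp
        moreover have "bary T A.apex x = 0" using A.bary_apex[OF p(1), of x] x(2) by simp
        ultimately have xF: "x \<in> F" using A.mem_F_iff by blast
        have "\<bar>J x - J p\<bar> = \<bar>b\<bar> * \<bar>facet_bubble T F x - facet_bubble T F p\<bar>"
          unfolding J_ab[OF xF] J_ab[OF p(1)] by (simp add: abs_mult[symmetric] right_diff_distrib)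
        also have "\<dots> \<le> \<bar>b\<bar> * (real ?N * (\<Lambda> / h * norm (x - p)))"
          by (intro mult_left_mono A.facet_bubble_Lipschitz[OF gA xF p(1)]) auto
        also have "\<dots> \<le> (8 * q * M) * (real ?N * (\<Lambda>\<^sup>2 / h * r))"
        proof (intro mult_mono b_M \<Lambda>le order_refl)
          show "norm (x - p) \<le> r" using x(1) by (simp add: dist_norm norm_minus_commute)
        qed (use \<Lambda>1 h r0 M0 q1 in auto)
        also have "\<dots> \<le> (8 * q * M) * (real ?N * (1 / (16 * real ?N * q)))"
          using Gr M0 q1 by (intro mult_left_mono) auto
        also have "\<dots> = M / 2" using N1 q1 by simp
        finally have "\<bar>J x - J p\<bar> \<le> M / 2" .
        then have "\<bar>s * (J x - J p)\<bar> \<le> M / 2" using s(1) by (simp add: abs_mult)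
        then show ?thesis using s(2) unfolding right_diff_distrib by linarith
      qed
      \<comment> \<open>At most \<open>\<epsilon>\<close>, so that \<open>\<delta>\<^sup>2\<close>
        is absorbed by the weight of the divergence error, and at most \<open>r\<close>, as the
        layer estimates require.\<close>
      define \<delta> where "\<delta> = min \<epsilon> r"
      have \<delta>: "0 < \<delta>" "\<delta> \<le> r" "\<delta> \<le> \<epsilon>" using \<epsilon> r0 by (auto simp: \<delta>_def)
      define \<phi> where "\<phi> = layer_bump p A.n r \<delta>"
      have supp: "\<phi> x = 0" if "x \<notin> cball p r \<or> \<delta> \<le> \<bar>(x - p) \<bullet> A.n\<bar>" for x
        unfolding \<phi>_def by (rule layer_bump_outside[OF r0 \<delta>(1) that])
      \<comment> \<open>The doubled radius leaves room: the open ball of radius \<open>2 * r\<close>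
        lies in the interior of the closure of the domain, which is the domain, so the closed ball
        of radius \<open>r\<close> is an admissible support.\<close>
      have ballT: "ball p (2 * r) \<subseteq> T \<union> T'"
      proof
        fix x assume "x \<in> ball p (2 * r)"
        then have x: "x \<in> cball p (2 * r)" by simp
        show "x \<in> T \<union> T'"
          using A.mem_T_iff_halfspace[OF p(1) nearA[OF x]] B.mem_T_iff_halfspace[OF p(1) nearB[OF x]] pair(1) by auto
      qed
      have "ball p (2 * r) \<subseteq> closure \<Omega>" using ballT T T'(1) mesh_Union[OF mesh] by blast
      then have "ball p (2 * r) \<subseteq> interior (closure \<Omega>)" by (intro interior_maximal) auto
      then have "cball p r \<subseteq> \<Omega>" using lipschitz_domain_interior_closure[OF lip] r0 by auto
      then have \<phi>: "\<phi> \<in> test_functions \<Omega>"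
        using supp unfolding \<phi>_def by (intro test_functionsI[OF layer_bump_Ck compact_cball]) auto
      define H where "H = hyperplane_integral p A.n (\<lambda>x. \<phi> x * J x)"
      have H_eq: "H = - (tested \<phi> ?e T + tested \<phi> ?e T')"
        unfolding H_def J_def
      proof (rule jump_identity[OF lip mesh T F T'(1,3,2) \<sigma> tr[OF \<phi>] \<tau>H Ck\<rho> \<rho>(2) Ck\<rho>' \<rho>'(2) \<phi> _ p(1)])
        show "\<phi> x = 0" if "x \<notin> cball p r" for x using supp that by blast
      qed (use nearA nearB cball2 in blast)+
      define u v where "u = l2_norm UNIV \<phi>" and "v = l2_norm UNIV (grad \<phi>)"
      note patch = patch_props[where T = T, OF lip mesh, folded U_def]
      have "interior T \<subseteq> U" "interior T' \<subseteq> U"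
        using patch(4)[OF T] patch(4)[OF T'(1)] p(1) A.F_subset B.F_subset by blast+
      then have "\<bar>tested \<phi> ?e T\<bar> \<le> V * u + E * v" "\<bar>tested \<phi> ?e T'\<bar> \<le> V * u + E * v"
        unfolding V_def E_def u_def v_def
        using tested_le[OF mesh eH op patch(1-3) T _ \<phi>] tested_le[OF mesh eH op patch(1-3) T'(1) _ \<phi>] by blast+
      moreover have "\<bar>- (x + y)\<bar> \<le> 2 * z" if "\<bar>x\<bar> \<le> z" "\<bar>y\<bar> \<le> z" for x y z :: real
        using that by linarith
      ultimately have H_le: "\<bar>H\<bar> \<le> 2 * (V * u + E * v)" unfolding H_eq by blast
      define Y where "Y = r ^ (?N - 1)"
      have Y0: "0 < Y" using r0 by (simp add: Y_def)
      have "exp_bump 0 (3/4) * exp_bump 0 1 * (M / 2) * (unit_ball_vol CARD('n) / 4 ^ CARD('n) * (r / 2) ^ (CARD('n) - 1))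
          \<le> s * H"
        unfolding H_def \<phi>_def
        by (rule hyperplane_integral_ge[OF Jc A.norm_n r0 r1 \<delta>(1) _ J_low]) (use M0 in auto)
      also have "s * H \<le> \<bar>H\<bar>" using s(1) abs_ge_self[of "s * H"] by (simp add: abs_mult)
      also note H_le
      also have "exp_bump 0 (3/4) * exp_bump 0 1 * (M / 2) * (unit_ball_vol CARD('n) / 4 ^ CARD('n) * (r / 2) ^ (CARD('n) - 1))
          = k * M * Y"
        unfolding k_def Y_def \<omega>_def by (simp add: power_divide)
      finally have main: "k * M * Y \<le> 2 * (V * u + E * v)" .
      have c: "continuous_on UNIV \<phi>" "continuous_on UNIV (grad \<phi>)" using test_functions_continuous[OF \<phi>] by auto
      have u2: "u\<^sup>2 \<le> K0 * Y * \<delta>"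
      proof -
        have "u\<^sup>2 \<le> 1\<^sup>2 * (2 * 3 ^ ?N * unit_ball_vol ?N * r ^ (?N - 1) * \<delta>)"
          unfolding u_def
          by (rule l2_norm_layer_le[OF c(1) \<delta>(1,2) A.norm_n _ supp])
            (use layer_bump_bounds[of p A.n r \<delta>] in \<open>auto simp: \<phi>_def\<close>)
        then show ?thesis by (simp add: K0_def \<omega>_def Y_def)
      qed
      have v2: "v\<^sup>2 \<le> (8 / \<delta>)\<^sup>2 * (K0 * Y * \<delta>)"
      proof -
        have "v\<^sup>2 \<le> (8 / \<delta>)\<^sup>2 * (2 * 3 ^ ?N * unit_ball_vol ?N * r ^ (?N - 1) * \<delta>)"
          unfolding v_def
        proof (rule l2_norm_layer_le[where p = p, OF c(2) \<delta>(1,2) A.norm_n])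
          show "norm (grad \<phi> x) \<le> 8 / \<delta>" for x
            unfolding \<phi>_def by (rule layer_bump_grad(1)[OF \<delta>(1,2) A.norm_n])
          show "grad \<phi> x = 0" if "x \<notin> cball p r \<or> \<delta> \<le> \<bar>(x - p) \<bullet> A.n\<bar>" for x
            unfolding \<phi>_def by (rule layer_bump_grad(2)[OF \<delta>(1,2) A.norm_n that])
        qed simp
        then show ?thesis by (simp only: K0_def \<omega>_def Y_def)
      qed
      have K00: "0 \<le> K0" using \<omega>0 by (simp add: K0_def)
      have "M\<^sup>2 * Y * \<delta> \<le> 512 * K0 / k\<^sup>2 * (V\<^sup>2 * \<delta>\<^sup>2 + E\<^sup>2)"
        by (rule absorb_sqrt_bounds[OF main k0 M0 Y0 \<delta>(1) K00 _ _ _ _ u2 v2])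
          (simp_all add: V_def E_def u_def v_def)
      also have "\<dots> \<le> 512 * K0 / k\<^sup>2 * (E\<^sup>2 + \<epsilon>\<^sup>2 * V\<^sup>2)"
      proof (rule mult_left_mono)
        have "V\<^sup>2 * \<delta>\<^sup>2 \<le> V\<^sup>2 * \<epsilon>\<^sup>2" using \<delta> by (intro mult_left_mono power_mono) auto
        then show "V\<^sup>2 * \<delta>\<^sup>2 + E\<^sup>2 \<le> E\<^sup>2 + \<epsilon>\<^sup>2 * V\<^sup>2" by (simp add: mult.commute)
      qed (use K00 in simp)
      finally have bound: "M\<^sup>2 * Y * \<delta> \<le> 512 * K0 / k\<^sup>2 * (E\<^sup>2 + \<epsilon>\<^sup>2 * V\<^sup>2)" .
      have C40: "0 \<le> C4" using D \<omega>0 by (simp add: C4_def)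
      have I_le: "?I \<le> (C1 * M)\<^sup>2 * (C4 * h ^ (?N - 1))"
      proof (rule flat)
        fix x assume "x \<in> F - frontier \<Omega>"
        then have "\<bar>?J x\<bar> \<le> C1 * M" using J_sup J_jump by simp
        then show "(?J x)\<^sup>2 \<le> (C1 * M)\<^sup>2" using power_mono[of "\<bar>?J x\<bar>" "C1 * M" 2] by simp
      qed simp
      have c'1: "c' \<le> 1"
      proof -
        have "1 \<le> real ?N * q" using mult_mono[OF N1 q1] by simp
        then have "1 \<le> real ?N * q * \<Lambda>\<^sup>2" using mult_mono[OF _ prods, of 1 "real ?N * q"] by simp
        then have "1 \<le> real ?N * q * \<Lambda>\<^sup>2 * D" using mult_mono[OF _ D, of 1 "real ?N * q * \<Lambda>\<^sup>2"] by simp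
        moreover have "1 / (16 * P) \<le> 1" if "1 \<le> P" for P :: real using that by simp
        ultimately show ?thesis unfolding c'_def mult.assoc by blast
      qed
      \<comment> \<open>Returns from \<open>\<delta>\<close> to the weight of the estimator:
        \<open>r\<close> is \<open>c' * h\<close> and \<open>c' \<le> 1\<close>.\<close>
      have min_le: "min \<epsilon> h \<le> \<delta> / c'"
      proof -
        have "c' * min \<epsilon> h \<le> \<epsilon>"
          using mult_mono[OF c'1, of "min \<epsilon> h" \<epsilon>] \<epsilon> h c'0 by (simp add: min_def split: if_splits)
        moreover have "c' * min \<epsilon> h \<le> r" unfolding r_def using c'0 by (intro mult_left_mono) auto
        ultimately have "c' * min \<epsilon> h \<le> \<delta>" by (simp add: \<delta>_def)
        then show ?thesis using c'0 by (simp add: field_simps)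
      qed
      have "min \<epsilon> h * ?I \<le> min \<epsilon> h * ((C1 * M)\<^sup>2 * (C4 * h ^ (?N - 1)))"
        using I_le \<epsilon> h by (intro mult_left_mono) auto
      also have "\<dots> \<le> \<delta> / c' * ((C1 * M)\<^sup>2 * (C4 * h ^ (?N - 1)))"
        using min_le C40 h by (intro mult_right_mono) auto
      \<comment> \<open>\<open>Y\<close> is the power \<open>d - 1\<close> of
        \<open>r = c' * h\<close>, so it absorbs that power of \<open>h\<close> at the cost of as
        many factors \<open>c'\<close>; one more comes from replacing the minimum by
        \<open>\<delta>\<close>.\<close>
      also have "\<dots> = C1\<^sup>2 * C4 / c' ^ ?N * (M\<^sup>2 * Y * \<delta>)"
      proof -
        have "c' ^ ?N = c' * c' ^ (?N - 1)" using power_eq_if[of c' ?N] by simp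
        moreover have "Y = c' ^ (?N - 1) * h ^ (?N - 1)" by (simp add: Y_def r_def power_mult_distrib)
        ultimately show ?thesis using c'0 by (simp add: power_mult_distrib)
      qed
      also have "\<dots> \<le> C1\<^sup>2 * C4 / c' ^ ?N * (512 * K0 / k\<^sup>2 * (E\<^sup>2 + \<epsilon>\<^sup>2 * V\<^sup>2))"
        using C40 c'0 by (intro mult_left_mono bound) auto
      finally show ?thesis by (simp only: C_def mult.assoc)
    qed
    then show "min \<epsilon> (diameter T) * ?I \<le> C * ((l2_norm (patch \<T> T) ?e)\<^sup>2 + \<epsilon>\<^sup>2 * (l2_norm (patch \<T> T) (pw_div \<T> ?e))\<^sup>2)"
      by (simp add: h_def E_def V_def U_def)
  qed
qed

section \<open>The estimator\<close>

text \<open>The projection error is at most the distance to any constant \<open>c\<close>, and the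
  detour over \<open>g\<close> splits it into an error and an approximation term.\<close>

lemma proj0_error_le:
  fixes f :: "real ^ 'n \<Rightarrow> 'b::euclidean_space"
  assumes T: "T \<in> lmeasurable" "0 < measure lebesgue T"
    and L: "f \<in> L2 T" "g \<in> L2 T"
  shows "(l2_norm T (\<lambda>x. f x - proj0 T f))\<^sup>2 \<le> 2 * (l2_norm T (\<lambda>x. g x - f x))\<^sup>2 + 2 * (l2_norm T (\<lambda>x. g x - c))\<^sup>2"
proof -
  have neg: "(l2_norm T (\<lambda>x. f x - g x))\<^sup>2 = (l2_norm T (\<lambda>x. g x - f x))\<^sup>2"
    by (simp add: l2_norm_sq norm_minus_commute)
  have "(l2_norm T (\<lambda>x. f x - proj0 T f))\<^sup>2 \<le> (l2_norm T (\<lambda>x. f x - c))\<^sup>2"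
    by (rule proj0_best_approximation[OF T L(1)])
  also have "(\<lambda>x. f x - c) = (\<lambda>x. (f x - g x) + (g x - c))" by auto
  also have "(l2_norm T (\<lambda>x. (f x - g x) + (g x - c)))\<^sup>2
      \<le> 2 * (l2_norm T (\<lambda>x. f x - g x))\<^sup>2 + 2 * (l2_norm T (\<lambda>x. g x - c))\<^sup>2"
    by (intro l2_norm_add_sq_le L2_diff L L2_const[OF T(1)])
  finally show ?thesis unfolding neg .
qed

text \<open>Solving for \<open>b c\<close> makes \<open>(x - y) / k\<close> a lower bound of all
  competitors, hence of the infimum.\<close>

lemma le_cINF_affine:
  fixes b :: "'a \<Rightarrow> real"
  assumes "\<And>c. x \<le> y + k * b c" "0 < k"
  shows "x \<le> y + k * (INF c. b c)"
proof -
  have "(x - y) / k \<le> (INF c. b c)"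
  proof (rule cINF_greatest)
    show "(x - y) / k \<le> b c" for c
      using assms(1)[of c] assms(2) by (simp add: divide_le_eq algebra_simps)
  qed simp
  then show ?thesis using assms(2) by (simp add: divide_le_eq algebra_simps)
qed

lemma volume_terms_le:
  fixes \<sigma> \<tau> :: "real ^ 'n \<Rightarrow> real ^ 'n" and \<epsilon> :: real
  assumes lip: "lipschitz_domain \<Omega>" and mesh: "conforming_mesh \<Omega> \<T>" and T: "T \<in> \<T>"
    and \<sigma>: "\<sigma> \<in> Hdiv_mesh \<Omega> \<T>" and \<tau>: "\<tau> \<in> Hdiv_mesh \<Omega> \<T>" and f: "f \<in> L2 \<Omega>"
  defines "r \<equiv> \<lambda>x. \<epsilon> * weak_div T \<tau> x + f x"
    and "E \<equiv> (l2_norm (patch \<T> T) (\<lambda>x. \<sigma> x - \<tau> x))\<^sup>2"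
    and "V \<equiv> (l2_norm (patch \<T> T) (pw_div \<T> (\<lambda>x. \<sigma> x - \<tau> x)))\<^sup>2"
  shows "(l2_norm T (\<lambda>x. \<tau> x - proj0 T \<tau>))\<^sup>2 \<le> 2 * E + 2 * (INF c. (l2_norm T (\<lambda>x. \<sigma> x - c))\<^sup>2)"
    and "(l2_norm T (\<lambda>x. r x - proj0 T r))\<^sup>2 \<le> (2 * (\<epsilon>\<^sup>2 * V) + 4 * (l2_norm T (\<lambda>x. f x - proj0 T f))\<^sup>2)
      + 4 * (INF c. \<epsilon>\<^sup>2 * (l2_norm T (\<lambda>x. pw_div \<T> \<sigma> x - c))\<^sup>2)"
proof -
  interpret full_simplex T by (rule mesh_simplex[OF mesh T])
  have op: "open \<Omega>" using lip by (simp add: lipschitz_domain_def)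
  have \<Omega>s: "\<Omega> \<in> sets lebesgue" using op by auto
  have I: "interior T \<in> sets lebesgue" by auto
  let ?e = "\<lambda>x. \<sigma> x - \<tau> x"
  have eH: "?e \<in> Hdiv_mesh \<Omega> \<T>" by (rule Hdiv_mesh_diff[OF mesh \<Omega>s \<sigma> \<tau>])
  have H: "\<sigma> \<in> Hdiv T" "\<tau> \<in> Hdiv T" "?e \<in> Hdiv T" using \<sigma> \<tau> eH T by (auto simp: Hdiv_mesh_def)
  have L: "\<sigma> \<in> L2 T" "\<tau> \<in> L2 T" using H by (auto simp: Hdiv_def)
  note W = H[THEN weak_div_works(1)]
  note P = patch_props[where T = T, OF lip mesh]
  have sub: "interior T \<subseteq> patch \<T> T" using P(4)[OF T] interior_nonempty interior_subset by blast
  note n = local_norms_le[OF mesh eH op P(1-3) T sub]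
  have fT: "f \<in> L2 T"
    by (rule L2_null_extend[OF L2_subset[OF f \<Omega>s I mesh_interior_subset[OF lip mesh T]] I T_sets interior_subset negligible_boundary])
  have ae: "AE x in lebesgue. x \<notin> T - interior T"
    using AE_not_in[of "T - interior T" lebesgue] negligible_boundary by (simp add: negligible_iff_null_sets)
  have E: "(l2_norm T ?e)\<^sup>2 \<le> E" unfolding E_def by (intro power_mono n) auto
  have "(l2_norm T (\<lambda>x. \<tau> x - proj0 T \<tau>))\<^sup>2 \<le> 2 * E + 2 * (l2_norm T (\<lambda>x. \<sigma> x - c))\<^sup>2" for c
    using proj0_error_le[OF T_lmeasurable measure_pos L(2,1), of c] E by simp
  then show "(l2_norm T (\<lambda>x. \<tau> x - proj0 T \<tau>))\<^sup>2 \<le> 2 * E + 2 * (INF c. (l2_norm T (\<lambda>x. \<sigma> x - c))\<^sup>2)"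
    by (rule le_cINF_affine) simp
  have V: "(l2_norm T (\<lambda>x. weak_div T \<sigma> x - weak_div T \<tau> x))\<^sup>2 \<le> V"
  proof -
    have "AE x in lebesgue. x \<in> T \<longrightarrow> weak_div T ?e x = weak_div T \<sigma> x - weak_div T \<tau> x"
      using ae Hdiv_diff(2)[OF T_sets H(1,2)] by eventually_elim auto
    then have "l2_norm T (weak_div T ?e) = l2_norm T (\<lambda>x. weak_div T \<sigma> x - weak_div T \<tau> x)"
      by (intro l2_norm_cong_AE W L2_diff T_sets)
    moreover have "(l2_norm T (weak_div T ?e))\<^sup>2 \<le> V" unfolding V_def by (intro power_mono n) auto
    ultimately show ?thesis by simp
  qed
  have pw: "l2_norm T (\<lambda>x. weak_div T \<sigma> x - c) = l2_norm T (\<lambda>x. pw_div \<T> \<sigma> x - c)" for c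
  proof -
    have eq: "AE x in lebesgue. x \<in> T \<longrightarrow> weak_div T \<sigma> x = pw_div \<T> \<sigma> x"
      using ae by eventually_elim (use pw_div_eq[OF mesh T] in auto)
    have "pw_div \<T> \<sigma> \<in> L2 T" by (rule L2_cong_AE[OF W(1) T_sets eq])
    then show ?thesis
      using eq by (intro l2_norm_cong_AE L2_diff W L2_const[OF T_lmeasurable] T_sets) (auto elim: AE_mp)
  qed
  have scale: "(l2_norm T (\<lambda>x. \<epsilon> * g x))\<^sup>2 = \<epsilon>\<^sup>2 * (l2_norm T g)\<^sup>2" for g :: "real ^ 'n \<Rightarrow> real"
    by (simp add: l2_norm_sq power_mult_distrib)
  have "(l2_norm T (\<lambda>x. r x - proj0 T r))\<^sup>2 \<le> (2 * (\<epsilon>\<^sup>2 * V) + 4 * (l2_norm T (\<lambda>x. f x - proj0 T f))\<^sup>2)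
      + 4 * (\<epsilon>\<^sup>2 * (l2_norm T (\<lambda>x. pw_div \<T> \<sigma> x - c))\<^sup>2)" for c
  proof -
    let ?g = "\<lambda>x. \<epsilon> * weak_div T \<sigma> x + f x"
    \<comment> \<open>The competitor for the residual: \<open>c\<close> approximates the divergence
      and the mean takes care of \<open>f\<close>, so that only the oscillation of \<open>f\<close>
      remains.\<close>
    let ?c = "\<epsilon> * c + proj0 T f"
    have "(l2_norm T (\<lambda>x. r x - proj0 T r))\<^sup>2 \<le> 2 * (l2_norm T (\<lambda>x. ?g x - r x))\<^sup>2 + 2 * (l2_norm T (\<lambda>x. ?g x - ?c))\<^sup>2"
      unfolding r_def by (intro proj0_error_le T_lmeasurable measure_pos L2_add L2_cmult W fT)
    also have "(\<lambda>x. ?g x - r x) = (\<lambda>x. \<epsilon> * (weak_div T \<sigma> x - weak_div T \<tau> x))"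
      by (auto simp: r_def algebra_simps)
    also have "(\<lambda>x. ?g x - ?c) = (\<lambda>x. \<epsilon> * (weak_div T \<sigma> x - c) + (f x - proj0 T f))"
      by (auto simp: algebra_simps)
    also have "2 * (l2_norm T (\<lambda>x. \<epsilon> * (weak_div T \<sigma> x - weak_div T \<tau> x)))\<^sup>2
        + 2 * (l2_norm T (\<lambda>x. \<epsilon> * (weak_div T \<sigma> x - c) + (f x - proj0 T f)))\<^sup>2
      \<le> 2 * (\<epsilon>\<^sup>2 * V) + 2 * (2 * (l2_norm T (\<lambda>x. \<epsilon> * (weak_div T \<sigma> x - c)))\<^sup>2 + 2 * (l2_norm T (\<lambda>x. f x - proj0 T f))\<^sup>2)"
    proof (intro add_mono mult_left_mono)
      show "(l2_norm T (\<lambda>x. \<epsilon> * (weak_div T \<sigma> x - weak_div T \<tau> x)))\<^sup>2 \<le> \<epsilon>\<^sup>2 * V"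
        unfolding scale using V by (intro mult_left_mono) auto
      show "(l2_norm T (\<lambda>x. \<epsilon> * (weak_div T \<sigma> x - c) + (f x - proj0 T f)))\<^sup>2
        \<le> 2 * (l2_norm T (\<lambda>x. \<epsilon> * (weak_div T \<sigma> x - c)))\<^sup>2 + 2 * (l2_norm T (\<lambda>x. f x - proj0 T f))\<^sup>2"
        by (intro l2_norm_add_sq_le L2_cmult L2_diff W fT L2_const[OF T_lmeasurable])
    qed auto
    finally show ?thesis unfolding scale pw by simp
  qed
  then show "(l2_norm T (\<lambda>x. r x - proj0 T r))\<^sup>2 \<le> (2 * (\<epsilon>\<^sup>2 * V) + 4 * (l2_norm T (\<lambda>x. f x - proj0 T f))\<^sup>2)
      + 4 * (INF c. \<epsilon>\<^sup>2 * (l2_norm T (\<lambda>x. pw_div \<T> \<sigma> x - c))\<^sup>2)"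
    by (rule le_cINF_affine) simp
qed

theorem corollary22:
  fixes \<Omega> :: "(real ^ 'n) set" and \<kappa> :: real
  assumes "CARD('n) = 2 \<or> CARD('n) = 3"
    and "bounded \<Omega>" and "lipschitz_domain \<Omega>" and "polyhedral_boundary \<Omega>"
  shows "\<exists>C>0. \<forall>\<epsilon> \<T> zT f \<sigma> w \<sigma>h wh.
    0 < \<epsilon> \<longrightarrow> \<epsilon> \<le> 1 \<longrightarrow> conforming_mesh \<Omega> \<T> \<longrightarrow> shape_regular \<kappa> \<T> \<longrightarrow>
    (\<forall>T\<in>\<T>. zT T \<in> vertices T) \<longrightarrow> f \<in> L2 \<Omega> \<longrightarrow>
    solves_dual \<epsilon> \<Omega> \<T> f (Hdiv_mesh \<Omega> \<T>) (W_space \<Omega> \<T>) \<sigma> w \<longrightarrow>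
    solves_dual \<epsilon> \<Omega> \<T> f (Sigma_h \<epsilon> \<Omega> \<T> zT) (Wh_space \<Omega> \<T>) \<sigma>h wh \<longrightarrow>
    (\<forall>T\<in>\<T>. estimator_sq \<epsilon> \<Omega> \<T> f \<sigma>h T \<le> C *
      ((l2_norm (patch \<T> T) (\<lambda>x. \<sigma> x - \<sigma>h x))\<^sup>2
       + \<epsilon>\<^sup>2 * (l2_norm (patch \<T> T) (pw_div \<T> (\<lambda>x. \<sigma> x - \<sigma>h x)))\<^sup>2
       + (INF c. (l2_norm T (\<lambda>x. \<sigma> x - c))\<^sup>2)
       + (INF c. \<epsilon>\<^sup>2 * (l2_norm T (\<lambda>x. pw_div \<T> \<sigma> x - c))\<^sup>2)
       + (l2_norm T (\<lambda>x. f x - proj0 T f))\<^sup>2))"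
proof -
  have d: "2 \<le> CARD('n)" using assms(1) by auto
  note lip = assms(3)
  have op: "open \<Omega>" using lip by (simp add: lipschitz_domain_def)
  \<comment> \<open>Every element lies in the closure of the bounded domain, so its diameter bounds
    that of all elements of all meshes.\<close>
  define D where "D = max 1 (diameter (closure \<Omega>))"
  have D: "1 \<le> D" by (simp add: D_def)
  obtain C where C: "0 < C" "\<And>\<epsilon> (\<Omega> :: (real ^ 'n) set) \<T> zT \<sigma> \<tau> T F.
    0 < \<epsilon> \<Longrightarrow> lipschitz_domain \<Omega> \<Longrightarrow> conforming_mesh \<Omega> \<T> \<Longrightarrow> shape_regular \<kappa> \<T> \<Longrightarrow>
    (\<And>K. K \<in> \<T> \<Longrightarrow> diameter K \<le> D) \<Longrightarrow> \<sigma> \<in> Hdiv_mesh \<Omega> \<T> \<Longrightarrow>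
    (\<And>\<phi>. \<phi> \<in> test_functions \<Omega> \<Longrightarrow> tr_grad \<Omega> \<T> \<phi> \<sigma> = 0) \<Longrightarrow>
    \<tau> \<in> Sigma_h \<epsilon> \<Omega> \<T> zT \<Longrightarrow> T \<in> \<T> \<Longrightarrow> F facet_of T \<Longrightarrow>
    min \<epsilon> (diameter T) * flat_surface_integral (outer_normal T F) (F - frontier \<Omega>) (\<lambda>x. (normal_jump \<T> F \<tau> x)\<^sup>2)
      \<le> C * ((l2_norm (patch \<T> T) (\<lambda>x. \<sigma> x - \<tau> x))\<^sup>2
        + \<epsilon>\<^sup>2 * (l2_norm (patch \<T> T) (pw_div \<T> (\<lambda>x. \<sigma> x - \<tau> x)))\<^sup>2)"
    using facet_jump_bound[OF d D] by blast
  \<comment> \<open>4 is the largest coefficient in the volume terms; a simplex has at most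
    \<open>Suc CARD('n)\<close> facets, each of which contributes \<open>C\<close>.\<close>
  define C' where "C' = 4 + real (Suc CARD('n)) * C"
  have C'0: "0 < C'" using C(1) by (simp add: C'_def add_pos_nonneg)
  show ?thesis
  proof (intro exI[of _ C'] conjI C'0 allI impI ballI)
    fix \<epsilon> \<T> zT f \<sigma> w \<sigma>h wh T
    assume \<epsilon>: "0 < \<epsilon>" and mesh: "conforming_mesh \<Omega> \<T>" and reg: "shape_regular \<kappa> \<T>"
      and f: "f \<in> L2 \<Omega>"
      and sol: "solves_dual \<epsilon> \<Omega> \<T> f (Hdiv_mesh \<Omega> \<T>) (W_space \<Omega> \<T>) \<sigma> w"
      and solh: "solves_dual \<epsilon> \<Omega> \<T> f (Sigma_h \<epsilon> \<Omega> \<T> zT) (Wh_space \<Omega> \<T>) \<sigma>h wh"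
      and T: "T \<in> \<T>"
    define X1 where "X1 = (l2_norm (patch \<T> T) (\<lambda>x. \<sigma> x - \<sigma>h x))\<^sup>2"
    define X2 where "X2 = \<epsilon>\<^sup>2 * (l2_norm (patch \<T> T) (pw_div \<T> (\<lambda>x. \<sigma> x - \<sigma>h x)))\<^sup>2"
    define X3 where "X3 = (INF c. (l2_norm T (\<lambda>x. \<sigma> x - c))\<^sup>2)"
    define X4 where "X4 = (INF c. \<epsilon>\<^sup>2 * (l2_norm T (\<lambda>x. pw_div \<T> \<sigma> x - c))\<^sup>2)"
    define X5 where "X5 = (l2_norm T (\<lambda>x. f x - proj0 T f))\<^sup>2"
    have X: "0 \<le> X1" "0 \<le> X2" "0 \<le> X3" "0 \<le> X4" "0 \<le> X5"
      by (auto simp: X1_def X2_def X3_def X4_def X5_def intro!: cINF_greatest)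
    have \<sigma>: "\<sigma> \<in> Hdiv_mesh \<Omega> \<T>" using sol by (simp add: solves_dual_def)
    have \<sigma>h: "\<sigma>h \<in> Sigma_h \<epsilon> \<Omega> \<T> zT" using solh by (simp add: solves_dual_def)
    then have \<sigma>hH: "\<sigma>h \<in> Hdiv_mesh \<Omega> \<T>" by (simp add: Sigma_h_def)
    \<comment> \<open>The constraint equation tested with the trace of a test function;
      \<open>\<epsilon>\<close> is divided out.\<close>
    have tr: "tr_grad \<Omega> \<T> \<phi> \<sigma> = 0" if "\<phi> \<in> test_functions \<Omega>" for \<phi>
    proof -
      have "tr_grad \<Omega> \<T> \<phi> \<in> W_space \<Omega> \<T>"
        unfolding W_space_def using test_functions_H10[OF that op] by blast
      then have "b_dual \<epsilon> (tr_grad \<Omega> \<T> \<phi>) \<sigma> = 0" using sol by (simp add: solves_dual_def)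
      then show ?thesis using \<epsilon> by (simp add: b_dual_def)
    qed
    have dia: "diameter K \<le> D" if "K \<in> \<T>" for K
    proof -
      have "diameter K \<le> diameter (closure \<Omega>)"
        using mesh_Union[OF mesh] that assms(2) by (intro diameter_subset) auto
      then show ?thesis by (simp add: D_def)
    qed
    have facets: "min \<epsilon> (diameter T) * jump_norm_sq \<Omega> \<T> \<sigma>h T \<le> real (Suc CARD('n)) * C * (X1 + X2)"
    proof -
      interpret full_simplex T by (rule mesh_simplex[OF mesh T])
      obtain v where "v \<in> vertices T" using ex_other_vertex by blast
      then have "convex hull (vertices T - {v}) facet_of T" unfolding facet_iff by blast
      note fin = finite_card_facets[OF simplex_facetI[OF mesh T this]]
      have "min \<epsilon> (diameter T) * jump_norm_sq \<Omega> \<T> \<sigma>h T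
        = (\<Sum>F | F facet_of T. min \<epsilon> (diameter T) *
            flat_surface_integral (outer_normal T F) (F - frontier \<Omega>) (\<lambda>x. (normal_jump \<T> F \<sigma>h x)\<^sup>2))"
        by (simp add: jump_norm_sq_def sum_distrib_left)
      also have "\<dots> \<le> (\<Sum>F | F facet_of T. C * (X1 + X2))"
        unfolding X1_def X2_def
        by (intro sum_mono C(2)[OF \<epsilon> lip mesh reg dia \<sigma> tr \<sigma>h T]) auto
      also have "\<dots> = real (card {F. F facet_of T}) * (C * (X1 + X2))" by simp
      also have "\<dots> \<le> real (Suc CARD('n)) * (C * (X1 + X2))"
        using fin(2) C(1) X by (intro mult_right_mono) auto
      finally show ?thesis by simp
    qed
    note vol = volume_terms_le(1)[OF lip mesh T \<sigma> \<sigma>hH f, folded X1_def X3_def]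
      volume_terms_le(2)[where \<epsilon> = \<epsilon>, OF lip mesh T \<sigma> \<sigma>hH f, folded X2_def X4_def X5_def]
    have "estimator_sq \<epsilon> \<Omega> \<T> f \<sigma>h T
        \<le> (2 * X2 + 4 * X5 + 4 * X4) + (2 * X1 + 2 * X3) + real (Suc CARD('n)) * C * (X1 + X2)"
      unfolding estimator_sq_def Let_def using vol facets by (intro add_mono) auto
    also have "\<dots> \<le> 4 * (X1 + X2 + X3 + X4 + X5) + real (Suc CARD('n)) * C * (X1 + X2 + X3 + X4 + X5)"
    proof (rule add_mono)
      show "(2 * X2 + 4 * X5 + 4 * X4) + (2 * X1 + 2 * X3) \<le> 4 * (X1 + X2 + X3 + X4 + X5)"
        using X by simp
      show "real (Suc CARD('n)) * C * (X1 + X2) \<le> real (Suc CARD('n)) * C * (X1 + X2 + X3 + X4 + X5)"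
        using X C(1) by (intro mult_left_mono) auto
    qed
    also have "\<dots> = C' * (X1 + X2 + X3 + X4 + X5)" by (simp only: C'_def distrib_right)
    finally show "estimator_sq \<epsilon> \<Omega> \<T> f \<sigma>h T \<le> C' *
      ((l2_norm (patch \<T> T) (\<lambda>x. \<sigma> x - \<sigma>h x))\<^sup>2
       + \<epsilon>\<^sup>2 * (l2_norm (patch \<T> T) (pw_div \<T> (\<lambda>x. \<sigma> x - \<sigma>h x)))\<^sup>2
       + (INF c. (l2_norm T (\<lambda>x. \<sigma> x - c))\<^sup>2)
       + (INF c. \<epsilon>\<^sup>2 * (l2_norm T (\<lambda>x. pw_div \<T> \<sigma> x - c))\<^sup>2)
       + (l2_norm T (\<lambda>x. f x - proj0 T f))\<^sup>2)"
      by (simp only: X1_def X2_def X3_def X4_def X5_def)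
  qed
qed

end
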